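(* Suppose the real input sequence $\{x_i\}_{i\ge 0}$ satisfies (A1) or (A2) or (A3). Let $RC_n=((x_{(i+j)\bmod n}))_{1\le i,j\le n}$ be the Reverse Circulant matrix and let $\widehat{RC}_n=M_n\odot RC_n$. Then the LSD of $n^{-1/2}\widehat{RC}_n$ exists and is the same as the LSD $\mathcal{L}_{RC}$ of $n^{-1/2}RC_n$.
   Context: Assumptions on the real input random variables: (A1) they are independent and uniformly bounded with mean $0$ and variance $1$; (A2) they are i.i.d. with mean $0$ and variance $1$; (A3) they are independent with mean $0$ and variance $1$, and with uniformly bounded moments of all orders. $M_n=((m_{ij}))_{1\le i,j\le n}$ is the symmetric matrix with $m_{ij}=1$ if $i+j<n+1$, $m_{ij}=0$ if $i+j=n+1$, and $m_{ij}=-1$ if $i+j>n+1$. The symbol $\odot$ denotes the entrywise (Schur–Hadamard) product. For a real symmetric $n\times n$ matrix $A$ with eigenvalues $\lambda_1,\dots,\lambda_n$, the empirical spectral distribution is $F^A(x)=\frac1n\#\{j:\lambda_j\le x\}$. A non-random distribution function $F$ is the limiting spectral distribution (LSD) of a sequence $A_n$ if, outside a null set, $F^{A_n}(x)\to F(x)$ as $n\to\infty$ at all continuity points $x$ of $F$. It is known that under any of (A1), (A2), (A3) the LSD of $n^{-1/2}RC_n$ exists and does not depend on the distribution of the input sequence; it is denoted $\mathcal{L}_{RC}$. *)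

theory Defs
  imports
    "HOL-Probability.Probability"
    "Jordan_Normal_Form.Char_Poly"
begin

section \<open>Input sequences\<close>

definition std_input :: "'a measure \<Rightarrow> (nat \<Rightarrow> 'a \<Rightarrow> real) \<Rightarrow> bool" where
  "std_input P x \<longleftrightarrow>
     prob_space P \<and>
     prob_space.indep_vars P (\<lambda>_. borel) x UNIV \<and>
     (\<forall>i. integrable P (x i) \<and> integrable P (\<lambda>\<omega>. (x i \<omega>)\<^sup>2) \<and>
          prob_space.expectation P (x i) = 0 \<and> prob_space.variance P (x i) = 1)"

definition input_A1 :: "'a measure \<Rightarrow> (nat \<Rightarrow> 'a \<Rightarrow> real) \<Rightarrow> bool" where
  "input_A1 P x \<longleftrightarrow> std_input P x \<and> (\<exists>B. \<forall>i. AE \<omega> in P. \<bar>x i \<omega>\<bar> \<le> B)"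

definition input_A2 :: "'a measure \<Rightarrow> (nat \<Rightarrow> 'a \<Rightarrow> real) \<Rightarrow> bool" where
  "input_A2 P x \<longleftrightarrow> std_input P x \<and> (\<forall>i j. distr P borel (x i) = distr P borel (x j))"

definition input_A3 :: "'a measure \<Rightarrow> (nat \<Rightarrow> 'a \<Rightarrow> real) \<Rightarrow> bool" where
  "input_A3 P x \<longleftrightarrow> std_input P x \<and>
     (\<forall>k::nat. \<exists>C. \<forall>i. integrable P (\<lambda>\<omega>. \<bar>x i \<omega>\<bar> ^ k) \<and>
                      prob_space.expectation P (\<lambda>\<omega>. \<bar>x i \<omega>\<bar> ^ k) \<le> C)"

section \<open>Limiting spectral distributions\<close>

text \<open>The multiset of roots of the characteristic polynomial lists the eigenvalues with their
  multiplicities; for a real symmetric matrix it has exactly \<open>dim_row A\<close> elements.\<close>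

definition esd :: "real mat \<Rightarrow> real \<Rightarrow> real" where
  "esd A t = real (size {# l \<in># proots (char_poly A). l \<le> t #}) / real (dim_row A)"

definition distribution_function :: "(real \<Rightarrow> real) \<Rightarrow> bool" where
  "distribution_function F \<longleftrightarrow>
     mono F \<and> (\<forall>t. continuous (at_right t) F) \<and>
     (F \<longlongrightarrow> 0) at_bot \<and> (F \<longlongrightarrow> 1) at_top"

definition is_LSD :: "'a measure \<Rightarrow> (nat \<Rightarrow> 'a \<Rightarrow> real mat) \<Rightarrow> (real \<Rightarrow> real) \<Rightarrow> bool" where
  "is_LSD P A F \<longleftrightarrow>
     distribution_function F \<and> (AE \<omega> in P. weak_conv (\<lambda>n. esd (A n \<omega>)) F)"

section \<open>The matrices\<close>

text \<open>Matrix indices of the library start at 0, hence the shifts by one.\<close>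

definition RC :: "nat \<Rightarrow> (nat \<Rightarrow> real) \<Rightarrow> real mat" where
  "RC n x = Matrix.mat n n (\<lambda>(i, j). x (((i + 1) + (j + 1)) mod n))"

definition sign_mat :: "nat \<Rightarrow> real mat" where
  "sign_mat n = Matrix.mat n n (\<lambda>(i, j).
     if (i + 1) + (j + 1) < n + 1 then 1
     else if (i + 1) + (j + 1) = n + 1 then 0
     else - 1)"

definition schur_hadamard :: "real mat \<Rightarrow> real mat \<Rightarrow> real mat" (infixl "\<odot>" 70) where
  "A \<odot> B = Matrix.mat (dim_row A) (dim_col A) (\<lambda>(i, j). A $$ (i, j) * B $$ (i, j))"

definition RC_hat :: "nat \<Rightarrow> (nat \<Rightarrow> real) \<Rightarrow> real mat" where
  "RC_hat n x = sign_mat n \<odot> RC n x"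

definition scaled_RC :: "(nat \<Rightarrow> 'a \<Rightarrow> real) \<Rightarrow> nat \<Rightarrow> 'a \<Rightarrow> real mat" where
  "scaled_RC x n \<omega> = (1 / sqrt (real n)) \<cdot>\<^sub>m RC n (\<lambda>k. x k \<omega>)"

definition scaled_RC_hat :: "(nat \<Rightarrow> 'a \<Rightarrow> real) \<Rightarrow> nat \<Rightarrow> 'a \<Rightarrow> real mat" where
  "scaled_RC_hat x n \<omega> = (1 / sqrt (real n)) \<cdot>\<^sub>m RC_hat n (\<lambda>k. x k \<omega>)"

text \<open>The common LSD of the scaled Reverse Circulant matrices. It depends only on the laws of the
  input sequences, and every such law is realised on the sequence space itself, so the underlying
  probability spaces may be taken to live on the type \<open>nat \<Rightarrow> real\<close>.\<close>

definition L_RC :: "real \<Rightarrow> real" where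
  "L_RC = (THE F. \<forall>(P :: (nat \<Rightarrow> real) measure) x.
     input_A1 P x \<or> input_A2 P x \<or> input_A3 P x \<longrightarrow> is_LSD P (scaled_RC x) F)"

end

theory Submission
  imports Defs "HOL-Real_Asymp.Real_Asymp"
begin

text \<open>On the Fourier vectors \<open>v\<^sub>k = (exp (i \<omega>\<^sub>k l))\<^sub>l\<close> with frequencies \<open>\<omega>\<^sub>k = 2\<pi>k/n\<close> the Reverse Circulant
  matrix acts by \<open>v\<^sub>k \<mapsto> \<lambda>\<^sub>k v\<^sub>-\<^sub>k\<close>, so that its eigenvalues are essentially \<open>\<plusminus>|\<lambda>\<^sub>k|\<close>, where \<open>\<lambda>\<^sub>k\<close> is the
  normalised discrete Fourier transform of the input. The sign matrix turns it into a reverse skew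
  circulant matrix (up to the input \<open>x\<^sub>1\<close>), for which the same holds with \<open>\<omega>\<^sub>k = (2k + 1)\<pi>/n\<close>.
  In both cases it suffices that the empirical distribution of the \<open>|\<lambda>\<^sub>k|\<^sup>2\<close> tends almost surely
  to the exponential law, that is, \<open>G\<^sub>s = 1/n \<Sum>\<^sub>k exp (-s|\<lambda>\<^sub>k|\<^sup>2) \<longrightarrow> 1/(1 + s)\<close> for \<open>s = 1, 2, \<dots>\<close>,
  because these are the moments of \<open>exp (-|\<lambda>\<^sub>k|\<^sup>2)\<close>, whose limit law is uniform on \<open>[0, 1]\<close>.
  For bounded inputs, Parseval's identity bounds the sum of the squared effects on \<open>G\<^sub>s\<close> of changing a
  single input by \<open>O(1/n)\<close>; applying the Efron--Stein inequality to \<open>G\<^sub>s\<close> and to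
  \<open>(G\<^sub>s - E G\<^sub>s)\<^sup>2\<close> then yields \<open>E (G\<^sub>s - E G\<^sub>s)\<^sup>4 = O(n\<^sup>-\<^sup>2)\<close>, which is summable. The mean is found by
  approximate Gaussian integration by parts, which says that \<open>(1 + s) E exp (-s|\<lambda>\<^sub>k|\<^sup>2)\<close> has
  derivative \<open>O(n\<^sup>-\<^sup>1\<^sup>/\<^sup>2)\<close> in \<open>s\<close>. General inputs are truncated: again by Parseval,
  \<open>G\<^sub>s\<close> is a Lipschitz function of the input in the normalised \<open>l\<^sup>2\<close> distance, and the
  truncation error in that distance is controlled by a one-sided strong law of large numbers.\<close>

section \<open>Spectra of reverse circulant and reverse skew circulant matrices\<close>

text \<open>Almost sure convergence is the demand that shapes the proof: the Efron--Stein bound on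
  the variance of \<open>G\<close> is of order 1/n and does not sum, hence the fourth moments. With
  q = |lambda_k|^2, the functions exp(-s q) serve three purposes: they are smooth with bounded
  derivatives, their averages are moments of points in [0, 1], so that polynomial approximation
  identifies the limit, and they turn the exponential law into the equation (1 + r) u' + u = 0 for
  the Laplace transform u. This equation comes from E q exp(-r q) = E (1 - r q) exp(-r q) up to a
  small error, the outcome of integrating by parts in every input. The factor 1 - r q rests on the
  vanishing of the sum of the squared entries of a Fourier vector: its real and imaginary parts are
  orthogonal and equally long. At most two frequencies violate this. (A2) supplies second moments
  only, which forces the truncation; truncated inputs must again have mean 0 and variance 1, and the
  error must be small almost surely, not just in the mean.\<close>

lemma char_poly_orthonormal_eigenbasis:
  fixes A :: "real mat" and U :: "nat \<Rightarrow> nat \<Rightarrow> real"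
  assumes A: "A \<in> carrier_mat n n"
    and orth: "\<And>k l. k < n \<Longrightarrow> l < n \<Longrightarrow> (\<Sum>i<n. U i k * U i l) = (if k = l then 1 else 0)"
    and eig: "\<And>i k. i < n \<Longrightarrow> k < n \<Longrightarrow> (\<Sum>j<n. A $$ (i, j) * U j k) = eg k * U i k"
  shows "char_poly A = (\<Prod>k<n. [:- eg k, 1:])"
proof -
  \<comment> \<open>\<open>P\<close> is orthogonal, so \<open>A\<close> is similar to a diagonal
    matrix. The similarity delivers the multiplicities, which a bare list of eigenpairs would
    not.\<close>
  define P where "P = Matrix.mat n n (\<lambda>(i, k). U i k)"
  define Q where "Q = transpose_mat P"
  define D where "D = mat_diag n eg"
  have P: "P \<in> carrier_mat n n" and Q: "Q \<in> carrier_mat n n" and D: "D \<in> carrier_mat n n"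
    by (auto simp: P_def Q_def D_def mat_diag_def)
  have "Q * P = 1\<^sub>m n"
  proof (rule eq_matI)
    fix k l assume "k < dim_row (1\<^sub>m n)" "l < dim_col (1\<^sub>m n)"
    then show "(Q * P) $$ (k, l) = 1\<^sub>m n $$ (k, l)"
      using orth[of k l] by (simp add: P_def Q_def scalar_prod_def lessThan_atLeast0)
  qed (use P Q in auto)
  then have PQ: "P * Q = 1\<^sub>m n"
    using mat_mult_left_right_inverse[OF Q P] by simp
  have "A * P = P * D"
  proof (rule eq_matI)
    fix i k assume "i < dim_row (P * D)" "k < dim_col (P * D)"
    then show "(A * P) $$ (i, k) = (P * D) $$ (i, k)"
      using eig[of i k] A P D
      by (simp add: D_def mat_diag_mult_right[OF P] scalar_prod_def lessThan_atLeast0)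
        (simp add: P_def mult.commute)
  qed (use A P D in auto)
  then have "A = P * D * Q"
    using assoc_mult_mat[OF A P Q] PQ A by simp
  with PQ \<open>Q * P = 1\<^sub>m n\<close> A P Q D have "similar_mat A D"
    by (intro similar_matI[of A D P Q n]) auto
  then have "char_poly A = char_poly D" by (rule char_poly_similar)
  also have "\<dots> = (\<Prod>a\<leftarrow>diag_mat D. [:- a, 1:])"
    by (rule char_poly_upper_triangular[OF D]) (auto simp: D_def mat_diag_def upper_triangular_def)
  also have "diag_mat D = map eg [0..<n]"
    by (auto simp: D_def diag_mat_def mat_diag_def)
  also have "(\<Prod>a\<leftarrow>map eg [0..<n]. [:- a, 1:]) = (\<Prod>k<n. [:- eg k, 1:])"
    by (simp add: prod.list_conv_set_nth lessThan_atLeast0 o_def)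
  finally show ?thesis .
qed

lemma esd_eq_card:
  assumes "A \<in> carrier_mat n n" "char_poly A = (\<Prod>k<n. [:- eg k, 1:])"
  shows "esd A t = real (card {k. k < n \<and> eg k \<le> t}) / real n"
proof -
  have "proots (char_poly A) = (\<Sum>k<n. {#eg k#})"
    unfolding assms by (subst proots_prod) auto
  also have "\<dots> = image_mset eg (mset_set {..<n})"
    by (simp add: sum_unfold_sum_mset)
  finally have "size {# l \<in># proots (char_poly A). l \<le> t #} = card {k \<in> {..<n}. eg k \<le> t}"
    by (simp add: filter_mset_image_mset)
  then show ?thesis
    using assms(1) by (simp add: esd_def)
qed

section \<open>Orthogonality of discrete Fourier vectors\<close>

lemma sum_cis_multiples:
  fixes m :: int
  assumes "n > 0"
  shows "(\<Sum>l=1..n. cis (2 * pi * of_int m * real l / real n)) = (if int n dvd m then of_nat n else 0)"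
proof -
  define z where "z = cis (2 * pi * of_int m / real n)"
  have zl: "cis (2 * pi * of_int m * real l / real n) = z ^ l" for l
    unfolding z_def Complex.DeMoivre by (rule arg_cong[where f = cis]) (simp add: field_simps)
  have zn: "z ^ n = 1"
    using assms cis_multiple_2pi[of "of_int m"] by (simp add: z_def Complex.DeMoivre)
  show ?thesis
  proof (cases "z = 1")
    case True
    then have "exp (\<i> * of_real (2 * pi * of_int m / real n)) = 1"
      by (simp add: z_def cis_conv_exp)
    then obtain c :: int where "2 * pi * of_int m / real n = of_int (2 * c) * pi"
      unfolding exp_eq_1 by auto
    then have "of_int m = (of_int (c * int n) :: real)"
      using assms by (simp add: field_simps)
    then have "int n dvd m" by (simp only: of_int_eq_iff) simp
    then show ?thesis using True by (simp add: zl)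
  next
    case False
    have "\<not> int n dvd m"
    proof
      assume "int n dvd m"
      then obtain c where "m = int n * c" by auto
      then have "z = cis (2 * pi * of_int c)"
        using assms by (simp add: z_def mult.assoc)
      with False show False using cis_multiple_2pi[of "of_int c"] by simp
    qed
    moreover have "(\<Sum>l=1..n. z ^ l) * (z - 1) = 0"
    proof -
      have "(\<Sum>l=1..n. z ^ l) = z * (\<Sum>l<n. z ^ l)"
        by (simp only: One_nat_def sum.atLeast1_atMost_eq power_Suc sum_distrib_left)
      also have "\<dots> * (z - 1) = z * (z ^ n - 1)"
        unfolding power_diff_1_eq by (simp only: mult.assoc mult.commute[of "sum _ _"])
      finally show ?thesis using zn by simp
    qed
    ultimately show ?thesis using False by (simp add: zl)
  qed
qed

text \<open>The parameter \<open>e\<close> is \<open>0\<close> for circulant and \<open>1\<close> for skew circulant matrices; \<open>conj_index n e k\<close>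
  is the index of the frequency opposite to that of \<open>k\<close> modulo \<open>2\<pi>\<close>.\<close>

definition fourier :: "nat \<Rightarrow> nat \<Rightarrow> nat \<Rightarrow> nat \<Rightarrow> complex" where
  "fourier n e k l = cis (2 * pi * (real k + real e / 2) * real l / real n)"

definition conj_index :: "nat \<Rightarrow> nat \<Rightarrow> nat \<Rightarrow> nat" where
  "conj_index n e k = (if k + e = 0 then 0 else n - (k + e))"

lemma cmod_fourier [simp]: "cmod (fourier n e k l) = 1"
  by (simp add: fourier_def)

lemma conj_index_less: "e \<le> 1 \<Longrightarrow> k < n \<Longrightarrow> conj_index n e k < n"
  by (auto simp: conj_index_def)

lemma conj_index_invol: "e \<le> 1 \<Longrightarrow> k < n \<Longrightarrow> conj_index n e (conj_index n e k) = k"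
  by (auto simp: conj_index_def)

lemma fourier_conj_index:
  assumes "e \<le> 1" "k < n"
  shows "fourier n e (conj_index n e k) l = cnj (fourier n e k l)"
\<comment> \<open>Here the reflected index would be \<open>n\<close>, outside the range; the
  frequency 0 is its own opposite.\<close>
proof (cases "k + e = 0")
  case True
  then show ?thesis by (simp add: fourier_def conj_index_def)
next
  case False
  then have "real (conj_index n e k) = real n - real k - real e"
    using assms by (simp add: conj_index_def)
  then have rc: "real (conj_index n e k) = real n - real k - real e" .
  have "2 * pi * (real (conj_index n e k) + real e / 2) * real l / real n
      = 2 * pi * real l - 2 * pi * (real k + real e / 2) * real l / real n"
    using assms unfolding rc by (simp add: field_simps)
  moreover have "cis (2 * pi * real l - a) = cis (- a)" for a
    using cis_multiple_2pi[of "of_nat l"] by (simp add: cis_divide[symmetric] flip: cis_inverse)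
      (simp add: divide_inverse)
  ultimately show ?thesis by (simp add: fourier_def cis_cnj)
qed

lemma sum_fourier_cnj:
  assumes "k < n" "k' < n"
  shows "(\<Sum>l=1..n. fourier n e k l * cnj (fourier n e k' l)) = (if k = k' then of_nat n else 0)"
proof -
  have "fourier n e k l * cnj (fourier n e k' l) = cis (2 * pi * of_int (int k - int k') * real l / real n)" for l
    using assms by (simp add: fourier_def cis_cnj cis_mult)
      (rule arg_cong[where f = cis], simp add: field_simps)
  moreover have "int n dvd int k - int k' \<longleftrightarrow> k = k'"
  proof
    assume "int n dvd int k - int k'"
    then show "k = k'"
      using dvd_imp_le_int[of "int k - int k'" "int n"] assms by (cases "k = k'") auto
  qed simp
  ultimately show ?thesis
    using sum_cis_multiples[of n "int k - int k'"] assms by simp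
qed

text \<open>One factor is the conjugate of the Fourier vector of the opposite frequency, which
  reduces the sum to orthogonality. For \<open>k = k'\<close> it tells at which frequencies the
  squares of the entries sum to zero.\<close>

lemma sum_fourier_mult:
  assumes "e \<le> 1" "k < n" "k' < n"
  shows "(\<Sum>l=1..n. fourier n e k l * fourier n e k' l)
    = (if k' = conj_index n e k then of_nat n else 0)"
proof -
  have "fourier n e k l * fourier n e k' l
      = fourier n e k' l * cnj (fourier n e (conj_index n e k) l)" for l
    using assms by (simp add: fourier_conj_index)
  then have "(\<Sum>l=1..n. fourier n e k l * fourier n e k' l)
      = (\<Sum>l=1..n. fourier n e k' l * cnj (fourier n e (conj_index n e k) l))"
    by (rule sum.cong[OF refl])
  then show ?thesis
    using sum_fourier_cnj[of k' n "conj_index n e k" e] assms by (simp only: conj_index_less)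
qed

lemma fourier_add_period:
  assumes "n > 0"
  shows "fourier n e k (l + n) = (- 1) ^ e * fourier n e k l"
proof -
  have "2 * pi * (real k + real e / 2) * real (l + n) / real n
      = 2 * pi * (real k + real e / 2) * real l / real n + (2 * pi * real k + real e * pi)"
    using assms by (simp add: field_simps)
  moreover have "cis (real e * pi) = (- 1) ^ e"
    using Complex.DeMoivre[of pi e] by (simp only: cis_pi)
  then have "cis (2 * pi * real k + real e * pi) = (- 1) ^ e"
    using cis_multiple_2pi[of "of_nat k"] by (simp flip: cis_mult)
  ultimately show ?thesis by (simp add: fourier_def flip: cis_mult)
qed

definition dft :: "nat \<Rightarrow> nat \<Rightarrow> (nat \<Rightarrow> real) \<Rightarrow> nat \<Rightarrow> complex" where
  "dft n e y k = (\<Sum>l=1..n. of_real (y l) * fourier n e k l)"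

text \<open>Over \<open>n\<close> steps both \<open>y\<close> and the Fourier vector pick up the
  sign \<open>(- 1) ^ e\<close>, so their product has period \<open>n\<close>, and its sum over the
  shifted window \<open>1 + i..n + i\<close> equals the sum over \<open>1..n\<close>. The shift
  itself costs the phase \<open>cnj (fourier n e k i)\<close>.\<close>

lemma hankel_fourier:
  assumes "e \<le> 1" "i \<le> n" "n > 0"
    and y: "\<And>l. 1 \<le> l \<Longrightarrow> l \<le> n \<Longrightarrow> y (l + n) = (- 1) ^ e * y l"
  shows "(\<Sum>j=1..n. of_real (y (i + j)) * fourier n e k j) = cnj (fourier n e k i) * dft n e y k"
proof -
  define g where "g l = of_real (y l) * fourier n e k l" for l
  have g: "g (l + n) = g l" if "1 \<le> l" "l \<le> n" for l
  proof -
    have "((- 1) ^ e * (- 1) ^ e :: complex) = 1"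
      by (simp flip: power_add mult_2)
    then show ?thesis
      using that by (simp add: g_def fourier_add_period[OF \<open>n > 0\<close>] y)
  qed
  have split: "cnj (fourier n e k i) * fourier n e k (i + j) = fourier n e k j" for j
    using assms by (simp add: fourier_def cis_cnj cis_mult)
      (rule arg_cong[where f = cis], simp add: field_simps)
  have "(\<Sum>j=1..n. of_real (y (i + j)) * fourier n e k j) = cnj (fourier n e k i) * (\<Sum>j=1..n. g (i + j))"
    unfolding sum_distrib_left
  proof (rule sum.cong[OF refl])
    fix j
    show "of_real (y (i + j)) * fourier n e k j = cnj (fourier n e k i) * g (i + j)"
      unfolding g_def split[of j, symmetric] by (simp add: mult_ac)
  qed
  also have "(\<Sum>j=1..n. g (i + j)) = (\<Sum>l=1+i..n+i. g l)"
    using sum.shift_bounds_cl_nat_ivl[of g 1 i n] by (simp add: add.commute)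
  also have "{1+i..n+i} = {1+i..n} \<union> {n+1..n+i}" using assms by auto
  also have "(\<Sum>l\<in>\<dots>. g l) = (\<Sum>l=1+i..n. g l) + (\<Sum>l=n+1..n+i. g l)"
    by (rule sum.union_disjoint) auto
  also have "(\<Sum>l=n+1..n+i. g l) = (\<Sum>l=1..i. g (l + n))"
    using sum.shift_bounds_cl_nat_ivl[of g 1 n i] by (simp add: add.commute)
  also have "\<dots> = (\<Sum>l=1..i. g l)"
    using assms by (intro sum.cong) (auto simp: g)
  also have "(\<Sum>l=1+i..n. g l) + (\<Sum>l=1..i. g l) = (\<Sum>l\<in>{1+i..n} \<union> {1..i}. g l)"
    by (rule sum.union_disjoint[symmetric]) auto
  also have "{1+i..n} \<union> {1..i} = {1..n}" using assms by auto
  finally show ?thesis by (simp add: g_def dft_def)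
qed

lemma dft_conj_index:
  "e \<le> 1 \<Longrightarrow> k < n \<Longrightarrow> dft n e y (conj_index n e k) = cnj (dft n e y k)"
  unfolding dft_def cnj_sum by (intro sum.cong refl) (simp add: fourier_conj_index)

lemma half_arg_rotation:
  fixes z :: complex
  shows "cis (- Arg z / 2) * cis (- Arg z / 2) * z = of_real (cmod z)"
proof -
  have "cis (- Arg z / 2) * cis (- Arg z / 2) = cis (- Arg z)"
    by (simp add: cis_mult)
  moreover have "z = of_real (cmod z) * cis (Arg z)"
    using rcis_cmod_Arg[of z] by (simp add: rcis_def)
  ultimately have "cis (- Arg z / 2) * cis (- Arg z / 2) * z
      = of_real (cmod z) * (cis (- Arg z) * cis (Arg z))"
    by (metis mult.left_commute)
  then show ?thesis by (simp add: cis_mult)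
qed

text \<open>The eigenvectors are \<open>Re (\<gamma>\<^sub>k exp (i \<omega>\<^sub>k l))\<close>, where \<open>\<gamma>\<^sub>k\<close> cancels half of the argument of the Fourier
  coefficient; in each pair of opposite frequencies one gets the positive, the other one the
  negative eigenvalue.\<close>

lemma esd_hankel:
  fixes y :: "nat \<Rightarrow> real"
  assumes e: "e \<le> 1" and n: "n > 0" and c: "c \<ge> 0"
    and y: "\<And>l. 1 \<le> l \<Longrightarrow> l \<le> n \<Longrightarrow> y (l + n) = (- 1) ^ e * y l"
    and A: "A \<in> carrier_mat n n"
    and A_eq: "\<And>i j. i < n \<Longrightarrow> j < n \<Longrightarrow> A $$ (i, j) = c * y (i + j + 2)"
  obtains eg where
    "\<And>t. esd A t = real (card {k. k < n \<and> eg k \<le> t}) / real n"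
    "\<And>k. k < n \<Longrightarrow> \<bar>eg k\<bar> = c * cmod (dft n e y k)"
    "\<And>k. k < n \<Longrightarrow> k < conj_index n e k \<Longrightarrow> eg k \<ge> 0"
    "\<And>k. k < n \<Longrightarrow> conj_index n e k < k \<Longrightarrow> eg k \<le> 0"
proof -
  define D where "D = dft n e y"
  define cj where "cj = conj_index n e"
  define \<rho> where "\<rho> k = cis (- Arg (D k) / 2)" for k
  \<comment> \<open>Since \<open>Re (\<i> * cnj w) = Im w\<close>, an opposite pair receives the
    real and the imaginary part of one rotated Fourier vector; \<open>sqrt 2\<close> compensates for
    their squared norms being half of its squared norm. At a self-opposite frequency the coefficient
    is real and needs no rotation.\<close>
  define \<gamma> where "\<gamma> k = (if k < cj k then of_real (sqrt 2) * \<rho> k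
    else if cj k < k then of_real (sqrt 2) * \<i> * cnj (\<rho> (cj k)) else 1)" for k
  define eg where "eg k = c * (if k < cj k then cmod (D k) else if cj k < k then - cmod (D k) else Re (D k))" for k
  define U where "U i k = Re (\<gamma> k * fourier n e k (i + 1)) / sqrt (real n)" for i k
  have cj: "cj k < n" "cj (cj k) = k" if "k < n" for k
    using that e by (auto simp: cj_def conj_index_less conj_index_invol)
  have D_cj: "D (cj k) = cnj (D k)" if "k < n" for k
    using that e by (simp add: D_def cj_def dft_conj_index)
  have D_self: "Im (D k) = 0" if "k < n" "cj k = k" for k
    using D_cj[OF that(1)] that(2) by (simp add: complex_eq_iff)
  have \<rho>: "\<rho> k * \<rho> k * D k = of_real (cmod (D k))" for k
    unfolding \<rho>_def by (rule half_arg_rotation)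
  have \<rho>1: "\<rho> k * cnj (\<rho> k) = 1" "cnj (\<rho> k) * \<rho> k = 1" "cmod (\<rho> k) = 1" for k
    by (simp_all add: \<rho>_def cis_cnj cis_mult)
  have s2: "of_real (sqrt 2) * of_real (sqrt 2) = (2 :: complex)"
    by (simp flip: of_real_mult)
  \<comment> \<open>The matrix maps a Fourier vector to a multiple of its conjugate; this
    conjugate-linear relation is what makes \<open>Re (\<gamma> k * fourier n e k l)\<close> an
    eigenvector.\<close>
  have \<gamma>_eig: "of_real c * cnj (\<gamma> k * D k) = of_real (eg k) * \<gamma> k" if k: "k < n" for k
  proof -
    consider "k < cj k" | "cj k < k" | "cj k = k" by linarith
    then show ?thesis
    proof cases
      case 1
      have "\<rho> k * D k = of_real (cmod (D k)) * cnj (\<rho> k)"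
        using \<rho>[of k] \<rho>1[of k] by (metis mult.assoc mult.commute mult_1)
      then have "cnj (\<rho> k * D k) = of_real (cmod (D k)) * \<rho> k" by simp
      then show ?thesis using 1 by (simp add: \<gamma>_def eg_def)
    next
      case 2
      have "\<rho> (cj k) * D (cj k) = of_real (cmod (D (cj k))) * cnj (\<rho> (cj k))"
        using \<rho>[of "cj k"] \<rho>1[of "cj k"] by (metis mult.assoc mult.commute mult_1)
      then have "\<rho> (cj k) * cnj (D k) = of_real (cmod (D k)) * cnj (\<rho> (cj k))"
        using k by (simp add: D_cj)
      then show ?thesis using 2 by (simp add: \<gamma>_def eg_def)
    next
      case 3
      then show ?thesis using D_self[OF k 3]
        by (simp add: \<gamma>_def eg_def complex_eq_iff)
    qed
  qed
  \<comment> \<open>In \<open>2 * Re a * Re b = Re (a * b) + Re (a * cnj b)\<close> the first term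
    survives summation only for opposite and the second only for equal frequencies. A self-opposite
    frequency collects 1 + 1, any other 0 + 2, and an opposite pair 0 because of the factor
    \<open>\<i>\<close>.\<close>
  have \<gamma>_cj: "Re (\<gamma> k * \<gamma> (cj k)) = (if cj k = k then 1 else 0)" if k: "k < n" for k
  proof -
    consider "k < cj k" | "cj k < k" | "cj k = k" by linarith
    then show ?thesis
    proof cases
      case 1
      then have "\<gamma> k * \<gamma> (cj k) = of_real (sqrt 2) * of_real (sqrt 2) * (\<rho> k * cnj (\<rho> k)) * \<i>"
        using cj[OF k] by (simp add: \<gamma>_def)
      then show ?thesis using 1 \<rho>1[of k] s2 by simp
    next
      case 2
      then have "\<gamma> k * \<gamma> (cj k)
          = of_real (sqrt 2) * of_real (sqrt 2) * (\<rho> (cj k) * cnj (\<rho> (cj k))) * \<i>"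
        using cj[OF k] by (simp add: \<gamma>_def)
      then show ?thesis using 2 \<rho>1[of "cj k"] s2 by simp
    next
      case 3
      then show ?thesis by (simp add: \<gamma>_def)
    qed
  qed
  have \<gamma>_norm: "Re (\<gamma> k * cnj (\<gamma> k)) = (if cj k = k then 1 else 2)" for k
    using \<rho>1(3)[of k] \<rho>1(3)[of "cj k"]
    by (simp add: complex_norm_square[symmetric] \<gamma>_def norm_mult power_mult_distrib)
  have orth: "(\<Sum>i<n. U i k * U i l) = (if k = l then 1 else 0)" if k: "k < n" and l: "l < n" for k l
  proof -
    have re: "Re a * Re b = (Re (a * b) + Re (a * cnj b)) / 2" for a b
      by simp
    have "(\<Sum>i<n. U i k * U i l)
        = (\<Sum>i<n. Re (\<gamma> k * fourier n e k (Suc i)) * Re (\<gamma> l * fourier n e l (Suc i))) / real n"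
      by (simp add: U_def sum_divide_distrib)
    also have "(\<Sum>i<n. Re (\<gamma> k * fourier n e k (Suc i)) * Re (\<gamma> l * fourier n e l (Suc i)))
        = (\<Sum>i=1..n. Re (\<gamma> k * fourier n e k i) * Re (\<gamma> l * fourier n e l i))"
      by (simp only: One_nat_def sum.atLeast1_atMost_eq)
    also have "\<dots> = (\<Sum>i=1..n. Re (\<gamma> k * \<gamma> l * (fourier n e k i * fourier n e l i))
        + Re (\<gamma> k * cnj (\<gamma> l) * (fourier n e k i * cnj (fourier n e l i)))) / 2"
      unfolding sum_divide_distrib re
      by (intro sum.cong refl) (simp only: complex_cnj_mult mult_ac)
    also have "\<dots> = (Re (\<gamma> k * \<gamma> l * (\<Sum>i=1..n. fourier n e k i * fourier n e l i))
        + Re (\<gamma> k * cnj (\<gamma> l) * (\<Sum>i=1..n. fourier n e k i * cnj (fourier n e l i)))) / 2"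
      unfolding sum.distrib sum_distrib_left Re_sum ..
    also have "\<dots> = (Re (\<gamma> k * \<gamma> l * (if l = cj k then of_nat n else 0))
        + Re (\<gamma> k * cnj (\<gamma> l) * (if k = l then of_nat n else 0))) / 2"
      unfolding sum_fourier_mult[OF e k l] sum_fourier_cnj[OF k l] cj_def ..
    also have "\<dots> = (if k = l then real n else 0)"
    proof -
      have sc: "Re (a * of_nat n) = Re a * real n" for a by simp
      consider "l = cj k" "k = l" | "l = cj k" "k \<noteq> l" | "l \<noteq> cj k" "k = l" | "l \<noteq> cj k" "k \<noteq> l"
        by blast
      then show ?thesis
      proof cases
        case 1
        then show ?thesis using \<gamma>_cj[OF k] \<gamma>_norm[of k]
          by (simp only: sc if_True refl) (simp add: 1(1)[symmetric] del: times_complex.sel)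
      next
        case 2
        then show ?thesis using \<gamma>_cj[OF k] by (simp only: sc if_True refl) simp
      next
        case 3
        then have "cj k \<noteq> k" by simp
        with 3 show ?thesis using \<gamma>_norm[of k] by (simp only: sc if_True if_False refl) simp
      qed simp
    qed
    finally show ?thesis using n by simp
  qed
  have eig: "(\<Sum>j<n. A $$ (i, j) * U j k) = eg k * U i k" if i: "i < n" and k: "k < n" for i k
  proof -
    have "(\<Sum>j<n. A $$ (i, j) * U j k)
        = (\<Sum>j<n. c * y (Suc i + Suc j) * Re (\<gamma> k * fourier n e k (Suc j))) / sqrt (real n)"
      unfolding sum_divide_distrib using i by (intro sum.cong refl) (simp add: A_eq U_def)
    also have "(\<Sum>j<n. c * y (Suc i + Suc j) * Re (\<gamma> k * fourier n e k (Suc j)))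
        = (\<Sum>j=1..n. c * y (Suc i + j) * Re (\<gamma> k * fourier n e k j))"
      by (simp only: One_nat_def sum.atLeast1_atMost_eq)
    also have "\<dots> = Re (of_real c * \<gamma> k * (\<Sum>j=1..n. of_real (y (Suc i + j)) * fourier n e k j))"
      unfolding sum_distrib_left Re_sum by (intro sum.cong refl) (simp add: algebra_simps)
    also have "(\<Sum>j=1..n. of_real (y (Suc i + j)) * fourier n e k j) = cnj (fourier n e k (Suc i)) * D k"
      using hankel_fourier[of e "Suc i" n y k] e n y i by (simp add: D_def)
    also have "Re (of_real c * \<gamma> k * (cnj (fourier n e k (Suc i)) * D k))
        = Re (cnj (of_real c * \<gamma> k * (cnj (fourier n e k (Suc i)) * D k)))"
      by (simp only: cnj.sel)
    also have "cnj (of_real c * \<gamma> k * (cnj (fourier n e k (Suc i)) * D k))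
        = of_real c * cnj (\<gamma> k * D k) * fourier n e k (Suc i)"
      by (simp add: mult_ac)
    also have "\<dots> = of_real (eg k) * (\<gamma> k * fourier n e k (Suc i))"
      unfolding \<gamma>_eig[OF k] by (simp add: mult_ac)
    also have "Re \<dots> = eg k * Re (\<gamma> k * fourier n e k (Suc i))"
      by (simp only: Re_complex_of_real times_complex.sel complex_of_real_def) simp
    finally show ?thesis by (simp add: U_def)
  qed
  have "char_poly A = (\<Prod>k<n. [:- eg k, 1:])"
    by (rule char_poly_orthonormal_eigenbasis[OF A orth eig])
  then have "esd A t = real (card {k. k < n \<and> eg k \<le> t}) / real n" for t
    by (rule esd_eq_card[OF A])
  moreover have "\<bar>eg k\<bar> = c * cmod (dft n e y k)" if "k < n" for k
  proof -
    have "cj k = k \<Longrightarrow> \<bar>Re (D k)\<bar> = cmod (D k)"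
      using D_self[OF that] by (simp add: cmod_def)
    then show ?thesis using c unfolding D_def[symmetric]
      by (auto simp: eg_def abs_mult not_less_iff_gr_or_eq)
  qed
  moreover have "eg k \<ge> 0" if "k < n" "k < conj_index n e k" for k
    using that c by (simp add: eg_def cj_def)
  moreover have "eg k \<le> 0" if "k < n" "conj_index n e k < k" for k
    using that c by (simp add: eg_def cj_def)
  ultimately show ?thesis by (rule that)
qed

text \<open>Only 0 and the middle of the range can be self-opposite. These frequencies are
  exceptional twice: for the pairing of eigenvalue signs, and for the balance of real and imaginary
  parts behind the exponential law.\<close>

lemma card_conj_index_fixed:
  assumes "e \<le> 1"
  shows "card {k. k < n \<and> conj_index n e k = k} \<le> 2"
proof -
  have "{k. k < n \<and> conj_index n e k = k} \<subseteq> {0, (n - e) div 2}"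
    using assms by (auto simp: conj_index_def split: if_splits)
  then have "card {k. k < n \<and> conj_index n e k = k} \<le> card {0, (n - e) div 2}"
    by (intro card_mono) auto
  also have "\<dots> \<le> 2" by (simp add: card_insert_if)
  finally show ?thesis .
qed

section \<open>From exponential moments to the spectral distribution\<close>

text \<open>An opposite pair carries one nonnegative and one nonpositive eigenvalue of the same
  modulus, so the counts of eigenvalues and of moduli determine each other exactly on pairs. Only
  the self-opposite indices \<open>C\<close> disturb this; there are at most two, and weighting the
  counts by 2 gives the error 4.\<close>

lemma card_sign_symmetric:
  fixes eg :: "nat \<Rightarrow> real"
  assumes e: "e \<le> 1"
    and inv: "\<And>k. k < n \<Longrightarrow> \<bar>eg (conj_index n e k)\<bar> = \<bar>eg k\<bar>"
    and pos: "\<And>k. k < n \<Longrightarrow> k < conj_index n e k \<Longrightarrow> eg k \<ge> 0"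
    and neg: "\<And>k. k < n \<Longrightarrow> conj_index n e k < k \<Longrightarrow> eg k \<le> 0"
  shows "t \<ge> 0 \<Longrightarrow> \<bar>2 * real (card {k. k < n \<and> eg k \<le> t}) - (real n + real (card {k. k < n \<and> \<bar>eg k\<bar> \<le> t}))\<bar> \<le> 4"
    and "t < 0 \<Longrightarrow> \<bar>2 * real (card {k. k < n \<and> eg k \<le> t}) - (real n - real (card {k. k < n \<and> \<bar>eg k\<bar> < - t}))\<bar> \<le> 4"
proof -
  define cj where "cj = conj_index n e"
  have cj: "cj k < n" "cj (cj k) = k" if "k < n" for k
    using that e by (auto simp: cj_def conj_index_less conj_index_invol)
  define A B C where "A Z = {k \<in> Z. k < n \<and> k < cj k}" and "B Z = {k \<in> Z. k < n \<and> cj k < k}"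
    and "C Z = {k \<in> Z. k < n \<and> cj k = k}" for Z
  have split: "real (card {k \<in> Z. k < n}) = real (card (A Z)) + real (card (B Z)) + real (card (C Z))" for Z
  proof -
    have "{k \<in> Z. k < n} = A Z \<union> (B Z \<union> C Z)" by (auto simp: A_def B_def C_def)
    moreover have "card (A Z \<union> (B Z \<union> C Z)) = card (A Z) + (card (B Z) + card (C Z))"
      by (subst card_Un_disjoint; (subst card_Un_disjoint)?) (auto simp: A_def B_def C_def)
    ultimately show ?thesis by simp
  qed
  have C2: "real (card (C Z)) \<le> 2" for Z
  proof -
    have "card (C Z) \<le> card {k. k < n \<and> cj k = k}" by (intro card_mono) (auto simp: C_def)
    also have "\<dots> \<le> 2" using card_conj_index_fixed[OF e] by (simp add: cj_def)
    finally show ?thesis by simp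
  qed
  have AB: "card (A Z) = card (B Z)" if Z: "\<And>k. k < n \<Longrightarrow> cj k \<in> Z \<longleftrightarrow> k \<in> Z" for Z
  proof -
    have "bij_betw cj (A Z) (B Z)"
      by (rule bij_betwI[where g = cj]) (auto simp: A_def B_def cj Z)
    then show ?thesis by (rule bij_betw_same_card)
  qed
  have split_n: "real n = real (card (A UNIV)) + real (card (B UNIV)) + real (card (C UNIV))"
    using split[of UNIV] by simp
  have CC: "real (card (C Z)) \<le> real (card (C UNIV))" for Z
    by (intro of_nat_mono card_mono) (auto simp: C_def)
  {
    assume t: "t \<ge> 0"
    define Z R where "Z = {k. eg k \<le> t}" and "R = {k. \<bar>eg k\<bar> \<le> t}"
    have "A Z = A R" using pos by (auto simp: A_def Z_def R_def cj_def)
    moreover have "B Z = B UNIV" using neg t by (force simp: B_def Z_def cj_def)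
    moreover have "card (A R) = card (B R)" "card (A UNIV) = card (B UNIV)"
      by (rule AB; simp add: R_def inv[folded cj_def])+
    ultimately have "\<bar>2 * real (card {k \<in> Z. k < n}) - (real n + real (card {k \<in> R. k < n}))\<bar> \<le> 4"
      using C2[of UNIV] CC[of Z] CC[of R] unfolding split[of Z] split[of R] split_n
      by (simp add: abs_le_iff)
    then show "\<bar>2 * real (card {k. k < n \<and> eg k \<le> t}) - (real n + real (card {k. k < n \<and> \<bar>eg k\<bar> \<le> t}))\<bar> \<le> 4"
      by (simp add: Z_def R_def conj_commute)
  }
  {
    assume t: "t < 0"
    define Z R where "Z = {k. eg k \<le> t}" and "R = {k. \<bar>eg k\<bar> < - t}"
    have "A Z = {}" using pos t by (force simp: A_def Z_def cj_def)
    moreover have "B Z \<union> B R = B UNIV" "B Z \<inter> B R = {}" using neg by (force simp: B_def Z_def R_def cj_def)+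
    then have "real (card (B UNIV)) = real (card (B Z)) + real (card (B R))"
      by (metis (no_types) B_def card_Un_disjoint finite_Collect_conjI finite_Collect_less_nat of_nat_add)
    moreover have "card (A R) = card (B R)" "card (A UNIV) = card (B UNIV)"
      by (rule AB; simp add: R_def inv[folded cj_def])+
    ultimately have "\<bar>2 * real (card {k \<in> Z. k < n}) - (real n - real (card {k \<in> R. k < n}))\<bar> \<le> 4"
      using C2[of UNIV] CC[of Z] CC[of R] unfolding split[of Z] split[of R] split_n
      by (simp add: abs_le_iff)
    then show "\<bar>2 * real (card {k. k < n \<and> eg k \<le> t}) - (real n - real (card {k. k < n \<and> \<bar>eg k\<bar> < - t}))\<bar> \<le> 4"
      by (simp add: Z_def R_def conj_commute)
  }
qed

text \<open>As 1/(1 + s) is the integral of \<open>x ^ s\<close> over [0, 1], the hypothesis is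
  convergence for monomials; Weierstrass approximation extends it to continuous functions.\<close>

lemma uniform_limit_from_moments:
  fixes v :: "nat \<Rightarrow> nat \<Rightarrow> real"
  assumes v: "\<And>n k. v n k \<in> {0..1}"
    and mom: "\<And>s::nat. (\<lambda>n. (\<Sum>k<n. v n k ^ s) / real n) \<longlonglongrightarrow> 1 / (1 + real s)"
    and f: "continuous_on {0..1} f"
  shows "(\<lambda>n. (\<Sum>k<n. f (v n k)) / real n) \<longlonglongrightarrow> integral {0..1} f"
proof (rule LIMSEQ_I)
  fix r :: real assume "r > 0"
  then have r: "r / 4 > 0" by simp
  obtain g where "real_polynomial_function g" and g: "\<And>x. x \<in> {0..1} \<Longrightarrow> \<bar>f x - g x\<bar> < r / 4"
    using Stone_Weierstrass_real_polynomial_function[OF _ f r] by auto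
  then obtain a m where ga: "g = (\<lambda>x. \<Sum>i\<le>m. a i * x ^ i)"
    using real_polynomial_function_iff_sum by blast
  have "(\<lambda>n. \<Sum>i\<le>m. a i * ((\<Sum>k<n. v n k ^ i) / real n)) \<longlonglongrightarrow> (\<Sum>i\<le>m. a i * (1 / (1 + real i)))"
    by (intro tendsto_sum tendsto_mult tendsto_const mom)
  also have "(\<lambda>n. \<Sum>i\<le>m. a i * ((\<Sum>k<n. v n k ^ i) / real n)) = (\<lambda>n. (\<Sum>k<n. g (v n k)) / real n)"
    unfolding ga sum_divide_distrib sum_distrib_left by (subst sum.swap) simp
  also have "(\<Sum>i\<le>m. a i * (1 / (1 + real i))) = integral {0..1} g"
  proof -
    have "((\<lambda>x::real. x ^ i) has_integral (1 / (1 + real i))) {0..1}" for i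
    proof -
      have "((\<lambda>x::real. x ^ i) has_integral
          (1 ^ Suc i / real (Suc i) - 0 ^ Suc i / real (Suc i))) {0..1}"
      proof (rule fundamental_theorem_of_calculus)
        fix x :: real
        have "((\<lambda>x. x ^ Suc i / real (Suc i)) has_real_derivative real (Suc i) * x ^ i / real (Suc i)) (at x within {0..1})"
          by (intro DERIV_cdivide) (use DERIV_power[OF DERIV_ident, where n = "Suc i"] in simp)
        then show "((\<lambda>x. x ^ Suc i / real (Suc i)) has_vector_derivative x ^ i) (at x within {0..1})"
          by (simp flip: has_real_derivative_iff_has_vector_derivative)
      qed simp
      then show ?thesis by simp
    qed
    then have "(g has_integral (\<Sum>i\<le>m. a i * (1 / (1 + real i)))) {0..1}"
      unfolding ga by (intro has_integral_sum has_integral_mult_right) auto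
    then show ?thesis by (simp add: integral_unique)
  qed
  finally obtain N where N: "\<And>n. n \<ge> N \<Longrightarrow> norm ((\<Sum>k<n. g (v n k)) / real n - integral {0..1} g) < r / 4"
    using LIMSEQ_D[OF _ r] by blast
  have gc: "continuous_on {0..1} g" unfolding ga by (intro continuous_intros)
  have fg: "\<bar>integral {0..1} f - integral {0..1} g\<bar> \<le> r / 4"
  proof -
    have "integral {0..1} f - integral {0..1} g = integral {0..1} (\<lambda>x. f x - g x)"
      by (rule integral_diff[symmetric]) (intro integrable_continuous_interval f gc)+
    also have "norm \<dots> \<le> r / 4 * (1 - 0)"
      by (rule integral_bound) (use g in \<open>auto intro!: continuous_intros f gc less_imp_le simp del: less_divide_eq_numeral1 le_divide_eq_numeral1\<close>)
    finally show ?thesis by simp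
  qed
  have "norm ((\<Sum>k<n. f (v n k)) / real n - integral {0..1} f) < r" if "n \<ge> max N 1" for n
  proof -
    have "\<bar>(\<Sum>k<n. f (v n k)) - (\<Sum>k<n. g (v n k))\<bar> \<le> (\<Sum>k<n. \<bar>f (v n k) - g (v n k)\<bar>)"
      unfolding sum_subtractf[symmetric] by (rule sum_abs)
    also have "\<dots> \<le> (\<Sum>k<n. r / 4)"
      using v g by (intro sum_mono less_imp_le) auto
    finally have "\<bar>(\<Sum>k<n. f (v n k)) / real n - (\<Sum>k<n. g (v n k)) / real n\<bar> \<le> r / 4"
      using that by (simp add: diff_divide_distrib[symmetric] field_simps)
    moreover have "\<bar>(\<Sum>k<n. g (v n k)) / real n - integral {0..1} g\<bar> < r / 4"
      using N[of n] that by (simp only: real_norm_def max.bounded_iff)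
    ultimately show ?thesis
      using fg r unfolding real_norm_def abs_le_iff abs_less_iff by linarith
  qed
  then show "\<exists>N. \<forall>n\<ge>N. norm ((\<Sum>k<n. f (v n k)) / real n - integral {0..1} f) < r" by blast
qed

definition ramp :: "real \<Rightarrow> real \<Rightarrow> real \<Rightarrow> real" where
  "ramp a b x = max 0 (min 1 ((x - a) / (b - a)))"

lemma continuous_on_ramp: "a < b \<Longrightarrow> continuous_on S (ramp a b)"
  unfolding ramp_def by (intro continuous_intros) auto

lemma ramp_bounds: "0 \<le> ramp a b x" "ramp a b x \<le> 1"
  by (auto simp: ramp_def)

lemma ramp_eq_0: "a < b \<Longrightarrow> x \<le> a \<Longrightarrow> ramp a b x = 0"
  by (simp add: ramp_def divide_nonpos_pos)

lemma ramp_eq_1: "a < b \<Longrightarrow> b \<le> x \<Longrightarrow> ramp a b x = 1"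
  by (simp add: ramp_def)

lemma integral_ramp_le:
  assumes "0 \<le> a" "a < b" "a \<le> 1"
  shows "integral {0..1} (ramp a b) \<le> 1 - a"
proof -
  have int: "ramp a b integrable_on {x..y}" for x y
    by (intro integrable_continuous_interval continuous_on_ramp assms)
  have "integral {0..1} (ramp a b) = integral {0..a} (ramp a b) + integral {a..1} (ramp a b)"
    by (rule Henstock_Kurzweil_Integration.integral_combine[symmetric]) (use assms int in auto)
  also have "integral {0..a} (ramp a b) = integral {0..a} (\<lambda>_. 0)"
    by (rule integral_cong) (use assms ramp_eq_0 in auto)
  also have "integral {a..1} (ramp a b) \<le> integral {a..1} (\<lambda>_. 1)"
    by (rule integral_le) (use int ramp_bounds in auto)
  also have "\<dots> = 1 - a" using assms by simp
  finally show ?thesis by simp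
qed

lemma integral_ramp_ge:
  assumes "0 \<le> b" "a < b"
  shows "1 - b \<le> integral {0..1} (ramp a b)"
proof (cases "b \<le> 1")
  case True
  have int: "ramp a b integrable_on {x..y}" for x y
    by (intro integrable_continuous_interval continuous_on_ramp assms)
  have "1 - b = integral {b..1} (\<lambda>_. 1 :: real)" using True by simp
  also have "\<dots> \<le> integral {b..1} (ramp a b)"
    by (rule integral_le) (use int assms ramp_eq_1 in auto)
  also have "\<dots> \<le> integral {0..b} (ramp a b) + integral {b..1} (ramp a b)"
    using integral_nonneg[OF int] ramp_bounds by simp
  also have "\<dots> = integral {0..1} (ramp a b)"
    by (rule Henstock_Kurzweil_Integration.integral_combine) (use assms True int in auto)
  finally show ?thesis .
next
  case False
  have "0 \<le> integral {0..1} (ramp a b)"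
    by (intro integral_nonneg integrable_continuous_interval continuous_on_ramp assms ramp_bounds)
  then show ?thesis using False by simp
qed

text \<open>Continuous ramps on either side of \<open>c\<close> sandwich the indicator functions.
  Both the weak and the strict count are needed, because exp(-t^2) reverses the order and the two
  half-lines of the spectral distribution lead to different inequalities.\<close>

lemma card_limit_from_moments:
  fixes v :: "nat \<Rightarrow> nat \<Rightarrow> real"
  assumes v: "\<And>n k. v n k \<in> {0..1}"
    and mom: "\<And>s::nat. (\<lambda>n. (\<Sum>k<n. v n k ^ s) / real n) \<longlonglongrightarrow> 1 / (1 + real s)"
    and c: "0 < c" "c \<le> 1"
  shows "(\<lambda>n. real (card {k. k < n \<and> c \<le> v n k}) / real n) \<longlonglongrightarrow> 1 - c"
    and "(\<lambda>n. real (card {k. k < n \<and> c < v n k}) / real n) \<longlonglongrightarrow> 1 - c"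
proof -
  define p q where "p n = real (card {k. k < n \<and> c \<le> v n k}) / real n"
    and "q n = real (card {k. k < n \<and> c < v n k}) / real n" for n
  have card: "real (card {k. k < n \<and> P k}) = (\<Sum>k<n. of_bool (P k))" for n :: nat and P
    by (simp add: of_bool_def sum.If_cases Int_def)
  have qp: "q n \<le> p n" for n
    unfolding p_def q_def by (intro divide_right_mono of_nat_mono card_mono) auto
  have up: "\<forall>\<^sub>F n in sequentially. p n < 1 - c + r" if "r > 0" for r
  proof -
    \<comment> \<open>Below \<open>r\<close> for the accuracy, below \<open>c\<close> so that the
      ramp starts inside [0, 1].\<close>
    define d where "d = min (r / 2) (c / 2)"
    have d: "0 < d" "d < c" "d < r" using that c by (auto simp: d_def min_def)
    have "(\<lambda>n. (\<Sum>k<n. ramp (c - d) c (v n k)) / real n) \<longlonglongrightarrow> integral {0..1} (ramp (c - d) c)"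
      using d by (intro uniform_limit_from_moments v mom continuous_on_ramp) auto
    moreover have "integral {0..1} (ramp (c - d) c) < 1 - c + r"
      using integral_ramp_le[of "c - d" c] d c by simp
    ultimately have "\<forall>\<^sub>F n in sequentially. (\<Sum>k<n. ramp (c - d) c (v n k)) / real n < 1 - c + r"
      by (rule order_tendstoD(2))
    then show ?thesis
    proof eventually_elim
      case (elim n)
      have "p n \<le> (\<Sum>k<n. ramp (c - d) c (v n k)) / real n"
        unfolding p_def card using d ramp_bounds ramp_eq_1[of "c - d" c]
        by (intro divide_right_mono sum_mono) (auto simp: of_bool_def)
      with elim show ?case by simp
    qed
  qed
  have lo: "\<forall>\<^sub>F n in sequentially. 1 - c - r < q n" if "r > 0" for r
  proof -
    define d where "d = r / 2"
    have d: "0 < d" "d < r" using that by (auto simp: d_def)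
    have "(\<lambda>n. (\<Sum>k<n. ramp c (c + d) (v n k)) / real n) \<longlonglongrightarrow> integral {0..1} (ramp c (c + d))"
      using d by (intro uniform_limit_from_moments v mom continuous_on_ramp) auto
    moreover have "1 - c - r < integral {0..1} (ramp c (c + d))"
      using integral_ramp_ge[of "c + d" c] d c by simp
    ultimately have "\<forall>\<^sub>F n in sequentially. 1 - c - r < (\<Sum>k<n. ramp c (c + d) (v n k)) / real n"
      by (rule order_tendstoD(1))
    then show ?thesis
    proof eventually_elim
      case (elim n)
      have "(\<Sum>k<n. ramp c (c + d) (v n k)) / real n \<le> q n"
        unfolding q_def card using d ramp_bounds ramp_eq_0[of c "c + d"]
        by (intro divide_right_mono sum_mono) (auto simp: of_bool_def)
      with elim show ?case by simp
    qed
  qed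
  have "\<forall>\<^sub>F n in sequentially. \<bar>p n - (1 - c)\<bar> < r \<and> \<bar>q n - (1 - c)\<bar> < r" if "r > 0" for r
    using up[OF that] lo[OF that]
  proof eventually_elim
    case (elim n)
    then show ?case using qp[of n] unfolding abs_less_iff by linarith
  qed
  then have "p \<longlonglongrightarrow> 1 - c" "q \<longlonglongrightarrow> 1 - c"
    unfolding tendsto_iff dist_real_def eventually_conj_iff by blast+
  then show "(\<lambda>n. real (card {k. k < n \<and> c \<le> v n k}) / real n) \<longlonglongrightarrow> 1 - c"
    "(\<lambda>n. real (card {k. k < n \<and> c < v n k}) / real n) \<longlonglongrightarrow> 1 - c"
    unfolding p_def q_def .
qed

text \<open>The law of the square root of a standard exponential variable with an independent fair
  sign; its density is |t| exp(-t^2).\<close>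

definition rayleigh_sym_cdf :: "real \<Rightarrow> real" where
  "rayleigh_sym_cdf t = (if t < 0 then exp (- t\<^sup>2) / 2 else 1 - exp (- t\<^sup>2) / 2)"

text \<open>Passing to \<open>v = exp (- |eg|^2)\<close> places the problem on [0, 1], where the
  hypothesis gives all moments. Counts of \<open>v\<close> above \<open>exp (- t\<^sup>2)\<close>
  are counts of moduli below |t|, and sign symmetry converts these into the spectral
  distribution.\<close>

lemma esd_hankel_tendsto:
  fixes y :: "nat \<Rightarrow> nat \<Rightarrow> real"
  assumes e: "e \<le> 1"
    and y: "\<And>n l. 1 \<le> l \<Longrightarrow> l \<le> n \<Longrightarrow> y n (l + n) = (- 1) ^ e * y n l"
    and A: "\<And>n. A n \<in> carrier_mat n n"
    and A_eq: "\<And>n i j. i < n \<Longrightarrow> j < n \<Longrightarrow> A n $$ (i, j) = (1 / sqrt (real n)) * y n (i + j + 2)"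
    and lim: "\<And>s::nat. s \<ge> 1 \<Longrightarrow>
      (\<lambda>n. (\<Sum>k<n. exp (- (real s * ((cmod (dft n e (y n) k))\<^sup>2 / real n)))) / real n) \<longlonglongrightarrow> 1 / (1 + real s)"
  shows "(\<lambda>n. esd (A n) t) \<longlonglongrightarrow> rayleigh_sym_cdf t"
proof -
  define v where "v n k = exp (- ((cmod (dft n e (y n) k))\<^sup>2 / real n))" for n k
  have v: "v n k \<in> {0..1}" for n k by (simp add: v_def)
  have mom: "(\<lambda>n. (\<Sum>k<n. v n k ^ s) / real n) \<longlonglongrightarrow> 1 / (1 + real s)" for s
  proof (cases "s \<ge> 1")
    case True
    then show ?thesis using lim[of s] by (simp add: v_def exp_of_nat_mult[symmetric])
  next
    case False
    \<comment> \<open>The zeroth moment is 1 only for \<open>n > 0\<close>; at \<open>n = 0\<close>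
      the quotient is 0 by the convention on division.\<close>
    then have [simp]: "s = 0" by simp
    have "\<forall>\<^sub>F n in sequentially. (\<Sum>k<n. v n k ^ s) / real n = 1"
      using eventually_gt_at_top[of 0] by eventually_elim simp
    then show ?thesis using tendsto_eventually by force
  qed
  define Q where "Q n eg \<longleftrightarrow> (\<forall>t. esd (A n) t = real (card {k. k < n \<and> eg k \<le> t}) / real n) \<and>
      (\<forall>k<n. \<bar>eg k\<bar> = (1 / sqrt (real n)) * cmod (dft n e (y n) k)) \<and>
      (\<forall>k<n. k < conj_index n e k \<longrightarrow> eg k \<ge> 0) \<and> (\<forall>k<n. conj_index n e k < k \<longrightarrow> eg k \<le> 0)"
    for n and eg :: "nat \<Rightarrow> real"
  have Q_ex: "\<exists>eg. Q n eg" if n: "n > 0" for n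
  proof (rule esd_hankel[of e n "1 / sqrt (real n)" "y n" "A n", OF e n], goal_cases)
    case (5 eg)
    then show ?case unfolding Q_def by (intro exI[of _ eg] conjI allI impI)
  qed (simp_all add: y A A_eq)
  define eg where "eg n = (SOME g. Q n g)" for n
  have Q: "Q n (eg n)" if "n > 0" for n
    unfolding eg_def by (rule someI_ex[OF Q_ex[OF that]])
  have eg_esd: "esd (A n) t = real (card {k. k < n \<and> eg n k \<le> t}) / real n" if "n > 0" for n t
    using Q[OF that] unfolding Q_def by blast
  have eg_abs: "\<bar>eg n k\<bar> = (1 / sqrt (real n)) * cmod (dft n e (y n) k)" if "n > 0" "k < n" for n k
    using Q[OF that(1)] that(2) unfolding Q_def by blast
  have eg_pos: "eg n k \<ge> 0" if "n > 0" "k < n" "k < conj_index n e k" for n k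
    using Q[OF that(1)] that(2,3) unfolding Q_def by blast
  have eg_neg: "eg n k \<le> 0" if "n > 0" "k < n" "conj_index n e k < k" for n k
    using Q[OF that(1)] that(2,3) unfolding Q_def by blast
  have eg_v: "v n k = exp (- (\<bar>eg n k\<bar>)\<^sup>2)" if "n > 0" "k < n" for n k
    unfolding eg_abs[OF that] v_def using that by (simp add: power_mult_distrib power_divide)
  have inv: "\<bar>eg n (conj_index n e k)\<bar> = \<bar>eg n k\<bar>" if "n > 0" "k < n" for n k
    using that e by (simp add: eg_abs conj_index_less dft_conj_index)
  \<comment> \<open>The error 4 of \<open>card_sign_symmetric\<close>, divided by
    \<open>2 * n\<close>.\<close>
  have small: "(\<lambda>n. 2 / real n) \<longlonglongrightarrow> 0"
    by (rule lim_const_over_n)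
  show ?thesis
  proof (cases "t \<ge> 0")
    case True
    have "(\<lambda>n. real (card {k. k < n \<and> exp (- t\<^sup>2) \<le> v n k}) / real n) \<longlonglongrightarrow> 1 - exp (- t\<^sup>2)"
      by (rule card_limit_from_moments(1)[OF v mom]) auto
    then have lim1: "(\<lambda>n. (1 + real (card {k. k < n \<and> exp (- t\<^sup>2) \<le> v n k}) / real n) / 2)
        \<longlonglongrightarrow> (1 + (1 - exp (- t\<^sup>2))) / 2"
      by (intro tendsto_intros) auto
    have "(\<lambda>n. esd (A n) t - (1 + real (card {k. k < n \<and> exp (- t\<^sup>2) \<le> v n k}) / real n) / 2) \<longlonglongrightarrow> 0"
    proof (rule Lim_null_comparison[OF _ small], rule eventually_mono[OF eventually_gt_at_top[of 0]])
      fix n :: nat assume n: "n > 0"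
      have "{k. k < n \<and> exp (- t\<^sup>2) \<le> v n k} = {k. k < n \<and> \<bar>eg n k\<bar> \<le> t}"
        using n True by (auto simp: eg_v abs_le_square_iff[symmetric] simp del: power2_abs)
      then show "norm (esd (A n) t - (1 + real (card {k. k < n \<and> exp (- t\<^sup>2) \<le> v n k}) / real n) / 2) \<le> 2 / real n"
        using card_sign_symmetric(1)[of e n "eg n" t] e n True inv eg_pos eg_neg
        by (simp add: eg_esd[OF n] field_simps abs_le_iff)
    qed
    from tendsto_add[OF this lim1] True show ?thesis
      by (simp add: rayleigh_sym_cdf_def field_simps)
  next
    case False
    have "(\<lambda>n. real (card {k. k < n \<and> exp (- t\<^sup>2) < v n k}) / real n) \<longlonglongrightarrow> 1 - exp (- t\<^sup>2)"
      by (rule card_limit_from_moments(2)[OF v mom]) auto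
    then have lim1: "(\<lambda>n. (1 - real (card {k. k < n \<and> exp (- t\<^sup>2) < v n k}) / real n) / 2)
        \<longlonglongrightarrow> (1 - (1 - exp (- t\<^sup>2))) / 2"
      by (intro tendsto_intros) auto
    have "(\<lambda>n. esd (A n) t - (1 - real (card {k. k < n \<and> exp (- t\<^sup>2) < v n k}) / real n) / 2) \<longlonglongrightarrow> 0"
    proof (rule Lim_null_comparison[OF _ small], rule eventually_mono[OF eventually_gt_at_top[of 0]])
      fix n :: nat assume n: "n > 0"
      have "{k. k < n \<and> exp (- t\<^sup>2) < v n k} = {k. k < n \<and> \<bar>eg n k\<bar> < - t}"
      proof -
        have "(\<bar>g\<bar>)\<^sup>2 < t\<^sup>2 \<longleftrightarrow> \<bar>g\<bar> < - t" for g
          using abs_le_square_iff[of t g] False by (simp only: power2_abs) linarith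
        then have "exp (- t\<^sup>2) < v n k \<longleftrightarrow> \<bar>eg n k\<bar> < - t" if "k < n" for k
          unfolding eg_v[OF n that] by (simp only: exp_less_cancel_iff neg_less_iff_less)
        then show ?thesis by blast
      qed
      then show "norm (esd (A n) t - (1 - real (card {k. k < n \<and> exp (- t\<^sup>2) < v n k}) / real n) / 2) \<le> 2 / real n"
        using card_sign_symmetric(2)[of e n "eg n" t] e n False inv eg_pos eg_neg
        by (simp add: eg_esd[OF n] field_simps abs_le_iff)
    qed
    from tendsto_add[OF this lim1] False show ?thesis
      by (simp add: rayleigh_sym_cdf_def field_simps)
  qed
qed

section \<open>The Efron--Stein inequality\<close>

lemma (in prob_space) integrable_real_bounded:
  fixes f :: "'a \<Rightarrow> real"
  assumes "f \<in> borel_measurable M" "\<And>x. x \<in> space M \<Longrightarrow> \<bar>f x\<bar> \<le> b"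
  shows "integrable M f"
  by (rule integrable_const_bound[of _ b]) (use assms in auto)

text \<open>A non-integrable function has integral 0 by convention, which a nonnegative
  \<open>b\<close> also dominates; so no integrability has to be shown when the bound is
  applied.\<close>

lemma (in prob_space) integral_le_bound:
  fixes f :: "'a \<Rightarrow> real"
  assumes "\<And>x. x \<in> space M \<Longrightarrow> f x \<le> b" "b \<ge> 0"
  shows "(\<integral>x. f x \<partial>M) \<le> b"
proof (cases "integrable M f")
  case True
  then have "(\<integral>x. f x \<partial>M) \<le> (\<integral>x. b \<partial>M)"
    by (intro integral_mono) (use assms in auto)
  then show ?thesis by (simp add: prob_space)
qed (use assms in \<open>simp add: not_integrable_integral_eq\<close>)

lemma (in prob_space) abs_integral_le_bound:
  fixes f :: "'a \<Rightarrow> real"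
  assumes "\<And>x. x \<in> space M \<Longrightarrow> \<bar>f x\<bar> \<le> b"
  shows "\<bar>\<integral>x. f x \<partial>M\<bar> \<le> b"
proof -
  obtain x where "x \<in> space M" using not_empty by blast
  then have b: "b \<ge> 0" using assms abs_ge_zero order_trans by blast
  have "\<bar>\<integral>x. f x \<partial>M\<bar> \<le> (\<integral>x. \<bar>f x\<bar> \<partial>M)" by (rule integral_abs_bound)
  also have "\<dots> \<le> b" by (rule integral_le_bound) (use assms b in auto)
  finally show ?thesis .
qed

lemma (in prob_space) square_integral_le:
  fixes f :: "'a \<Rightarrow> real"
  assumes "integrable M f" "integrable M (\<lambda>x. (f x)\<^sup>2)"
  shows "(\<integral>x. f x \<partial>M)\<^sup>2 \<le> (\<integral>x. (f x)\<^sup>2 \<partial>M)"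
  using variance_eq[OF assms] variance_positive[of f] by linarith

lemma square_le_bound: "\<bar>a :: real\<bar> \<le> b \<Longrightarrow> a\<^sup>2 \<le> b\<^sup>2"
  by (simp add: abs_le_square_iff[symmetric])

lemma abs_square_le: "\<bar>a :: real\<bar> \<le> b \<Longrightarrow> \<bar>a\<^sup>2\<bar> \<le> b\<^sup>2"
  by (simp add: abs_le_square_iff[symmetric])

text \<open>Jensen's inequality in the independent copy \<open>y\<close>. The exact identity would
  have half of the right side; the lost factor 2 is harmless, as only rates matter later.\<close>

lemma (in prob_space) variance_le_resample:
  fixes g :: "'a \<Rightarrow> real"
  assumes g[measurable]: "g \<in> borel_measurable M" and b: "\<And>x. x \<in> space M \<Longrightarrow> \<bar>g x\<bar> \<le> b"
  shows "(\<integral>x. (g x)\<^sup>2 \<partial>M) - (\<integral>x. g x \<partial>M)\<^sup>2 \<le> (\<integral>x. (\<integral>y. (g x - g y)\<^sup>2 \<partial>M) \<partial>M)"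
proof -
  interpret P: pair_prob_space M M by standard
  have d: "\<bar>g x - g y\<bar> \<le> 2 * b" if "x \<in> space M" "y \<in> space M" for x y
    using b[OF that(1)] b[OF that(2)] by linarith
  note d2 = abs_square_le[OF d]
  have dm: "\<bar>g x - (\<integral>y. g y \<partial>M)\<bar> \<le> 2 * b" if "x \<in> space M" for x
    using b[OF that] abs_integral_le_bound[of g b, OF b] by linarith
  have ig: "integrable M g" by (rule integrable_real_bounded[OF g b])
  have ig2: "integrable M (\<lambda>x. (g x)\<^sup>2)"
    by (rule integrable_real_bounded[OF _ abs_square_le[OF b]]) auto
  have "(\<integral>x. (g x)\<^sup>2 \<partial>M) - (\<integral>x. g x \<partial>M)\<^sup>2 = (\<integral>x. (g x - (\<integral>y. g y \<partial>M))\<^sup>2 \<partial>M)"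
    using variance_eq[OF ig ig2] by simp
  also have "\<dots> \<le> (\<integral>x. (\<integral>y. (g x - g y)\<^sup>2 \<partial>M) \<partial>M)"
  proof (rule integral_mono)
    show "integrable M (\<lambda>x. (g x - (\<integral>y. g y \<partial>M))\<^sup>2)"
      by (rule integrable_real_bounded[of _ "(2 * b)\<^sup>2"], measurable) (rule abs_square_le[OF dm])
    show "integrable M (\<lambda>x. \<integral>y. (g x - g y)\<^sup>2 \<partial>M)"
      by (rule integrable_real_bounded[of _ "(2 * b)\<^sup>2"], measurable)
        (rule abs_integral_le_bound[OF d2])
    fix x assume x: "x \<in> space M"
    have "(g x - (\<integral>y. g y \<partial>M)) = (\<integral>y. (g x - g y) \<partial>M)"
      using ig by (simp add: prob_space)
    also have "\<dots>\<^sup>2 \<le> (\<integral>y. (g x - g y)\<^sup>2 \<partial>M)"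
      by (rule square_integral_le; rule integrable_real_bounded, measurable)
        (use d[OF x] d2[OF x] in auto)
    finally show "(g x - (\<integral>y. g y \<partial>M))\<^sup>2 \<le> (\<integral>y. (g x - g y)\<^sup>2 \<partial>M)" .
  qed
  finally show ?thesis .
qed

section \<open>Products of probability spaces and resampling of a coordinate\<close>

locale prob_family =
  fixes M :: "'i \<Rightarrow> 'a measure"
  assumes prob_space: "\<And>i. prob_space (M i)"
begin

sublocale M: prob_space "M i" for i
  by (rule prob_space)

sublocale product_sigma_finite M
  by standard (rule M.sigma_finite_countable)

lemma integral_PiM_insert:
  fixes f :: "('i \<Rightarrow> 'a) \<Rightarrow> real"
  assumes J: "finite J" "i \<notin> J"
    and f: "f \<in> borel_measurable (PiM (insert i J) M)"
    and b: "\<And>w. w \<in> space (PiM (insert i J) M) \<Longrightarrow> \<bar>f w\<bar> \<le> b"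
  shows "(\<integral>w. f w \<partial>PiM (insert i J) M) = (\<integral>x. (\<integral>y. f (x(i := y)) \<partial>M i) \<partial>PiM J M)"
    and "(\<integral>w. f w \<partial>PiM (insert i J) M) = (\<integral>y. (\<integral>x. f (x(i := y)) \<partial>PiM J M) \<partial>M i)"
proof -
  interpret I: prob_space "PiM (insert i J) M" by (rule prob_space_PiM) (rule prob_space)
  interpret J: prob_space "PiM J M" by (rule prob_space_PiM) (rule prob_space)
  interpret P: pair_prob_space "PiM J M" "M i" by standard
  show 1: "(\<integral>w. f w \<partial>PiM (insert i J) M) = (\<integral>x. (\<integral>y. f (x(i := y)) \<partial>M i) \<partial>PiM J M)"
    by (rule product_integral_insert[OF J I.integrable_real_bounded[OF f b]])
  have m: "(\<lambda>(x, y). f (x(i := y))) \<in> borel_measurable (PiM J M \<Otimes>\<^sub>M M i)"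
    using measurable_compose[OF measurable_add_dim f] by (simp add: case_prod_beta)
  have "integrable (PiM J M \<Otimes>\<^sub>M M i) (\<lambda>(x, y). f (x(i := y)))"
  proof (rule P.integrable_real_bounded[OF m, of b])
    fix z assume "z \<in> space (PiM J M \<Otimes>\<^sub>M M i)"
    then have "(case z of (x, y) \<Rightarrow> x(i := y)) \<in> space (PiM (insert i J) M)"
      by (rule measurable_space[OF measurable_add_dim])
    then show "\<bar>case z of (x, y) \<Rightarrow> f (x(i := y))\<bar> \<le> b"
      using b by (auto simp: case_prod_beta)
  qed
  then have "(\<integral>y. (\<integral>x. f (x(i := y)) \<partial>PiM J M) \<partial>M i) = (\<integral>x. (\<integral>y. f (x(i := y)) \<partial>M i) \<partial>PiM J M)"
    by (rule P.Fubini_integral)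
  with 1 show "(\<integral>w. f w \<partial>PiM (insert i J) M) = (\<integral>y. (\<integral>x. f (x(i := y)) \<partial>PiM J M) \<partial>M i)"
    by simp
qed

lemma measurable_resample:
  assumes "i \<in> I"
  shows "(\<lambda>(w, z). w(i := z)) \<in> measurable (PiM I M \<Otimes>\<^sub>M M i) (PiM I M)"
  using measurable_add_dim[of i I M] assms by (simp add: insert_absorb)

lemma resample_in_space:
  assumes "i \<in> I" "w \<in> space (PiM I M)" "z \<in> space (M i)"
  shows "w(i := z) \<in> space (PiM I M)"
  using measurable_space[OF measurable_resample[OF assms(1)], of "(w, z)"] assms(2,3)
  by (simp add: space_pair_measure)

text \<open>Redrawing one coordinate preserves a product measure: the inner integral forgets the old
  value. This allows one input to be averaged while the others are frozen.\<close>

lemma integral_PiM_resample: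
  fixes f :: "('i \<Rightarrow> 'a) \<Rightarrow> real"
  assumes I: "finite I" "i \<in> I"
    and f: "f \<in> borel_measurable (PiM I M)"
    and b: "\<And>w. w \<in> space (PiM I M) \<Longrightarrow> \<bar>f w\<bar> \<le> b"
  shows "(\<integral>w. f w \<partial>PiM I M) = (\<integral>w. (\<integral>z. f (w(i := z)) \<partial>M i) \<partial>PiM I M)"
proof -
  define J where "J = I - {i}"
  have J: "finite J" "i \<notin> J" and IJ: "I = insert i J" using I by (auto simp: J_def)
  have m: "(\<lambda>w. \<integral>z. f (w(i := z)) \<partial>M i) \<in> borel_measurable (PiM I M)"
    using measurable_compose[OF measurable_resample[OF I(2)] f]
    by (intro M.borel_measurable_lebesgue_integral) (simp add: case_prod_beta)
  have bd: "\<bar>\<integral>z. f (w(i := z)) \<partial>M i\<bar> \<le> b" if "w \<in> space (PiM I M)" for w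
    by (rule M.abs_integral_le_bound) (rule b[OF resample_in_space[OF I(2) that]])
  have "(\<integral>w. (\<integral>z. f (w(i := z)) \<partial>M i) \<partial>PiM I M)
      = (\<integral>x. (\<integral>y. (\<integral>z. f ((x(i := y))(i := z)) \<partial>M i) \<partial>M i) \<partial>PiM J M)"
    using m bd unfolding IJ by (intro integral_PiM_insert(1)[OF J])
  also have "\<dots> = (\<integral>x. (\<integral>z. f (x(i := z)) \<partial>M i) \<partial>PiM J M)"
    by (simp add: M.prob_space)
  also have "\<dots> = (\<integral>w. f w \<partial>PiM I M)"
    using f b unfolding IJ by (intro integral_PiM_insert(1)[OF J, symmetric])
  finally show ?thesis by simp
qed

definition resample_var :: "(('i \<Rightarrow> 'a) \<Rightarrow> real) \<Rightarrow> 'i \<Rightarrow> ('i \<Rightarrow> 'a) \<Rightarrow> real" where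
  "resample_var f i w = (\<integral>z. (f w - f (w(i := z)))\<^sup>2 \<partial>M i)"

lemma resample_var_measurable:
  assumes "i \<in> I" and f[measurable]: "f \<in> borel_measurable (PiM I M)"
  shows "resample_var f i \<in> borel_measurable (PiM I M)"
proof -
  have [measurable]: "(\<lambda>p. f ((fst p)(i := snd p))) \<in> borel_measurable (PiM I M \<Otimes>\<^sub>M M i)"
    using measurable_compose[OF measurable_resample[OF assms(1)] f] by (simp add: case_prod_beta)
  show ?thesis
    unfolding resample_var_def
    by (intro M.borel_measurable_lebesgue_integral) (simp add: case_prod_beta)
qed

lemma resample_var_bound:
  assumes "i \<in> I" and b: "\<And>w. w \<in> space (PiM I M) \<Longrightarrow> \<bar>f w\<bar> \<le> b" and w: "w \<in> space (PiM I M)"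
  shows "\<bar>resample_var f i w\<bar> \<le> (2 * b)\<^sup>2"
  unfolding resample_var_def
proof (rule M.abs_integral_le_bound, rule abs_square_le)
  fix z assume "z \<in> space (M i)"
  then show "\<bar>f w - f (w(i := z))\<bar> \<le> 2 * b"
    using b[OF w] b[OF resample_in_space[OF assms(1) w, of z]] by linarith
qed

text \<open>Induction over the coordinates by the law of total variance. Given the new coordinate,
  the conditional variance falls under the induction hypothesis; the conditional mean depends on a
  single coordinate and is handled by \<open>variance_le_resample\<close>. The constant is 1 instead
  of the sharp 1/2.\<close>

theorem efron_stein:
  assumes "finite I" and "f \<in> borel_measurable (PiM I M)"
    and "\<And>w. w \<in> space (PiM I M) \<Longrightarrow> \<bar>f w\<bar> \<le> b"
  shows "(\<integral>w. (f w)\<^sup>2 \<partial>PiM I M) - (\<integral>w. f w \<partial>PiM I M)\<^sup>2 \<le> (\<Sum>i\<in>I. \<integral>w. resample_var f i w \<partial>PiM I M)"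
  using assms
proof (induction I arbitrary: f rule: finite_induct)
  case empty
  then show ?case by (simp add: PiM_empty lebesgue_integral_count_space_finite)
next
  case (insert i J)
  define I where "I = insert i J"
  have iI: "i \<in> I" by (simp add: I_def)
  note fm = insert.prems(1)[folded I_def] and fb = insert.prems(2)[folded I_def]
  interpret I: prob_space "PiM I M" by (rule prob_space_PiM) (rule prob_space)
  interpret J: prob_space "PiM J M" by (rule prob_space_PiM) (rule prob_space)
  interpret P: pair_prob_space "PiM J M" "M i" by standard
  have upd: "x(i := y) \<in> space (PiM I M)" if "x \<in> space (PiM J M)" "y \<in> space (M i)" for x y
    using measurable_space[OF measurable_add_dim[of i J M], of "(x, y)"] that
    by (simp add: space_pair_measure I_def)
  have fxy[measurable]: "(\<lambda>p. f ((fst p)(i := snd p))) \<in> borel_measurable (PiM J M \<Otimes>\<^sub>M M i)"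
    using measurable_compose[OF measurable_add_dim[of i J M] fm[unfolded I_def]] by (simp only: case_prod_beta)
  have fyx: "(\<lambda>p. f ((snd p)(i := fst p))) \<in> borel_measurable (M i \<Otimes>\<^sub>M PiM J M)"
    using measurable_compose[OF measurable_pair_swap' fxy] by (simp add: case_prod_beta)
  have fy: "(\<lambda>x. f (x(i := y))) \<in> borel_measurable (PiM J M)" if "y \<in> space (M i)" for y
    using measurable_compose[OF measurable_Pair2'[OF that] fxy] by simp
  have fx: "(\<lambda>y. f (x(i := y))) \<in> borel_measurable (M i)" if "x \<in> space (PiM J M)" for x
    using measurable_compose[OF measurable_Pair1'[OF that] fxy] by simp
  \<comment> \<open>The conditional mean of \<open>f\<close> given the coordinate
    \<open>i\<close>.\<close>
  define g where "g y = (\<integral>x. f (x(i := y)) \<partial>PiM J M)" for y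
  have gm[measurable]: "g \<in> borel_measurable (M i)"
    unfolding g_def by (intro J.borel_measurable_lebesgue_integral) (use fyx in \<open>simp add: case_prod_beta\<close>)
  have fb': "\<bar>f (x(i := y))\<bar> \<le> b" if "x \<in> space (PiM J M)" "y \<in> space (M i)" for x y
    using fb[OF upd[OF that]] .
  have gb: "\<bar>g y\<bar> \<le> b" if "y \<in> space (M i)" for y
    unfolding g_def by (rule J.abs_integral_le_bound) (rule fb'[OF _ that])
  have f2: "(\<integral>w. (f w)\<^sup>2 \<partial>PiM I M) = (\<integral>y. (\<integral>x. (f (x(i := y)))\<^sup>2 \<partial>PiM J M) \<partial>M i)"
    unfolding I_def
    by (rule integral_PiM_insert(2)[OF insert.hyps(1,2), of _ "b\<^sup>2"])
      (use fm fb in \<open>auto simp: I_def intro!: square_le_bound\<close>)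
  have f1: "(\<integral>w. f w \<partial>PiM I M) = (\<integral>y. g y \<partial>M i)"
    unfolding I_def g_def
    by (rule integral_PiM_insert(2)[OF insert.hyps(1,2), of _ b]) (use fm fb in \<open>auto simp: I_def\<close>)
  define S where "S y = (\<Sum>j\<in>J. \<integral>x. resample_var (\<lambda>x. f (x(i := y))) j x \<partial>PiM J M)" for y
  have IH: "(\<integral>x. (f (x(i := y)))\<^sup>2 \<partial>PiM J M) - (g y)\<^sup>2 \<le> S y" if "y \<in> space (M i)" for y
    unfolding g_def S_def by (rule insert.IH[OF fy[OF that] fb'[OF _ that]])
  \<comment> \<open>Fixing coordinate \<open>i\<close> commutes with resampling another coordinate
    \<open>j\<close>, so the terms of the induction hypothesis are slices of the terms
    wanted.\<close>
  have rv_eq: "resample_var (\<lambda>x. f (x(i := y))) j x = resample_var f j (x(i := y))" if "j \<in> J" for j x y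
  proof -
    have "j \<noteq> i" using that insert.hyps(2) by auto
    then show ?thesis by (simp add: resample_var_def fun_upd_twist[of j i])
  qed
  have rv_int: "(\<integral>w. resample_var f j w \<partial>PiM I M)
      = (\<integral>y. (\<integral>x. resample_var f j (x(i := y)) \<partial>PiM J M) \<partial>M i)"
    and rv_meas: "(\<lambda>y. \<integral>x. resample_var f j (x(i := y)) \<partial>PiM J M) \<in> borel_measurable (M i)"
    and rv_bd: "y \<in> space (M i) \<Longrightarrow> \<bar>\<integral>x. resample_var f j (x(i := y)) \<partial>PiM J M\<bar> \<le> (2 * b)\<^sup>2"
    if "j \<in> I" for j y
  proof -
    note m = resample_var_measurable[OF that fm]
    note bd = resample_var_bound[OF that fb]
    show "(\<integral>w. resample_var f j w \<partial>PiM I M)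
      = (\<integral>y. (\<integral>x. resample_var f j (x(i := y)) \<partial>PiM J M) \<partial>M i)"
      using m bd unfolding I_def by (intro integral_PiM_insert(2)[OF insert.hyps(1,2)])
    have "(\<lambda>p. resample_var f j ((fst p)(i := snd p))) \<in> borel_measurable (PiM J M \<Otimes>\<^sub>M M i)"
      using measurable_compose[OF measurable_add_dim[of i J M]] m by (simp add: case_prod_beta I_def)
    from measurable_compose[OF measurable_pair_swap' this]
    show "(\<lambda>y. \<integral>x. resample_var f j (x(i := y)) \<partial>PiM J M) \<in> borel_measurable (M i)"
      by (intro J.borel_measurable_lebesgue_integral) (simp add: case_prod_beta)
    show "y \<in> space (M i) \<Longrightarrow> \<bar>\<integral>x. resample_var f j (x(i := y)) \<partial>PiM J M\<bar> \<le> (2 * b)\<^sup>2"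
      by (rule J.abs_integral_le_bound) (intro bd upd)
  qed
  have S_int: "integrable (M i) S" "(\<integral>y. S y \<partial>M i) = (\<Sum>j\<in>J. \<integral>w. resample_var f j w \<partial>PiM I M)"
  proof -
    have S_eq: "S = (\<lambda>y. \<Sum>j\<in>J. \<integral>x. resample_var f j (x(i := y)) \<partial>PiM J M)"
      unfolding S_def by (intro ext sum.cong refl Bochner_Integration.integral_cong) (simp add: rv_eq)
    have int: "integrable (M i) (\<lambda>y. \<integral>x. resample_var f j (x(i := y)) \<partial>PiM J M)" if "j \<in> J" for j
      using that by (intro M.integrable_real_bounded[OF rv_meas rv_bd]) (auto simp: I_def)
    show "integrable (M i) S" unfolding S_eq by (intro Bochner_Integration.integrable_sum int)
    show "(\<integral>y. S y \<partial>M i) = (\<Sum>j\<in>J. \<integral>w. resample_var f j w \<partial>PiM I M)"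
      unfolding S_eq
      by (subst Bochner_Integration.integral_sum, erule int)
        (intro sum.cong refl rv_int[symmetric], simp add: I_def)
  qed
  have int_f2: "integrable (M i) (\<lambda>y. \<integral>x. (f (x(i := y)))\<^sup>2 \<partial>PiM J M)"
  proof (rule M.integrable_real_bounded[of _ _ "b\<^sup>2"])
    show "(\<lambda>y. \<integral>x. (f (x(i := y)))\<^sup>2 \<partial>PiM J M) \<in> borel_measurable (M i)"
      by (intro J.borel_measurable_lebesgue_integral) (use fyx in \<open>simp add: case_prod_beta\<close>)
    show "\<bar>\<integral>x. (f (x(i := y)))\<^sup>2 \<partial>PiM J M\<bar> \<le> b\<^sup>2" if "y \<in> space (M i)" for y
      by (rule J.abs_integral_le_bound, rule abs_square_le, rule fb'[OF _ that])
  qed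
  have int_g2: "integrable (M i) (\<lambda>y. (g y)\<^sup>2)"
    by (rule M.integrable_real_bounded[of _ _ "b\<^sup>2"]) (auto intro!: square_le_bound gb)
  have part1: "(\<integral>w. (f w)\<^sup>2 \<partial>PiM I M) - (\<integral>y. (g y)\<^sup>2 \<partial>M i) \<le> (\<Sum>j\<in>J. \<integral>w. resample_var f j w \<partial>PiM I M)"
  proof -
    have "(\<integral>w. (f w)\<^sup>2 \<partial>PiM I M) - (\<integral>y. (g y)\<^sup>2 \<partial>M i)
        = (\<integral>y. ((\<integral>x. (f (x(i := y)))\<^sup>2 \<partial>PiM J M) - (g y)\<^sup>2) \<partial>M i)"
      unfolding f2 by (rule Bochner_Integration.integral_diff[symmetric]) (rule int_f2 int_g2)+
    also have "\<dots> \<le> (\<integral>y. S y \<partial>M i)"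
      by (intro integral_mono Bochner_Integration.integrable_diff int_f2 int_g2 S_int(1) IH)
    finally show ?thesis using S_int(2) by simp
  qed
  have part2: "(\<integral>y. (g y)\<^sup>2 \<partial>M i) - (\<integral>y. g y \<partial>M i)\<^sup>2 \<le> (\<integral>w. resample_var f i w \<partial>PiM I M)"
  proof -
    interpret Q: pair_prob_space "PiM J M \<Otimes>\<^sub>M M i" "M i" by standard
    have d: "\<bar>f (x(i := y)) - f (x(i := z))\<bar> \<le> 2 * b"
      if "x \<in> space (PiM J M)" "y \<in> space (M i)" "z \<in> space (M i)" for x y z
      using fb'[OF that(1,2)] fb'[OF that(1,3)] by linarith
    have dm: "(\<lambda>x. f (x(i := y)) - f (x(i := z))) \<in> borel_measurable (PiM J M)"
      if "y \<in> space (M i)" "z \<in> space (M i)" for y z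
      by (intro borel_measurable_diff fy that)
    have "(\<integral>y. (g y)\<^sup>2 \<partial>M i) - (\<integral>y. g y \<partial>M i)\<^sup>2 \<le> (\<integral>y. (\<integral>z. (g y - g z)\<^sup>2 \<partial>M i) \<partial>M i)"
      by (rule M.variance_le_resample[OF gm gb])
    also have "\<dots> \<le> (\<integral>y. (\<integral>z. (\<integral>x. (f (x(i := y)) - f (x(i := z)))\<^sup>2 \<partial>PiM J M) \<partial>M i) \<partial>M i)"
    proof -
      \<comment> \<open>Jensen over the remaining coordinates: a difference of conditional means is
        a mean of differences.\<close>
      have le: "(g y - g z)\<^sup>2 \<le> (\<integral>x. (f (x(i := y)) - f (x(i := z)))\<^sup>2 \<partial>PiM J M)"
        if yz: "y \<in> space (M i)" "z \<in> space (M i)" for y z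
      proof -
        have "g y - g z = (\<integral>x. f (x(i := y)) - f (x(i := z)) \<partial>PiM J M)"
          unfolding g_def
          by (intro Bochner_Integration.integral_diff[symmetric] J.integrable_real_bounded[OF fy fb'] yz)
        also have "\<dots>\<^sup>2 \<le> (\<integral>x. (f (x(i := y)) - f (x(i := z)))\<^sup>2 \<partial>PiM J M)"
          by (rule J.square_integral_le; rule J.integrable_real_bounded)
            (use dm[OF yz] d[OF _ yz] abs_square_le[OF d[OF _ yz]] in auto)
        finally show ?thesis .
      qed
      have m3: "(\<lambda>(y, z). \<integral>x. (f (x(i := y)) - f (x(i := z)))\<^sup>2 \<partial>PiM J M) \<in> borel_measurable (M i \<Otimes>\<^sub>M M i)"
      proof -
        have swfst: "(\<lambda>p. (snd p, fst (fst p))) \<in> measurable ((M i \<Otimes>\<^sub>M M i) \<Otimes>\<^sub>M PiM J M) (PiM J M \<Otimes>\<^sub>M M i)"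
          and swsnd: "(\<lambda>p. (snd p, snd (fst p))) \<in> measurable ((M i \<Otimes>\<^sub>M M i) \<Otimes>\<^sub>M PiM J M) (PiM J M \<Otimes>\<^sub>M M i)"
          by measurable
        have "(\<lambda>p. f ((snd p)(i := fst (fst p)))) \<in> borel_measurable ((M i \<Otimes>\<^sub>M M i) \<Otimes>\<^sub>M PiM J M)"
          using measurable_compose[OF swfst fxy] by simp
        moreover have "(\<lambda>p. f ((snd p)(i := snd (fst p)))) \<in> borel_measurable ((M i \<Otimes>\<^sub>M M i) \<Otimes>\<^sub>M PiM J M)"
          using measurable_compose[OF swsnd fxy] by simp
        ultimately show ?thesis
          unfolding case_prod_beta
          by (intro J.borel_measurable_lebesgue_integral) (simp add: case_prod_beta)
      qed
      have b3: "\<bar>\<integral>x. (f (x(i := y)) - f (x(i := z)))\<^sup>2 \<partial>PiM J M\<bar> \<le> (2 * b)\<^sup>2"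
        if "y \<in> space (M i)" "z \<in> space (M i)" for y z
        by (rule J.abs_integral_le_bound, rule abs_square_le, rule d[OF _ that])
      have gd: "\<bar>g y - g z\<bar> \<le> 2 * b" if "y \<in> space (M i)" "z \<in> space (M i)" for y z
        using gb[OF that(1)] gb[OF that(2)] by linarith
      have m3': "(\<lambda>z. \<integral>x. (f (x(i := y)) - f (x(i := z)))\<^sup>2 \<partial>PiM J M) \<in> borel_measurable (M i)"
        if "y \<in> space (M i)" for y
        using measurable_compose[OF measurable_Pair1'[OF that] m3] by simp
      show ?thesis
      proof (intro integral_mono)
        show "integrable (M i) (\<lambda>y. \<integral>z. (g y - g z)\<^sup>2 \<partial>M i)"
          by (rule M.integrable_real_bounded[of _ _ "(2 * b)\<^sup>2"], measurable)
            (rule M.abs_integral_le_bound, rule abs_square_le, rule gd)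
        show "integrable (M i) (\<lambda>y. \<integral>z. (\<integral>x. (f (x(i := y)) - f (x(i := z)))\<^sup>2 \<partial>PiM J M) \<partial>M i)"
          by (rule M.integrable_real_bounded[of _ _ "(2 * b)\<^sup>2"], rule M.borel_measurable_lebesgue_integral[OF m3])
            (rule M.abs_integral_le_bound, rule b3)
        fix y assume y: "y \<in> space (M i)"
        show "integrable (M i) (\<lambda>z. (g y - g z)\<^sup>2)"
          by (rule M.integrable_real_bounded[of _ _ "(2 * b)\<^sup>2"], measurable)
            (rule abs_square_le[OF gd[OF y]])
        show "integrable (M i) (\<lambda>z. \<integral>x. (f (x(i := y)) - f (x(i := z)))\<^sup>2 \<partial>PiM J M)"
          by (rule M.integrable_real_bounded[OF m3' b3]) (rule y)+
        show "(g y - g z)\<^sup>2 \<le> (\<integral>x. (f (x(i := y)) - f (x(i := z)))\<^sup>2 \<partial>PiM J M)"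
          if "z \<in> space (M i)" for z
          by (rule le[OF y that])
      qed
    qed
    also have "\<dots> = (\<integral>y. (\<integral>x. (\<integral>z. (f (x(i := y)) - f (x(i := z)))\<^sup>2 \<partial>M i) \<partial>PiM J M) \<partial>M i)"
    proof (rule Bochner_Integration.integral_cong[OF refl])
      fix y assume y: "y \<in> space (M i)"
      have "(\<lambda>p. f ((fst p)(i := y))) \<in> borel_measurable (PiM J M \<Otimes>\<^sub>M M i)"
        by (rule measurable_compose[OF measurable_fst fy[OF y]])
      then have "integrable (PiM J M \<Otimes>\<^sub>M M i) (\<lambda>(x, z). (f (x(i := y)) - f (x(i := z)))\<^sup>2)"
        by (intro P.integrable_real_bounded[of _ "(2 * b)\<^sup>2"])
          (use square_le_bound[OF d[OF _ y]] in \<open>auto simp: case_prod_beta space_pair_measure\<close>)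
      then show "(\<integral>z. (\<integral>x. (f (x(i := y)) - f (x(i := z)))\<^sup>2 \<partial>PiM J M) \<partial>M i)
          = (\<integral>x. (\<integral>z. (f (x(i := y)) - f (x(i := z)))\<^sup>2 \<partial>M i) \<partial>PiM J M)"
        by (rule P.Fubini_integral)
    qed
    also have "\<dots> = (\<integral>w. resample_var f i w \<partial>PiM I M)"
      unfolding rv_int[OF iI] by (simp add: resample_var_def)
    finally show ?thesis .
  qed
  show ?case
    using part1 part2 insert.hyps f1 unfolding I_def by simp
qed

end

context prob_family
begin

text \<open>For \<open>H = (f - m)^2\<close>, Efron--Stein for \<open>f\<close> gives E H \<le> D,
  and for \<open>H\<close> it gives Var H \<le> D (8 E H + 2 D); adding the squared mean of
  \<open>H\<close> yields 11 = 8 + 2 + 1. The bounds \<open>d\<close> may depend on the point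
  \<open>w\<close> and only their sum is controlled, because for \<open>G\<close> only the Euclidean
  norm of the gradient is small.\<close>

lemma fourth_moment_bound:
  fixes f :: "('i \<Rightarrow> 'a) \<Rightarrow> real"
  assumes I: "finite I" and f[measurable]: "f \<in> borel_measurable (PiM I M)"
    and b: "\<And>w. w \<in> space (PiM I M) \<Longrightarrow> \<bar>f w\<bar> \<le> b"
    and d: "\<And>w. w \<in> space (PiM I M) \<Longrightarrow> \<exists>d. (\<forall>i\<in>I. 0 \<le> d i) \<and>
      (\<forall>i\<in>I. \<forall>z\<in>space (M i). (f w - f (w(i := z)))\<^sup>2 \<le> d i) \<and> (\<Sum>i\<in>I. d i) \<le> D"
  shows "(\<integral>w. (f w - (\<integral>w. f w \<partial>PiM I M)) ^ 4 \<partial>PiM I M) \<le> 11 * D\<^sup>2"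
proof -
  interpret N: prob_space "PiM I M" by (rule prob_space_PiM) (rule prob_space)
  define m where "m = (\<integral>w. f w \<partial>PiM I M)"
  obtain w0 where w0: "w0 \<in> space (PiM I M)" using N.not_empty by blast
  have D0: "D \<ge> 0"
    using d[OF w0] sum_nonneg order_trans by metis
  have mb: "\<bar>m\<bar> \<le> b" unfolding m_def by (rule N.abs_integral_le_bound[OF b])
  have fmb: "\<bar>f w - m\<bar> \<le> 2 * b" if "w \<in> space (PiM I M)" for w
    using b[OF that] mb by linarith
  define H where "H w = (f w - m)\<^sup>2" for w
  have Hm[measurable]: "H \<in> borel_measurable (PiM I M)" unfolding H_def by measurable
  have Hb: "\<bar>H w\<bar> \<le> (2 * b)\<^sup>2" if "w \<in> space (PiM I M)" for w
    unfolding H_def by (rule abs_square_le[OF fmb[OF that]])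
  have int_f: "integrable (PiM I M) f" by (rule N.integrable_real_bounded[OF f b])
  have int_f2: "integrable (PiM I M) (\<lambda>w. (f w)\<^sup>2)"
    by (rule N.integrable_real_bounded[OF _ abs_square_le[OF b]]) auto
  have int_H: "integrable (PiM I M) H" by (rule N.integrable_real_bounded[OF Hm Hb])
  have int_H2: "integrable (PiM I M) (\<lambda>w. (H w)\<^sup>2)"
    by (rule N.integrable_real_bounded[OF _ abs_square_le[OF Hb]]) auto
  have int_rv: "integrable (PiM I M) (resample_var g i)" if "i \<in> I" "g \<in> borel_measurable (PiM I M)"
    "\<And>w. w \<in> space (PiM I M) \<Longrightarrow> \<bar>g w\<bar> \<le> c" for g i c
    by (rule N.integrable_real_bounded[OF resample_var_measurable[OF that(1,2)] resample_var_bound[OF that(1,3)]])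
  have rv_f: "(\<Sum>i\<in>I. resample_var f i w) \<le> D" if w: "w \<in> space (PiM I M)" for w
  proof -
    obtain d where d: "\<forall>i\<in>I. 0 \<le> d i" "\<forall>i\<in>I. \<forall>z\<in>space (M i). (f w - f (w(i := z)))\<^sup>2 \<le> d i" "(\<Sum>i\<in>I. d i) \<le> D"
      using d[OF w] by blast
    have "resample_var f i w \<le> d i" if "i \<in> I" for i
      unfolding resample_var_def by (rule M.integral_le_bound) (use d that in auto)
    then have "(\<Sum>i\<in>I. resample_var f i w) \<le> (\<Sum>i\<in>I. d i)" by (rule sum_mono)
    with d(3) show ?thesis by simp
  qed
  have rv_H: "(\<Sum>i\<in>I. resample_var H i w) \<le> D * (8 * H w + 2 * D)" if w: "w \<in> space (PiM I M)" for w
  proof -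
    obtain d where d: "\<forall>i\<in>I. 0 \<le> d i" "\<forall>i\<in>I. \<forall>z\<in>space (M i). (f w - f (w(i := z)))\<^sup>2 \<le> d i" "(\<Sum>i\<in>I. d i) \<le> D"
      using d[OF w] by blast
    have "resample_var H i w \<le> d i * (8 * H w + 2 * D)" if i: "i \<in> I" for i
      unfolding resample_var_def
    proof (rule M.integral_le_bound)
      have "d i \<le> (\<Sum>i\<in>I. d i)" by (rule member_le_sum) (use i d I in auto)
      then have diD: "d i \<le> D" using d(3) by simp
      fix z assume z: "z \<in> space (M i)"
      \<comment> \<open>\<open>H\<close> changes by \<open>\<delta> * (2 * a - \<delta>)\<close>.
        One factor \<open>\<delta>\<^sup>2\<close> supplies the summable \<open>d i\<close>, a
        second one is merely bounded by \<open>D\<close>.\<close>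
      define a \<delta> where "a = f w - m" and "\<delta> = f w - f (w(i := z))"
      have \<delta>: "\<delta>\<^sup>2 \<le> d i" using d(2) i z by (simp add: \<delta>_def)
      have "(H w - H (w(i := z)))\<^sup>2 = \<delta>\<^sup>2 * (2 * a - \<delta>)\<^sup>2"
        unfolding H_def a_def \<delta>_def by (simp add: power2_eq_square algebra_simps)
      also have "\<dots> \<le> \<delta>\<^sup>2 * (8 * a\<^sup>2 + 2 * \<delta>\<^sup>2)"
      proof (rule mult_left_mono)
        have "0 \<le> (2 * a + \<delta>)\<^sup>2" by simp
        then show "(2 * a - \<delta>)\<^sup>2 \<le> 8 * a\<^sup>2 + 2 * \<delta>\<^sup>2"
          by (simp add: power2_eq_square algebra_simps)
      qed simp
      also have "\<dots> \<le> d i * (8 * a\<^sup>2 + 2 * D)"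
        using \<delta> diD d(1) i by (intro mult_mono add_mono) auto
      finally show "(H w - H (w(i := z)))\<^sup>2 \<le> d i * (8 * H w + 2 * D)"
        by (simp add: H_def a_def)
    qed (use d i D0 in \<open>auto simp: H_def\<close>)
    then have "(\<Sum>i\<in>I. resample_var H i w) \<le> (\<Sum>i\<in>I. d i * (8 * H w + 2 * D))"
      by (rule sum_mono)
    also have "\<dots> \<le> D * (8 * H w + 2 * D)"
      unfolding sum_distrib_right[symmetric] using d(3) D0 by (intro mult_right_mono) (auto simp: H_def)
    finally show ?thesis .
  qed
  have EH: "(\<integral>w. H w \<partial>PiM I M) \<le> D"
  proof -
    have "(\<integral>w. H w \<partial>PiM I M) = (\<integral>w. (f w)\<^sup>2 \<partial>PiM I M) - (\<integral>w. f w \<partial>PiM I M)\<^sup>2"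
      unfolding H_def m_def by (rule N.variance_eq[OF int_f int_f2])
    also have "\<dots> \<le> (\<Sum>i\<in>I. \<integral>w. resample_var f i w \<partial>PiM I M)"
      by (rule efron_stein[OF I f b])
    also have "\<dots> = (\<integral>w. (\<Sum>i\<in>I. resample_var f i w) \<partial>PiM I M)"
      by (rule Bochner_Integration.integral_sum[symmetric]) (rule int_rv[OF _ f b])
    also have "\<dots> \<le> D" by (rule N.integral_le_bound[OF rv_f D0])
    finally show ?thesis .
  qed
  have EH0: "0 \<le> (\<integral>w. H w \<partial>PiM I M)" by (simp add: H_def)
  have "(\<integral>w. (H w)\<^sup>2 \<partial>PiM I M) - (\<integral>w. H w \<partial>PiM I M)\<^sup>2 \<le> (\<Sum>i\<in>I. \<integral>w. resample_var H i w \<partial>PiM I M)"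
    by (rule efron_stein[OF I Hm Hb])
  also have "\<dots> = (\<integral>w. (\<Sum>i\<in>I. resample_var H i w) \<partial>PiM I M)"
    by (rule Bochner_Integration.integral_sum[symmetric]) (rule int_rv[OF _ Hm Hb])
  also have "\<dots> \<le> (\<integral>w. D * (8 * H w + 2 * D) \<partial>PiM I M)"
    by (intro integral_mono rv_H Bochner_Integration.integrable_sum int_rv[OF _ Hm Hb]
      integrable_mult_right Bochner_Integration.integrable_add int_H) auto
  also have "\<dots> = D * (8 * (\<integral>w. H w \<partial>PiM I M) + 2 * D)"
    using int_H by (simp add: N.prob_space)
  also have "\<dots> \<le> D * (8 * D + 2 * D)"
    using EH D0 by (intro mult_left_mono) auto
  finally have "(\<integral>w. (H w)\<^sup>2 \<partial>PiM I M) \<le> 10 * D\<^sup>2 + (\<integral>w. H w \<partial>PiM I M)\<^sup>2"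
    by (simp add: power2_eq_square algebra_simps)
  also have "(\<integral>w. H w \<partial>PiM I M)\<^sup>2 \<le> D\<^sup>2" using EH EH0 by (rule power_mono)
  finally show ?thesis by (simp add: H_def m_def flip: power_mult)
qed

end

text \<open>The sum of all \<open>f n\<close> has finite expectation, so it is finite almost surely
  and its terms tend to 0.\<close>

lemma (in prob_space) AE_tendsto_0_of_summable_integral:
  fixes f :: "nat \<Rightarrow> 'a \<Rightarrow> real"
  assumes f[measurable]: "\<And>n. f n \<in> borel_measurable M"
    and nonneg: "\<And>n x. x \<in> space M \<Longrightarrow> 0 \<le> f n x"
    and int: "\<And>n. integrable M (f n)"
    and sm: "summable (\<lambda>n. \<integral>x. f n x \<partial>M)"
  shows "AE x in M. (\<lambda>n. f n x) \<longlonglongrightarrow> 0"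
proof -
  have "(\<integral>\<^sup>+x. (\<Sum>n. ennreal (f n x)) \<partial>M) = (\<Sum>n. \<integral>\<^sup>+x. ennreal (f n x) \<partial>M)"
    by (rule nn_integral_suminf) simp
  also have "\<dots> = (\<Sum>n. ennreal (\<integral>x. f n x \<partial>M))"
    by (intro suminf_cong nn_integral_eq_integral int) (use nonneg in auto)
  also have "\<dots> = ennreal (\<Sum>n. \<integral>x. f n x \<partial>M)"
    by (rule suminf_ennreal_eq) (use nonneg sm in \<open>auto intro!: integral_nonneg_AE simp: summable_sums\<close>)
  finally have "(\<integral>\<^sup>+x. (\<Sum>n. ennreal (f n x)) \<partial>M) \<noteq> \<infinity>" by simp
  then have "AE x in M. (\<Sum>n. ennreal (f n x)) \<noteq> \<infinity>"
    by (intro nn_integral_PInf_AE) auto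
  then show ?thesis
  proof (rule AE_mp, intro AE_I2 impI)
    fix x assume x: "x \<in> space M" and fin: "(\<Sum>n. ennreal (f n x)) \<noteq> \<infinity>"
    then have "summable (\<lambda>n. f n x)"
      by (intro summable_suminf_not_top) (use nonneg in \<open>auto simp: infinity_ennreal_def\<close>)
    then show "(\<lambda>n. f n x) \<longlonglongrightarrow> 0" by (rule summable_LIMSEQ_zero)
  qed
qed

section \<open>Smooth statistics of Fourier coefficients\<close>

lemma mult_exp_neg_le_1: "v \<ge> 0 \<Longrightarrow> v * exp (- v) \<le> (1 :: real)"
proof -
  assume "v \<ge> 0"
  have "v \<le> exp v" using exp_ge_add_one_self[of v] by linarith
  then show ?thesis by (simp add: exp_minus field_simps)
qed

lemma square_mult_exp_neg_le_2: "v \<ge> 0 \<Longrightarrow> v\<^sup>2 * exp (- v) \<le> (2 :: real)"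
  using exp_lower_Taylor_quadratic[of v] by (simp add: exp_minus field_simps)

lemma abs_mult_gauss_le_1:
  assumes "s \<ge> (1 :: real)"
  shows "\<bar>t\<bar> * exp (- (s * t\<^sup>2)) \<le> 1"
proof -
  have "2 * \<bar>t\<bar> \<le> 1 + t\<^sup>2"
    using zero_le_power2[of "\<bar>t\<bar> - 1"] by (simp add: power2_eq_square algebra_simps abs_mult_self_eq)
  then have "\<bar>t\<bar> \<le> 1 + t\<^sup>2" by simp
  also have "\<dots> \<le> exp (t\<^sup>2)" by (rule exp_ge_add_one_self)
  also have "\<dots> \<le> exp (s * t\<^sup>2)" using assms mult_right_mono[of 1 s "t\<^sup>2"] by simp
  finally show ?thesis by (simp add: exp_minus field_simps)
qed

text \<open>The mean value inequality used twice, at the price of the factor 1/2 in the remainder.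
  The bound on \<open>F''\<close> is local, since \<open>laplace_has_derivative\<close> has only a
  local one.\<close>

lemma taylor_second_order:
  fixes F :: "real \<Rightarrow> real"
  assumes F: "\<And>t. (F has_real_derivative F' t) (at t)"
    and F': "\<And>t. (F' has_real_derivative F'' t) (at t)"
    and S: "\<And>t. \<bar>t\<bar> \<le> \<bar>y\<bar> \<Longrightarrow> \<bar>F'' t\<bar> \<le> S"
  shows "\<bar>F' y - F' 0\<bar> \<le> S * \<bar>y\<bar>" and "\<bar>F y - F 0 - y * F' 0\<bar> \<le> S * y\<^sup>2"
proof -
  define I where "I = {- \<bar>y\<bar>..\<bar>y\<bar>}"
  have lip: "\<bar>F' z - F' 0\<bar> \<le> S * \<bar>z\<bar>" if "z \<in> I" for z
  proof -
    have "norm (F' z - F' 0) \<le> S * norm (z - 0)"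
      by (rule field_differentiable_bound[of I F' F''])
        (use S that has_field_derivative_at_within[OF F'] in \<open>auto simp: I_def\<close>)
    then show ?thesis by simp
  qed
  show "\<bar>F' y - F' 0\<bar> \<le> S * \<bar>y\<bar>" by (rule lip) (auto simp: I_def)
  have S0: "S \<ge> 0" using S[of 0] by simp
  have "norm ((F y - y * F' 0) - (F 0 - 0 * F' 0)) \<le> S * \<bar>y\<bar> * norm (y - 0)"
  proof (rule field_differentiable_bound[of I "\<lambda>t. F t - t * F' 0" "\<lambda>t. F' t - F' 0"])
    fix z assume z: "z \<in> I"
    have "((\<lambda>t. F t - t * F' 0) has_field_derivative F' z - 1 * F' 0) (at z)"
      by (intro DERIV_diff F DERIV_cmult_right DERIV_ident)
    then show "((\<lambda>t. F t - t * F' 0) has_field_derivative F' z - F' 0) (at z within I)"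
      by (simp add: has_field_derivative_at_within)
    have "\<bar>F' z - F' 0\<bar> \<le> S * \<bar>z\<bar>" by (rule lip[OF z])
    also have "\<dots> \<le> S * \<bar>y\<bar>" using z S0 by (intro mult_left_mono) (auto simp: I_def)
    finally show "norm (F' z - F' 0) \<le> S * \<bar>y\<bar>" by simp
  qed (auto simp: I_def)
  then show "\<bar>F y - F 0 - y * F' 0\<bar> \<le> S * y\<^sup>2"
    by (simp add: power2_eq_square abs_mult_self_eq mult.assoc algebra_simps)
qed

lemma gauss_derivs:
  fixes r :: real
  shows "((\<lambda>t. exp (- (r * t\<^sup>2))) has_real_derivative (- 2 * r) * (t * exp (- (r * t\<^sup>2)))) (at t)"
    and "((\<lambda>t. t * exp (- (r * t\<^sup>2))) has_real_derivative (1 - 2 * r * t\<^sup>2) * exp (- (r * t\<^sup>2))) (at t)"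
    and "((\<lambda>t. (1 - 2 * r * t\<^sup>2) * exp (- (r * t\<^sup>2))) has_real_derivative
        (4 * r\<^sup>2 * t ^ 3 - 6 * r * t) * exp (- (r * t\<^sup>2))) (at t)"
  by (auto intro!: derivative_eq_intros simp: algebra_simps power2_eq_square power3_eq_cube)

text \<open>What counts is uniformity in \<open>t\<close> and monotonicity in \<open>r\<close>, so
  that one constant serves a whole interval of parameters. Splitting at |t| = 1 trades the optimal
  fractional powers of \<open>r\<close> for polynomials.\<close>

lemma gauss_deriv_bounds:
  fixes r :: real
  assumes "r \<ge> 0"
  shows "\<bar>(1 - 2 * r * t\<^sup>2) * exp (- (r * t\<^sup>2))\<bar> \<le> 3"
    and "\<bar>(4 * r\<^sup>2 * t ^ 3 - 6 * r * t) * exp (- (r * t\<^sup>2))\<bar> \<le> 4 * (r\<^sup>2 + 2) + 6 * (r + 1)"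
proof -
  define E where "E = exp (- (r * t\<^sup>2))"
  have E: "0 < E" "E \<le> 1" using assms by (auto simp: E_def)
  have v0: "0 \<le> r * t\<^sup>2" using assms by simp
  have v1: "r * t\<^sup>2 * E \<le> 1" unfolding E_def by (rule mult_exp_neg_le_1[OF v0])
  have v2: "(r * t\<^sup>2)\<^sup>2 * E \<le> 2" unfolding E_def by (rule square_mult_exp_neg_le_2[OF v0])
  have "\<bar>(1 - 2 * r * t\<^sup>2) * E\<bar> \<le> E + 2 * (r * t\<^sup>2 * E)"
    using E v0 mult_nonneg_nonneg[OF v0 less_imp_le[OF E(1)]] by (simp add: abs_le_iff algebra_simps)
  then show "\<bar>(1 - 2 * r * t\<^sup>2) * exp (- (r * t\<^sup>2))\<bar> \<le> 3"
    using v1 E unfolding E_def by linarith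
  have a: "r * \<bar>t\<bar> * E \<le> r + 1"
  proof (cases "\<bar>t\<bar> \<le> 1")
    case True
    have "r * \<bar>t\<bar> * E \<le> r * 1 * 1" using True E assms by (intro mult_mono) auto
    then show ?thesis by simp
  next
    case False
    then have "\<bar>t\<bar> \<le> t\<^sup>2" using mult_left_mono[of 1 "\<bar>t\<bar>" "\<bar>t\<bar>"] by (simp add: power2_eq_square abs_mult_self_eq)
    then have "r * \<bar>t\<bar> * E \<le> r * t\<^sup>2 * E" using E assms by (intro mult_mono) auto
    then show ?thesis using v1 assms by linarith
  qed
  have b: "r\<^sup>2 * \<bar>t\<bar> ^ 3 * E \<le> r\<^sup>2 + 2"
  proof (cases "\<bar>t\<bar> \<le> 1")
    case True
    have "\<bar>t\<bar> ^ 3 \<le> 1" using True by (intro power_le_one) auto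
    then have "r\<^sup>2 * \<bar>t\<bar> ^ 3 * E \<le> r\<^sup>2 * 1 * 1" using E by (intro mult_mono) auto
    then show ?thesis by simp
  next
    case False
    then have "\<bar>t\<bar> ^ 3 \<le> \<bar>t\<bar> ^ 4" by (intro power_increasing) auto
    then have "r\<^sup>2 * \<bar>t\<bar> ^ 3 * E \<le> r\<^sup>2 * \<bar>t\<bar> ^ 4 * E" using E by (intro mult_right_mono mult_left_mono) auto
    also have "\<dots> = (r * t\<^sup>2)\<^sup>2 * E" by (simp add: power_mult_distrib flip: power_mult)
    finally show ?thesis using v2 zero_le_power2[of r] by linarith
  qed
  have "\<bar>(4 * r\<^sup>2 * t ^ 3 - 6 * r * t) * E\<bar> \<le> \<bar>4 * r\<^sup>2 * t ^ 3 * E\<bar> + \<bar>6 * r * t * E\<bar>"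
    using abs_triangle_ineq4[of "4 * r\<^sup>2 * t ^ 3 * E" "6 * r * t * E"] by (simp add: left_diff_distrib)
  also have "\<dots> = 4 * (r\<^sup>2 * \<bar>t\<bar> ^ 3 * E) + 6 * (r * \<bar>t\<bar> * E)"
    using E assms by (simp add: abs_mult power_abs)
  also have "\<dots> \<le> 4 * (r\<^sup>2 + 2) + 6 * (r + 1)" using a b by (intro add_mono mult_left_mono) auto
  finally show "\<bar>(4 * r\<^sup>2 * t ^ 3 - 6 * r * t) * exp (- (r * t\<^sup>2))\<bar> \<le> 4 * (r\<^sup>2 + 2) + 6 * (r + 1)"
    unfolding E_def .
qed

lemma gauss_lipschitz:
  fixes s :: real
  assumes "s \<ge> 1"
  shows "\<bar>exp (- (s * a\<^sup>2)) - exp (- (s * b\<^sup>2))\<bar> \<le> 2 * s * \<bar>a - b\<bar>"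
proof -
  have "norm (exp (- (s * a\<^sup>2)) - exp (- (s * b\<^sup>2))) \<le> 2 * s * norm (a - b)"
  proof (rule field_differentiable_bound[of UNIV "\<lambda>t. exp (- (s * t\<^sup>2))" "\<lambda>t. (- 2 * s) * (t * exp (- (s * t\<^sup>2)))"])
    fix t :: real
    have "2 * s * (\<bar>t\<bar> * exp (- (s * t\<^sup>2))) \<le> 2 * s * 1"
      using assms by (intro mult_left_mono abs_mult_gauss_le_1) auto
    then show "norm ((- 2 * s) * (t * exp (- (s * t\<^sup>2)))) \<le> 2 * s"
      using assms by (simp add: abs_mult)
  qed (use gauss_derivs(1)[of s] in \<open>auto intro: has_field_derivative_at_within\<close>)
  then show ?thesis by simp
qed

text \<open>Rotation by \<open>cnj c\<close> makes the perturbation real. A change of one input then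
  moves only one real variable, and the Gaussian in |z| factors into two one-dimensional
  ones.\<close>

lemma cmod_add_unit_square:
  assumes "cmod c = 1"
  shows "(cmod (z + c * of_real t))\<^sup>2 = (Re (cnj c * z) + t)\<^sup>2 + (Im (cnj c * z))\<^sup>2"
proof -
  have "cnj c * c = 1" using assms complex_norm_square[of c] by (simp add: mult.commute)
  then have "cnj c * (z + c * of_real t) = cnj c * z + of_real t"
    by (simp add: distrib_left flip: mult.assoc)
  moreover have "cmod (cnj c * (z + c * of_real t)) = cmod (z + c * of_real t)"
    using assms by (simp add: norm_mult)
  ultimately have "cmod (z + c * of_real t) = cmod (cnj c * z + of_real t)" by simp
  then show ?thesis by (simp add: cmod_power2)
qed

text \<open>Formulated for an arbitrary matrix because it is applied to \<open>\<theta>\<close> and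
  to its conjugate transpose.\<close>

lemma parseval_matrix:
  fixes a :: "nat \<Rightarrow> nat \<Rightarrow> complex"
  assumes "\<And>j j'. j < n \<Longrightarrow> j' < n \<Longrightarrow> (\<Sum>k<n. a k j * cnj (a k j')) = (if j = j' then of_nat n else 0)"
  shows "(\<Sum>k<n. (cmod (\<Sum>j<n. a k j * z j))\<^sup>2) = real n * (\<Sum>j<n. (cmod (z j))\<^sup>2)"
proof -
  have "(\<Sum>k<n. complex_of_real ((cmod (\<Sum>j<n. a k j * z j))\<^sup>2))
      = (\<Sum>k<n. \<Sum>j<n. \<Sum>j'<n. z j * cnj (z j') * (a k j * cnj (a k j')))"
    unfolding complex_norm_square cnj_sum sum_product
    by (intro sum.cong refl) (simp add: mult_ac)
  also have "\<dots> = (\<Sum>j<n. \<Sum>k<n. \<Sum>j'<n. z j * cnj (z j') * (a k j * cnj (a k j')))"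
    by (rule sum.swap)
  also have "\<dots> = (\<Sum>j<n. \<Sum>j'<n. z j * cnj (z j') * (\<Sum>k<n. a k j * cnj (a k j')))"
    unfolding sum_distrib_left by (intro sum.cong refl sum.swap)
  also have "\<dots> = (\<Sum>j<n. \<Sum>j'<n. if j' = j then z j * cnj (z j) * of_nat n else 0)"
    by (intro sum.cong refl) (simp add: assms)
  also have "\<dots> = complex_of_real (real n * (\<Sum>j<n. (cmod (z j))\<^sup>2))"
    by (simp add: sum_distrib_left mult_ac) (simp flip: complex_norm_square)
  finally show ?thesis by (simp only: of_real_sum[symmetric] of_real_eq_iff)
qed

text \<open>The properties of the Fourier matrix that the probabilistic part uses, so that the
  circulant and the skew circulant case are treated at once. A vanishing sum of squares in row
  \<open>k\<close> means that the real and imaginary parts of the row are orthogonal and equally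
  long.\<close>

locale fourier_system =
  fixes n :: nat and \<theta> :: "nat \<Rightarrow> nat \<Rightarrow> complex"
  assumes n_pos: "n > 0"
    and unit: "\<And>k j. k < n \<Longrightarrow> j < n \<Longrightarrow> cmod (\<theta> k j) = 1"
    and col: "\<And>j j'. j < n \<Longrightarrow> j' < n \<Longrightarrow> (\<Sum>k<n. \<theta> k j * cnj (\<theta> k j')) = (if j = j' then of_nat n else 0)"
    and row: "\<And>k k'. k < n \<Longrightarrow> k' < n \<Longrightarrow> (\<Sum>j<n. \<theta> k j * cnj (\<theta> k' j)) = (if k = k' then of_nat n else 0)"
    and few_self: "card {k. k < n \<and> (\<Sum>j<n. (\<theta> k j)\<^sup>2) \<noteq> 0} \<le> 2"
begin

definition lam :: "(nat \<Rightarrow> real) \<Rightarrow> nat \<Rightarrow> complex" where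
  "lam x k = (\<Sum>j<n. \<theta> k j * of_real (x j)) / of_real (sqrt (real n))"

definition G :: "real \<Rightarrow> (nat \<Rightarrow> real) \<Rightarrow> real" where
  "G s x = (\<Sum>k<n. exp (- (s * (cmod (lam x k))\<^sup>2))) / real n"

lemma parseval_lam: "(\<Sum>k<n. (cmod (lam x k))\<^sup>2) = (\<Sum>j<n. (x j)\<^sup>2)"
proof -
  have "(\<Sum>k<n. (cmod (lam x k))\<^sup>2) = (\<Sum>k<n. (cmod (\<Sum>j<n. \<theta> k j * of_real (x j)))\<^sup>2) / real n"
    unfolding sum_divide_distrib using n_pos
    by (intro sum.cong refl) (simp add: lam_def norm_divide power_divide del: sum_divide_distrib)
  also have "(\<Sum>k<n. (cmod (\<Sum>j<n. \<theta> k j * of_real (x j)))\<^sup>2) = real n * (\<Sum>j<n. (x j)\<^sup>2)"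
    by (subst parseval_matrix[OF col]) auto
  finally show ?thesis using n_pos by simp
qed

lemma lam_diff: "lam x k - lam y k = lam (\<lambda>j. x j - y j) k"
  by (simp add: lam_def diff_divide_distrib[symmetric] sum_subtractf[symmetric] algebra_simps)

lemma G_bounds: "s \<ge> 0 \<Longrightarrow> 0 \<le> G s x" "s \<ge> 0 \<Longrightarrow> G s x \<le> 1"
proof -
  show "0 \<le> G s x" by (simp add: G_def sum_nonneg)
  assume "s \<ge> 0"
  then have "(\<Sum>k<n. exp (- (s * (cmod (lam x k))\<^sup>2))) \<le> (\<Sum>k<n. 1)" by (intro sum_mono) simp
  then show "G s x \<le> 1" using n_pos by (simp add: G_def field_simps)
qed

lemma sum_le_sqrt:
  fixes f :: "nat \<Rightarrow> real"
  shows "(\<Sum>k<n. \<bar>f k\<bar>) \<le> sqrt (real n) * sqrt (\<Sum>k<n. (f k)\<^sup>2)"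
proof -
  have "(\<Sum>k<n. \<bar>f k\<bar>)\<^sup>2 \<le> real n * (\<Sum>k<n. (f k)\<^sup>2)"
    using Cauchy_Schwarz_ineq_sum[of "\<lambda>_. 1" "\<lambda>k. \<bar>f k\<bar>" "{..<n}"] by simp
  then have "(\<Sum>k<n. \<bar>f k\<bar>) \<le> sqrt (real n * (\<Sum>k<n. (f k)\<^sup>2))"
    by (rule real_le_rsqrt)
  then show ?thesis by (simp add: real_sqrt_mult)
qed

text \<open>The moduli change by at most the transform of \<open>x - y\<close>; Cauchy--Schwarz and
  Parseval convert the average of these into the normalised Euclidean distance. Both truncation and
  the change of a single input rely on this.\<close>

lemma G_lipschitz:
  assumes "s \<ge> 1"
  shows "\<bar>G s x - G s y\<bar> \<le> 2 * s * sqrt ((\<Sum>j<n. (x j - y j)\<^sup>2) / real n)"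
proof -
  have "\<bar>G s x - G s y\<bar> = \<bar>\<Sum>k<n. exp (- (s * (cmod (lam x k))\<^sup>2)) - exp (- (s * (cmod (lam y k))\<^sup>2))\<bar> / real n"
    using n_pos by (simp add: G_def sum_subtractf diff_divide_distrib[symmetric])
  also have "\<dots> \<le> (\<Sum>k<n. 2 * s * \<bar>cmod (lam (\<lambda>j. x j - y j) k)\<bar>) / real n"
  proof (intro divide_right_mono order_trans[OF sum_abs] sum_mono)
    fix k
    have "\<bar>exp (- (s * (cmod (lam x k))\<^sup>2)) - exp (- (s * (cmod (lam y k))\<^sup>2))\<bar>
        \<le> 2 * s * \<bar>cmod (lam x k) - cmod (lam y k)\<bar>" by (rule gauss_lipschitz[OF assms])
    also have "\<dots> \<le> 2 * s * cmod (lam x k - lam y k)"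
      using assms by (intro mult_left_mono norm_triangle_ineq3) auto
    finally show "\<bar>exp (- (s * (cmod (lam x k))\<^sup>2)) - exp (- (s * (cmod (lam y k))\<^sup>2))\<bar>
        \<le> 2 * s * \<bar>cmod (lam (\<lambda>j. x j - y j) k)\<bar>" by (simp add: lam_diff)
  qed simp
  also have "\<dots> = 2 * s * (\<Sum>k<n. \<bar>cmod (lam (\<lambda>j. x j - y j) k)\<bar>) / real n"
    by (simp add: sum_distrib_left)
  also have "\<dots> \<le> 2 * s * (sqrt (real n) * sqrt (\<Sum>k<n. (cmod (lam (\<lambda>j. x j - y j) k))\<^sup>2)) / real n"
    using assms by (intro divide_right_mono mult_left_mono sum_le_sqrt) auto
  also have "\<dots> = 2 * s * (sqrt (real n) / real n) * sqrt (\<Sum>k<n. (cmod (lam (\<lambda>j. x j - y j) k))\<^sup>2)"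
    by simp
  also have "\<dots> = 2 * s * sqrt ((\<Sum>j<n. (x j - y j)\<^sup>2) / real n)"
    unfolding sqrt_divide_self_eq[OF of_nat_0_le_iff]
    by (simp add: parseval_lam real_sqrt_divide inverse_eq_divide)
  finally show ?thesis .
qed

lemma lam_upd:
  assumes "j < n"
  shows "lam (x(j := z)) k = lam x k + \<theta> k j * of_real ((z - x j) / sqrt (real n))"
proof -
  have "(\<Sum>i<n. \<theta> k i * of_real ((x(j := z)) i))
      = (\<Sum>i<n. \<theta> k i * of_real (x i) + (if i = j then \<theta> k j * of_real (z - x j) else 0))"
    by (intro sum.cong refl) (auto simp: algebra_simps)
  also have "\<dots> = (\<Sum>i<n. \<theta> k i * of_real (x i)) + \<theta> k j * of_real (z - x j)"
    using assms by (simp add: sum.distrib)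
  finally show ?thesis by (simp add: lam_def add_divide_distrib)
qed

definition G_grad :: "real \<Rightarrow> (nat \<Rightarrow> real) \<Rightarrow> nat \<Rightarrow> real" where
  "G_grad s x j = - (2 * s / (real n * sqrt (real n))) *
     Re (\<Sum>k<n. cnj (\<theta> k j) * (lam x k * of_real (exp (- (s * (cmod (lam x k))\<^sup>2)))))"

text \<open>After rotation by \<open>cnj (\<theta> k j)\<close> a change of \<open>x j\<close> moves
  only the real part \<open>a\<close>, at speed \<open>q\<close>; the imaginary part contributes a
  constant factor \<open>C \<le> 1\<close>. The second derivative is thus at most
  \<open>2 * s * 3 * q\<^sup>2\<close>, with \<open>q\<^sup>2 = 1 / n\<close>.\<close>

lemma exp_upd_taylor:
  assumes s: "s \<ge> 0" and k: "k < n" and j: "j < n"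
  defines "e \<equiv> \<lambda>x. exp (- (s * (cmod (lam x k))\<^sup>2))"
  shows "\<bar>e (x(j := z)) - e x - (z - x j) * (- (2 * s / sqrt (real n)) * Re (cnj (\<theta> k j) * lam x k) * e x)\<bar>
    \<le> 6 * s / real n * (z - x j)\<^sup>2"
proof -
  define q where "q = 1 / sqrt (real n)"
  have q2: "q\<^sup>2 = 1 / real n" using n_pos by (simp add: q_def power_divide)
  define a b where "a = Re (cnj (\<theta> k j) * lam x k)" and "b = Im (cnj (\<theta> k j) * lam x k)"
  define g where "g t = exp (- (s * t\<^sup>2))" for t
  define C where "C = exp (- (s * b\<^sup>2))"
  have C: "0 < C" "C \<le> 1" using s by (auto simp: C_def)
  have e_upd: "exp (- (s * (cmod (lam x k + \<theta> k j * of_real (t * q)))\<^sup>2)) = C * g (a + t * q)" for t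
    unfolding cmod_add_unit_square[OF unit[OF k j]] a_def[symmetric] b_def[symmetric] C_def g_def
    by (simp add: distrib_left flip: exp_add)
  define F where "F t = C * g (a + t * q)" for t
  define F' where "F' t = C * ((- 2 * s) * ((a + t * q) * g (a + t * q)) * q)" for t
  define F'' where "F'' t = C * ((- 2 * s) * ((1 - 2 * s * (a + t * q)\<^sup>2) * g (a + t * q) * q) * q)" for t
  have inner: "((\<lambda>t. a + t * q) has_real_derivative q) (at t)" for t
    by (auto intro!: derivative_eq_intros)
  have F_deriv: "(F has_real_derivative F' t) (at t)" for t
    unfolding F_def F'_def g_def
    by (intro DERIV_cmult DERIV_chain2[OF gauss_derivs(1) inner])
  have F'_deriv: "(F' has_real_derivative F'' t) (at t)" for t
    unfolding F'_def F''_def g_def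
    by (intro DERIV_cmult DERIV_cmult_right DERIV_chain2[OF gauss_derivs(2) inner])
  have bound: "\<bar>F'' t\<bar> \<le> 6 * s / real n" for t
  proof -
    have "\<bar>F'' t\<bar> = C * (2 * s * \<bar>(1 - 2 * s * (a + t * q)\<^sup>2) * g (a + t * q)\<bar> * q\<^sup>2)"
      using C s by (simp add: F''_def abs_mult power2_eq_square abs_mult_self_eq)
    also have "\<dots> \<le> 1 * (2 * s * 3 * q\<^sup>2)"
      using C s unfolding g_def
      by (intro mult_mono mult_right_mono mult_left_mono gauss_deriv_bounds(1)) auto
    finally show ?thesis by (simp add: q2)
  qed
  have "\<bar>F (z - x j) - F 0 - (z - x j) * F' 0\<bar> \<le> 6 * s / real n * (z - x j)\<^sup>2"
    by (rule taylor_second_order(2)[OF F_deriv F'_deriv bound])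
  moreover have "F (z - x j) = e (x(j := z))"
    unfolding F_def e_upd[symmetric] e_def lam_upd[OF j] by (simp add: q_def)
  moreover have e0: "F 0 = e x"
    using e_upd[of 0] by (simp add: F_def e_def)
  moreover have "F' 0 = - (2 * s / sqrt (real n)) * a * e x"
    unfolding e0[symmetric] by (simp add: F_def F'_def q_def)
  ultimately show ?thesis by (simp add: a_def)
qed

lemma G_upd_taylor:
  assumes s: "s \<ge> 0" and j: "j < n"
  shows "\<bar>G s (x(j := z)) - G s x - (z - x j) * G_grad s x j\<bar> \<le> 6 * s / real n * (z - x j)\<^sup>2"
proof -
  define e where "e k x = exp (- (s * (cmod (lam x k))\<^sup>2))" for k x
  define p where "p k = - (2 * s / sqrt (real n)) * Re (cnj (\<theta> k j) * lam x k) * e k x" for k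
  define r where "r k = e k (x(j := z)) - e k x - (z - x j) * p k" for k
  have "(\<Sum>k<n. \<bar>r k\<bar>) \<le> (\<Sum>k<n. 6 * s / real n * (z - x j)\<^sup>2)"
    unfolding r_def p_def e_def by (intro sum_mono exp_upd_taylor s j) auto
  then have "\<bar>\<Sum>k<n. r k\<bar> \<le> (\<Sum>k<n. 6 * s / real n * (z - x j)\<^sup>2)"
    using sum_abs[of r "{..<n}"] by linarith
  then have "\<bar>\<Sum>k<n. r k\<bar> / real n \<le> 6 * s / real n * (z - x j)\<^sup>2"
    using n_pos by (simp add: field_simps)
  moreover have "G s (x(j := z)) - G s x - (z - x j) * G_grad s x j = (\<Sum>k<n. r k) / real n"
  proof -
    have "G_grad s x j = (\<Sum>k<n. p k) / real n"
    proof -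
      have re: "Re (a * (b * of_real c)) = Re (a * b) * c" for a b c
        by (simp add: algebra_simps)
      have arr: "- (c / (a * b)) * (d * u) = - (c / b) * d * u / a" for a b c d u :: real
        by (simp add: divide_simps)
      show ?thesis
        unfolding G_grad_def p_def Re_sum re e_def[symmetric] sum_distrib_left sum_divide_distrib
        by (intro sum.cong refl arr)
    qed
    then show ?thesis
      by (simp only: G_def e_def[symmetric] r_def sum_subtractf sum_distrib_left[symmetric]
          diff_divide_distrib times_divide_eq_right)
  qed
  ultimately show ?thesis by simp
qed

text \<open>Up to a factor the gradient is the real part of an inverse transform of the values
  lambda_k exp(-s |lambda_k|^2), which are bounded by 1. Bounding each component separately would
  only give O(1) for the sum; Parseval gains the factor 1/n.\<close>

lemma G_grad_square_sum:
  assumes s: "s \<ge> 1"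
  shows "(\<Sum>j<n. (G_grad s x j)\<^sup>2) \<le> 4 * s\<^sup>2 / real n"
proof -
  define g where "g k = lam x k * of_real (exp (- (s * (cmod (lam x k))\<^sup>2)))" for k
  have g1: "cmod (g k) \<le> 1" for k
    using abs_mult_gauss_le_1[OF s, of "cmod (lam x k)"] by (simp add: g_def norm_mult)
  define K where "K = (2 * s / (real n * sqrt (real n)))\<^sup>2"
  have K: "K = 4 * s\<^sup>2 / real n ^ 3"
    using n_pos by (simp add: K_def power_divide power_mult_distrib power3_eq_cube power2_eq_square)
  have "(\<Sum>j<n. (G_grad s x j)\<^sup>2) \<le> (\<Sum>j<n. K * (cmod (\<Sum>k<n. cnj (\<theta> k j) * g k))\<^sup>2)"
  proof (rule sum_mono)
    fix j
    have "(Re (\<Sum>k<n. cnj (\<theta> k j) * g k))\<^sup>2 \<le> (cmod (\<Sum>k<n. cnj (\<theta> k j) * g k))\<^sup>2"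
      using abs_Re_le_cmod by (metis abs_le_square_iff abs_norm_cancel)
    then show "(G_grad s x j)\<^sup>2 \<le> K * (cmod (\<Sum>k<n. cnj (\<theta> k j) * g k))\<^sup>2"
      unfolding G_grad_def K_def g_def[symmetric] power_mult_distrib power2_minus
      by (rule mult_left_mono) simp
  qed
  also have "\<dots> = K * (\<Sum>j<n. (cmod (\<Sum>k<n. cnj (\<theta> k j) * g k))\<^sup>2)"
    by (simp add: sum_distrib_left)
  also have "(\<Sum>j<n. (cmod (\<Sum>k<n. cnj (\<theta> k j) * g k))\<^sup>2) = real n * (\<Sum>k<n. (cmod (g k))\<^sup>2)"
  proof (rule parseval_matrix)
    fix k k' assume "k < n" "k' < n"
    then show "(\<Sum>j<n. cnj (\<theta> k j) * cnj (cnj (\<theta> k' j))) = (if k = k' then of_nat n else 0)"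
      using row[of k' k] by (simp add: mult.commute)
  qed
  also have "\<dots> \<le> real n * (\<Sum>k<n. 1)"
    using g1 by (intro mult_left_mono sum_mono power_le_one) auto
  finally have "(\<Sum>j<n. (G_grad s x j)\<^sup>2) \<le> K * (real n * (\<Sum>k<n. 1))"
    by (simp add: K_def mult_left_mono)
  then show ?thesis using n_pos by (simp add: K power3_eq_cube)
qed

text \<open>The increment of the input is at most \<open>2 * B\<close>. In
  \<open>(p + R)^2 \<le> 2 * p^2 + 2 * R^2\<close> this gives 8 = 2 * 4 for the linear part and 1152
  = 2 * (6 * 4)^2 for the Taylor remainder.\<close>

lemma G_upd_square_bound:
  assumes s: "s \<ge> 1" and j: "j < n" and "\<bar>x j\<bar> \<le> B" "\<bar>z\<bar> \<le> B"
  shows "(G s x - G s (x(j := z)))\<^sup>2 \<le> 8 * B\<^sup>2 * (G_grad s x j)\<^sup>2 + 1152 * s\<^sup>2 * B ^ 4 / (real n)\<^sup>2"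
proof -
  define \<tau> where "\<tau> = z - x j"
  define R where "R = G s (x(j := z)) - G s x - \<tau> * G_grad s x j"
  have \<tau>: "\<bar>\<tau>\<bar> \<le> 2 * B" using assms by (auto simp: \<tau>_def)
  have \<tau>2: "\<tau>\<^sup>2 \<le> 4 * B\<^sup>2"
    using square_le_bound[OF \<tau>] by (simp add: power_mult_distrib)
  have "\<bar>R\<bar> \<le> 6 * s / real n * \<tau>\<^sup>2"
    unfolding R_def \<tau>_def using s j by (intro G_upd_taylor) auto
  also have "\<dots> \<le> 6 * s / real n * (4 * B\<^sup>2)" using \<tau>2 s by (intro mult_left_mono) auto
  finally have "R\<^sup>2 \<le> (6 * s / real n * (4 * B\<^sup>2))\<^sup>2" by (rule square_le_bound)
  also have "\<dots> = 576 * s\<^sup>2 * B ^ 4 / (real n)\<^sup>2"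
    by (simp add: power_mult_distrib power_divide flip: power_mult)
  finally have R2: "R\<^sup>2 \<le> 576 * s\<^sup>2 * B ^ 4 / (real n)\<^sup>2" .
  have "(G s x - G s (x(j := z)))\<^sup>2 = (\<tau> * G_grad s x j + R)\<^sup>2"
    by (simp add: R_def power2_commute)
  also have "\<dots> \<le> 2 * (\<tau> * G_grad s x j)\<^sup>2 + 2 * R\<^sup>2"
    using zero_le_power2[of "\<tau> * G_grad s x j - R"] by (simp add: power2_sum power2_diff)
  also have "\<dots> \<le> 2 * (4 * B\<^sup>2 * (G_grad s x j)\<^sup>2) + 2 * (576 * s\<^sup>2 * B ^ 4 / (real n)\<^sup>2)"
    unfolding power_mult_distrib[of \<tau>] using \<tau>2 R2 by (intro add_mono mult_left_mono mult_right_mono) auto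
  finally show ?thesis by simp
qed

end

section \<open>Bounded inputs\<close>

text \<open>The Gaussian identity E X F(X) = E F'(X) involves, to second order at 0, only the first
  two moments of X, which are those of a standard normal variable. What remains is of third order
  and is controlled by \<open>F''\<close>.\<close>

lemma (in prob_space) stein_approx:
  fixes X :: "'a \<Rightarrow> real" and F :: "real \<Rightarrow> real"
  assumes X[measurable]: "X \<in> borel_measurable M"
    and B: "\<And>\<omega>. \<omega> \<in> space M \<Longrightarrow> \<bar>X \<omega>\<bar> \<le> B"
    and mean: "(\<integral>\<omega>. X \<omega> \<partial>M) = 0" and var: "(\<integral>\<omega>. (X \<omega>)\<^sup>2 \<partial>M) = 1"
    and F: "\<And>t. (F has_real_derivative F' t) (at t)"
    and F': "\<And>t. (F' has_real_derivative F'' t) (at t)"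
    and S: "\<And>t. \<bar>F'' t\<bar> \<le> S"
  shows "\<bar>\<integral>\<omega>. X \<omega> * F (X \<omega>) - F' (X \<omega>) \<partial>M\<bar> \<le> S * (B ^ 3 + B)"
proof -
  have [measurable]: "F \<in> borel_measurable borel" "F' \<in> borel_measurable borel"
    using F F' by (auto intro!: borel_measurable_continuous_onI DERIV_isCont
      simp: continuous_on_eq_continuous_at)
  have S0: "S \<ge> 0" using S[of 0] by linarith
  \<comment> \<open>The subtracted terms \<open>y * F 0\<close> and
    \<open>(y\<^sup>2 - 1) * F' 0\<close> have mean zero; the rest consists of Taylor
    remainders.\<close>
  define h where "h y = y * F y - F' y - y * F 0 - (y\<^sup>2 - 1) * F' 0" for y
  have hm: "(\<lambda>\<omega>. h (X \<omega>)) \<in> borel_measurable M" unfolding h_def by measurable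
  have hb: "\<bar>h (X \<omega>)\<bar> \<le> S * (B ^ 3 + B)" if "\<omega> \<in> space M" for \<omega>
  proof -
    define y where "y = X \<omega>"
    have y: "\<bar>y\<bar> \<le> B" using B[OF that] by (simp add: y_def)
    have "h y = y * (F y - F 0 - y * F' 0) - (F' y - F' 0)"
      by (simp add: h_def power2_eq_square algebra_simps)
    then have "\<bar>h y\<bar> \<le> \<bar>y\<bar> * \<bar>F y - F 0 - y * F' 0\<bar> + \<bar>F' y - F' 0\<bar>"
      using abs_triangle_ineq4 by (simp flip: abs_mult)
    also have "\<dots> \<le> \<bar>y\<bar> * (S * y\<^sup>2) + S * \<bar>y\<bar>"
      by (intro add_mono mult_left_mono taylor_second_order[OF F F' S]) auto
    also have "\<dots> = S * (\<bar>y\<bar> ^ 3 + \<bar>y\<bar>)"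
      by (simp add: power3_eq_cube power2_eq_square algebra_simps abs_mult_self_eq)
    also have "\<dots> \<le> S * (B ^ 3 + B)"
      using y S0 by (intro mult_left_mono add_mono power_mono) auto
    finally show ?thesis by (simp add: y_def)
  qed
  have ih: "integrable M (\<lambda>\<omega>. h (X \<omega>))" by (rule integrable_real_bounded[OF hm hb])
  have iX: "integrable M X" by (rule integrable_real_bounded[OF X B])
  have iX2: "integrable M (\<lambda>\<omega>. (X \<omega>)\<^sup>2)"
    by (rule integrable_real_bounded[OF _ abs_square_le[OF B]]) auto
  have "(\<integral>\<omega>. X \<omega> * F (X \<omega>) - F' (X \<omega>) \<partial>M)
      = (\<integral>\<omega>. h (X \<omega>) + (X \<omega> * F 0 + ((X \<omega>)\<^sup>2 - 1) * F' 0) \<partial>M)"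
    by (simp add: h_def)
  also have "\<dots> = (\<integral>\<omega>. h (X \<omega>) \<partial>M) + ((\<integral>\<omega>. X \<omega> \<partial>M) * F 0 + ((\<integral>\<omega>. (X \<omega>)\<^sup>2 \<partial>M) - 1) * F' 0)"
    using ih iX iX2 by (simp add: prob_space)
  finally have "(\<integral>\<omega>. X \<omega> * F (X \<omega>) - F' (X \<omega>) \<partial>M) = (\<integral>\<omega>. h (X \<omega>) \<partial>M)"
    by (simp add: mean var)
  then show ?thesis using abs_integral_le_bound[OF hb] by simp
qed

text \<open>For bounded \<open>q\<close> the quadratic Taylor remainder of the integrand is uniform
  in the outcome. As \<open>r\<close> may be 0 or negative and is perturbed to both sides, the
  exponentials are bounded by \<open>E\<close> and not by 1.\<close>

lemma (in prob_space) laplace_has_derivative: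
  fixes q :: "'a \<Rightarrow> real"
  assumes q[measurable]: "q \<in> borel_measurable M"
    and Q: "\<And>\<omega>. \<omega> \<in> space M \<Longrightarrow> 0 \<le> q \<omega>" "\<And>\<omega>. \<omega> \<in> space M \<Longrightarrow> q \<omega> \<le> Q"
  shows "((\<lambda>r. \<integral>\<omega>. exp (- (r * q \<omega>)) \<partial>M) has_real_derivative (\<integral>\<omega>. - q \<omega> * exp (- (r * q \<omega>)) \<partial>M)) (at r)"
proof -
  define E where "E = exp ((\<bar>r\<bar> + 1) * Q)"
  define K where "K = Q\<^sup>2 * E"
  have Q0: "Q \<ge> 0" using Q not_empty by force
  have exp_le: "exp (- (t * q \<omega>)) \<le> E" if "\<omega> \<in> space M" "\<bar>t\<bar> \<le> \<bar>r\<bar> + 1" for \<omega> t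
  proof -
    have "- (t * q \<omega>) \<le> \<bar>t\<bar> * q \<omega>" using Q(1)[OF that(1)] by (simp add: abs_if)
    also have "\<dots> \<le> (\<bar>r\<bar> + 1) * Q" using Q[OF that(1)] that(2) by (intro mult_mono) auto
    finally show ?thesis by (simp add: E_def)
  qed
  have int: "integrable M (\<lambda>\<omega>. exp (- (t * q \<omega>)))" if "\<bar>t\<bar> \<le> \<bar>r\<bar> + 1" for t
    by (rule integrable_real_bounded[of _ E]) (use exp_le[OF _ that] in auto)
  have intq: "integrable M (\<lambda>\<omega>. - q \<omega> * exp (- (r * q \<omega>)))"
  proof (rule integrable_real_bounded[of _ "Q * E"])
    fix \<omega> assume \<omega>: "\<omega> \<in> space M"
    show "\<bar>- q \<omega> * exp (- (r * q \<omega>))\<bar> \<le> Q * E"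
      using Q[OF \<omega>] exp_le[OF \<omega>, of r] Q0 by (auto simp: abs_mult intro!: mult_mono)
  qed measurable
  have bound: "\<bar>(\<integral>\<omega>. exp (- ((r + h) * q \<omega>)) \<partial>M) - (\<integral>\<omega>. exp (- (r * q \<omega>)) \<partial>M)
      - h * (\<integral>\<omega>. - q \<omega> * exp (- (r * q \<omega>)) \<partial>M)\<bar> \<le> K * h\<^sup>2" if h: "\<bar>h\<bar> \<le> 1" for h
  proof -
    have "(\<integral>\<omega>. exp (- ((r + h) * q \<omega>)) \<partial>M) - (\<integral>\<omega>. exp (- (r * q \<omega>)) \<partial>M)
      - h * (\<integral>\<omega>. - q \<omega> * exp (- (r * q \<omega>)) \<partial>M)
      = (\<integral>\<omega>. exp (- ((r + h) * q \<omega>)) - exp (- (r * q \<omega>)) - h * (- q \<omega> * exp (- (r * q \<omega>))) \<partial>M)"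
    proof -
      have "\<bar>r + h\<bar> \<le> \<bar>r\<bar> + 1" using h by linarith
      then show ?thesis using int[of "r + h"] int[of r] intq by simp
    qed
    also have "\<bar>\<dots>\<bar> \<le> K * h\<^sup>2"
    proof (rule abs_integral_le_bound)
      fix \<omega> assume \<omega>: "\<omega> \<in> space M"
      have d1: "((\<lambda>t. exp (- ((r + t) * q \<omega>))) has_real_derivative - q \<omega> * exp (- ((r + t) * q \<omega>))) (at t)" for t
        by (auto intro!: derivative_eq_intros)
      have d2: "((\<lambda>t. - q \<omega> * exp (- ((r + t) * q \<omega>))) has_real_derivative (q \<omega>)\<^sup>2 * exp (- ((r + t) * q \<omega>))) (at t)" for t
        by (auto intro!: derivative_eq_intros simp: power2_eq_square)
      have S: "\<bar>(q \<omega>)\<^sup>2 * exp (- ((r + t) * q \<omega>))\<bar> \<le> K" if "\<bar>t\<bar> \<le> \<bar>h\<bar>" for t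
      proof -
        have "\<bar>r + t\<bar> \<le> \<bar>r\<bar> + 1" using that h by linarith
        then show ?thesis
          using Q[OF \<omega>] exp_le[OF \<omega>, of "r + t"] unfolding K_def
          by (auto simp: abs_mult intro!: mult_mono power_mono)
      qed
      show "\<bar>exp (- ((r + h) * q \<omega>)) - exp (- (r * q \<omega>)) - h * (- q \<omega> * exp (- (r * q \<omega>)))\<bar> \<le> K * h\<^sup>2"
        using taylor_second_order(2)[OF d1 d2 S] by simp
    qed
    finally show ?thesis .
  qed
  show ?thesis
    unfolding DERIV_def
  proof (rule LIM_zero_cancel, rule Lim_null_comparison)
    show "((\<lambda>h. K * \<bar>h\<bar>) \<longlongrightarrow> 0) (at (0 :: real))"
      by (rule tendsto_eq_intros refl | simp)+
    show "\<forall>\<^sub>F h in at 0. norm (((\<integral>\<omega>. exp (- ((r + h) * q \<omega>)) \<partial>M) - (\<integral>\<omega>. exp (- (r * q \<omega>)) \<partial>M)) / h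
        - (\<integral>\<omega>. - q \<omega> * exp (- (r * q \<omega>)) \<partial>M)) \<le> K * \<bar>h\<bar>"
      unfolding eventually_at
    proof (intro exI[of _ 1] conjI ballI impI)
      fix h :: real assume h: "h \<noteq> 0 \<and> dist h 0 < 1"
      define A where "A = (\<integral>\<omega>. exp (- ((r + h) * q \<omega>)) \<partial>M) - (\<integral>\<omega>. exp (- (r * q \<omega>)) \<partial>M)"
      define D where "D = (\<integral>\<omega>. - q \<omega> * exp (- (r * q \<omega>)) \<partial>M)"
      have "\<bar>A - h * D\<bar> \<le> K * h\<^sup>2" unfolding A_def D_def by (rule bound) (use h in auto)
      moreover have "(A / h - D) * h = A - h * D" using h by (simp add: field_simps)
      then have "\<bar>A / h - D\<bar> * \<bar>h\<bar> = \<bar>A - h * D\<bar>" by (simp flip: abs_mult)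
      ultimately have "\<bar>A / h - D\<bar> * \<bar>h\<bar> \<le> (K * \<bar>h\<bar>) * \<bar>h\<bar>"
        by (simp add: power2_eq_square mult.assoc abs_mult_self_eq)
      then show "norm (A / h - D) \<le> K * \<bar>h\<bar>" using h by simp
    qed simp
  qed
qed

text \<open>The solution of (1 + r) u' + u = 0 with u(0) = 1 is 1/(1 + r). The number
  \<open>c\<close> bounds the defect in this equation, which is the derivative of (1 + r)
  u(r).\<close>

lemma (in prob_space) laplace_limit_bound:
  fixes q :: "'a \<Rightarrow> real"
  assumes q[measurable]: "q \<in> borel_measurable M"
    and Q: "\<And>\<omega>. \<omega> \<in> space M \<Longrightarrow> 0 \<le> q \<omega>" "\<And>\<omega>. \<omega> \<in> space M \<Longrightarrow> q \<omega> \<le> Q"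
    and s: "s \<ge> 0"
    and c: "\<And>r. 0 \<le> r \<Longrightarrow> r \<le> s \<Longrightarrow> \<bar>\<integral>\<omega>. ((1 + r) * q \<omega> - 1) * exp (- (r * q \<omega>)) \<partial>M\<bar> \<le> c"
  shows "\<bar>(\<integral>\<omega>. exp (- (s * q \<omega>)) \<partial>M) - 1 / (1 + s)\<bar> \<le> c * s"
proof -
  define u where "u r = (\<integral>\<omega>. exp (- (r * q \<omega>)) \<partial>M)" for r
  define D where "D r = (\<integral>\<omega>. - q \<omega> * exp (- (r * q \<omega>)) \<partial>M)" for r
  have u: "(u has_real_derivative D r) (at r)" for r
    unfolding u_def D_def by (rule laplace_has_derivative[OF q Q])
  have "norm ((1 + s) * u s - (1 + 0) * u 0) \<le> c * norm (s - 0)"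
  proof (rule field_differentiable_bound[of "{0..s}" "\<lambda>r. (1 + r) * u r" "\<lambda>r. (1 + r) * D r + 1 * u r"])
    fix r assume r: "r \<in> {0..s}"
    have "((\<lambda>r. (1 + r) * u r) has_real_derivative (1 + r) * D r + (0 + 1) * u r) (at r)"
      by (intro DERIV_mult' DERIV_add DERIV_const DERIV_ident u)
    then show "((\<lambda>r. (1 + r) * u r) has_real_derivative (1 + r) * D r + 1 * u r) (at r within {0..s})"
      by (simp add: has_field_derivative_at_within)
    have i1: "integrable M (\<lambda>\<omega>. exp (- (r * q \<omega>)))"
      by (rule integrable_real_bounded[of _ 1]) (use Q(1) r in auto)
    have i2: "integrable M (\<lambda>\<omega>. - q \<omega> * exp (- (r * q \<omega>)))"
    proof (rule integrable_real_bounded[of _ "Q * 1"])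
      fix \<omega> assume \<omega>: "\<omega> \<in> space M"
      show "\<bar>- q \<omega> * exp (- (r * q \<omega>))\<bar> \<le> Q * 1"
        unfolding abs_mult using Q[OF \<omega>] r by (intro mult_mono) auto
    qed measurable
    have "(1 + r) * D r + 1 * u r = (\<integral>\<omega>. (1 + r) * (- q \<omega> * exp (- (r * q \<omega>))) + exp (- (r * q \<omega>)) \<partial>M)"
      unfolding D_def u_def using i1 i2 by simp
    also have "\<dots> = (\<integral>\<omega>. - (((1 + r) * q \<omega> - 1) * exp (- (r * q \<omega>))) \<partial>M)"
      by (intro Bochner_Integration.integral_cong refl) (simp add: algebra_simps)
    also have "\<dots> = - (\<integral>\<omega>. ((1 + r) * q \<omega> - 1) * exp (- (r * q \<omega>)) \<partial>M)"
      by (rule integral_minus)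
    finally show "norm ((1 + r) * D r + 1 * u r) \<le> c" using c[of r] r by simp
  qed (use s in auto)
  moreover have "u 0 = 1" by (simp add: u_def prob_space)
  ultimately have *: "\<bar>(1 + s) * u s - 1\<bar> \<le> c * s" using s by simp
  have "\<bar>u s - 1 / (1 + s)\<bar> * 1 \<le> \<bar>u s - 1 / (1 + s)\<bar> * (1 + s)"
    using s by (intro mult_left_mono) auto
  also have "\<dots> = \<bar>(u s - 1 / (1 + s)) * (1 + s)\<bar>" using s by (simp add: abs_mult)
  also have "(u s - 1 / (1 + s)) * (1 + s) = (1 + s) * u s - 1" using s by (simp add: field_simps)
  finally show ?thesis using * by (simp add: u_def)
qed

context fourier_system
begin

text \<open>Crude, but it only secures the existence of integrals and does not enter the
  rates.\<close>

lemma lam_norm_bound: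
  assumes "\<And>j. j < n \<Longrightarrow> \<bar>x j\<bar> \<le> B" "k < n"
  shows "cmod (lam x k) \<le> real n * B"
proof -
  define z where "z = (\<Sum>j<n. \<theta> k j * of_real (x j))"
  have "cmod z \<le> (\<Sum>j<n. cmod (\<theta> k j * of_real (x j)))"
    unfolding z_def by (rule norm_sum)
  also have "\<dots> \<le> (\<Sum>j<n. B)"
    by (intro sum_mono) (simp add: norm_mult unit assms)
  finally have z: "cmod z \<le> real n * B" by simp
  have "cmod z / sqrt (real n) \<le> cmod z / 1"
    using n_pos by (intro divide_left_mono) auto
  with z show ?thesis by (simp add: lam_def norm_divide flip: z_def)
qed

text \<open>Euler's identity for the quadratic form |lambda_k|^2: the factor of \<open>x j\<close>
  is half of its partial derivative in \<open>x j\<close>.\<close>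

lemma sum_mult_Re_lam:
  "(\<Sum>j<n. x j * (Re (cnj (\<theta> k j) * lam x k) / sqrt (real n))) = (cmod (lam x k))\<^sup>2"
proof -
  have "(\<Sum>j<n. x j * (Re (cnj (\<theta> k j) * lam x k) / sqrt (real n)))
      = Re (\<Sum>j<n. cnj (\<theta> k j * of_real (x j)) * lam x k / of_real (sqrt (real n)))"
    unfolding Re_sum by (intro sum.cong refl) (simp add: algebra_simps)
  also have "(\<Sum>j<n. cnj (\<theta> k j * of_real (x j)) * lam x k / of_real (sqrt (real n))) = cnj (lam x k) * lam x k"
    by (simp add: lam_def cnj_sum sum_distrib_right sum_divide_distrib)
  also have "\<dots> = of_real ((cmod (lam x k))\<^sup>2)"
    unfolding complex_norm_square by (rule mult.commute)
  finally show ?thesis by simp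
qed

text \<open>The squares of \<open>Re\<close> are half the squared moduli plus a multiple of the
  vanishing sum of squares. This factor 1/2 distinguishes a complex Gaussian limit, hence the
  exponential law, from a real one.\<close>

lemma sum_Re_square:
  assumes "k < n" "(\<Sum>j<n. (\<theta> k j)\<^sup>2) = 0"
  shows "(\<Sum>j<n. (Re (cnj (\<theta> k j) * w))\<^sup>2) = real n * (cmod w)\<^sup>2 / 2"
proof -
  have re2: "(Re z)\<^sup>2 = ((cmod z)\<^sup>2 + Re (z\<^sup>2)) / 2" for z
    unfolding cmod_power2 by (simp add: Re_power2)
  have "(\<Sum>j<n. (Re (cnj (\<theta> k j) * w))\<^sup>2)
      = (\<Sum>j<n. ((cmod w)\<^sup>2 + Re (cnj ((\<theta> k j)\<^sup>2) * w\<^sup>2)) / 2)"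
    unfolding re2 using assms(1) by (intro sum.cong refl) (simp add: norm_mult unit power_mult_distrib)
  also have "\<dots> = (real n * (cmod w)\<^sup>2 + Re (cnj (\<Sum>j<n. (\<theta> k j)\<^sup>2) * w\<^sup>2)) / 2"
    by (simp only: sum_divide_distrib[symmetric] sum.distrib Re_sum[symmetric] sum_distrib_right[symmetric] cnj_sum)
      simp
  finally show ?thesis using assms(2) by simp
qed

end

text \<open>With each law living on the interval itself, every point of the product space has
  bounded coordinates, and the pointwise bounds of \<open>fourth_moment_bound\<close> apply without
  null sets.\<close>

locale bounded_system = fourier_system n \<theta> + prob_family M
  for n :: nat and \<theta> :: "nat \<Rightarrow> nat \<Rightarrow> complex" and M :: "nat \<Rightarrow> real measure" +
  fixes B :: real
  assumes sets_M: "\<And>j. sets (M j) = sets (restrict_space borel {- B..B})"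
    and mean: "\<And>j. (\<integral>y. y \<partial>M j) = 0"
    and var: "\<And>j. (\<integral>y. y\<^sup>2 \<partial>M j) = 1"
begin

abbreviation N where "N \<equiv> PiM {..<n} M"

sublocale N: prob_space N
  by (rule prob_space_PiM) (rule prob_space)

lemma space_M: "space (M j) = {- B..B}"
  using sets_eq_imp_space_eq[OF sets_M[of j]] by (simp add: space_restrict_space)

lemma id_measurable [measurable]: "(\<lambda>y. y) \<in> borel_measurable (M j)"
proof -
  have "(\<lambda>y. y) \<in> borel_measurable (restrict_space borel {- B..B})"
    by (rule measurable_restrict_space1) simp
  then show ?thesis using measurable_cong_sets[OF sets_M[of j] refl] by blast
qed

lemma space_N:
  assumes "x \<in> space N" "j < n"
  shows "\<bar>x j\<bar> \<le> B"
proof -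
  have "x j \<in> space (M j)" using assms by (auto simp: space_PiM PiE_iff)
  then show ?thesis by (auto simp: space_M)
qed

lemma B_nonneg: "B \<ge> 0"
  using M.not_empty[of 0] by (simp add: space_M)

lemma coord_measurable: "j < n \<Longrightarrow> (\<lambda>x. x j) \<in> borel_measurable N"
  by (rule measurable_compose[where f = "\<lambda>x. x j" and N = "M j" and g = "\<lambda>y. y"]) simp_all

lemma lam_measurable [measurable]: "(\<lambda>x. lam x k) \<in> borel_measurable N"
  unfolding lam_def
  by (intro borel_measurable_divide borel_measurable_sum borel_measurable_times
      borel_measurable_const measurable_compose[OF coord_measurable borel_measurable_of_real]) auto

lemma G_measurable [measurable]: "G s \<in> borel_measurable N"
  unfolding G_def by measurable

lemma G_fourth_moment:
  assumes s: "s \<ge> 1"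
  shows "(\<integral>x. (G s x - (\<integral>x. G s x \<partial>N)) ^ 4 \<partial>N)
    \<le> 11 * ((32 * B\<^sup>2 * s\<^sup>2 + 1152 * s\<^sup>2 * B ^ 4) / real n)\<^sup>2"
proof (rule fourth_moment_bound[where b = 1])
  fix x assume x: "x \<in> space N"
  show "\<bar>G s x\<bar> \<le> 1" using G_bounds[of s x] s by simp
  \<comment> \<open>The squared gradient sums to O(1/n), and so do the \<open>n\<close> remainders
    of size O(1/n^2).\<close>
  define d where "d j = 8 * B\<^sup>2 * (G_grad s x j)\<^sup>2 + 1152 * s\<^sup>2 * B ^ 4 / (real n)\<^sup>2" for j
  have "(\<Sum>j<n. d j) = 8 * B\<^sup>2 * (\<Sum>j<n. (G_grad s x j)\<^sup>2) + 1152 * s\<^sup>2 * B ^ 4 / real n"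
    using n_pos by (simp add: d_def sum.distrib sum_distrib_left power2_eq_square)
  also have "\<dots> \<le> 8 * B\<^sup>2 * (4 * s\<^sup>2 / real n) + 1152 * s\<^sup>2 * B ^ 4 / real n"
    by (intro add_right_mono mult_left_mono G_grad_square_sum s) auto
  finally have "(\<Sum>j<n. d j) \<le> (32 * B\<^sup>2 * s\<^sup>2 + 1152 * s\<^sup>2 * B ^ 4) / real n"
    by (simp add: add_divide_distrib)
  moreover have "(G s x - G s (x(j := z)))\<^sup>2 \<le> d j" if "j \<in> {..<n}" "z \<in> space (M j)" for j z
    unfolding d_def using that space_N[OF x]
    by (intro G_upd_square_bound s) (auto simp: space_M abs_le_iff)
  moreover have "0 \<le> d j" for j by (simp add: d_def)
  ultimately show "\<exists>d. (\<forall>j\<in>{..<n}. 0 \<le> d j) \<and>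
      (\<forall>j\<in>{..<n}. \<forall>z\<in>space (M j). (G s x - G s (x(j := z)))\<^sup>2 \<le> d j) \<and>
      (\<Sum>j<n. d j) \<le> (32 * B\<^sup>2 * s\<^sup>2 + 1152 * s\<^sup>2 * B ^ 4) / real n"
    by blast
qed simp_all

text \<open>Integration by parts in the \<open>j\<close>-th coordinate, up to an error \<open>O(n\<^sup>-\<^sup>3\<^sup>/\<^sup>2)\<close>.\<close>

lemma stein_coordinate:
  assumes r: "r \<ge> 0" and k: "k < n" and j: "j < n"
  defines "e \<equiv> \<lambda>x. exp (- (r * (cmod (lam x k))\<^sup>2))"
  defines "a \<equiv> \<lambda>x. Re (cnj (\<theta> k j) * lam x k)"
  shows "integrable N (\<lambda>x. x j * (a x / sqrt (real n) * e x) - (1 - 2 * r * (a x)\<^sup>2) / real n * e x)"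
    and "\<bar>\<integral>x. x j * (a x / sqrt (real n) * e x) - (1 - 2 * r * (a x)\<^sup>2) / real n * e x \<partial>N\<bar>
      \<le> (4 * (r\<^sup>2 + 2) + 6 * (r + 1)) / (real n * sqrt (real n)) * (B ^ 3 + B)"
proof -
  define q where "q = 1 / sqrt (real n)"
  have q: "q > 0" "q\<^sup>2 = 1 / real n" using n_pos by (auto simp: q_def power_divide)
  define L where "L = real n * B"
  define f where "f x = x j * (a x / sqrt (real n) * e x) - (1 - 2 * r * (a x)\<^sup>2) / real n * e x" for x
  have f_alt: "f x = x j * (q * (a x * e x)) - q\<^sup>2 * ((1 - 2 * r * (a x)\<^sup>2) * e x)" for x
    unfolding f_def q(2) by (simp add: q_def)
  have am[measurable]: "a \<in> borel_measurable N" unfolding a_def by measurable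
  have em[measurable]: "e \<in> borel_measurable N" unfolding e_def by measurable
  have [measurable]: "(\<lambda>x. x j) \<in> borel_measurable N" by (rule coord_measurable[OF j])
  have fm: "f \<in> borel_measurable N" unfolding f_alt by measurable
  have ab: "\<bar>a x\<bar> \<le> L" if "x \<in> space N" for x
  proof -
    have "\<bar>a x\<bar> \<le> cmod (cnj (\<theta> k j) * lam x k)" unfolding a_def by (rule abs_Re_le_cmod)
    also have "\<dots> \<le> L" unfolding L_def using lam_norm_bound[of x B k] space_N[OF that] k j
      by (simp add: norm_mult unit)
    finally show ?thesis .
  qed
  have eb: "0 < e x" "e x \<le> 1" for x using r by (auto simp: e_def)
  have fb: "\<bar>f x\<bar> \<le> B * (q * (L * 1)) + q\<^sup>2 * ((1 + 2 * r * L\<^sup>2) * 1)" if x: "x \<in> space N" for x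
  proof -
    have "\<bar>f x\<bar> \<le> \<bar>x j\<bar> * (q * (\<bar>a x\<bar> * e x)) + q\<^sup>2 * (\<bar>1 - 2 * r * (a x)\<^sup>2\<bar> * e x)"
      unfolding f_alt
      using abs_triangle_ineq4[of "x j * (q * (a x * e x))" "q\<^sup>2 * ((1 - 2 * r * (a x)\<^sup>2) * e x)"] q(1) eb[of x]
      by (simp add: abs_mult)
    also have "\<dots> \<le> B * (q * (L * 1)) + q\<^sup>2 * ((1 + 2 * r * L\<^sup>2) * 1)"
    proof -
      have "\<bar>1 - 2 * r * (a x)\<^sup>2\<bar> \<le> 1 + 2 * r * (a x)\<^sup>2"
        using r by (simp add: abs_le_iff)
      also have "\<dots> \<le> 1 + 2 * r * L\<^sup>2"
        using square_le_bound[OF ab[OF x]] r by (intro add_left_mono mult_left_mono) auto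
      finally show ?thesis
        using space_N[OF x j] ab[OF x] eb[of x] q(1) r B_nonneg
        by (intro add_mono mult_mono mult_left_mono) auto
    qed
    finally show ?thesis .
  qed
  show "integrable N (\<lambda>x. x j * (a x / sqrt (real n) * e x) - (1 - 2 * r * (a x)\<^sup>2) / real n * e x)"
    using N.integrable_real_bounded[OF fm fb] by (simp add: f_def)
  define K where "K = 4 * (r\<^sup>2 + 2) + 6 * (r + 1)"
  \<comment> \<open>Averaging over coordinate \<open>j\<close> first leaves a one-variable problem
    with all other inputs frozen.\<close>
  have "(\<integral>x. f x \<partial>N) = (\<integral>x. (\<integral>y. f (x(j := y)) \<partial>M j) \<partial>N)"
    using j by (intro integral_PiM_resample[OF _ _ fm fb]) auto
  also have "\<bar>\<dots>\<bar> \<le> K * q ^ 3 * (B ^ 3 + B)"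
  proof (rule N.abs_integral_le_bound)
    fix x assume x: "x \<in> space N"
    \<comment> \<open>The part of \<open>a\<close> that does not involve \<open>x j\<close>: as a
      function of the redrawn value \<open>y\<close>, \<open>a\<close> becomes
      \<open>c + y * q\<close>.\<close>
    define c where "c = a x - x j * q"
    define C where "C = exp (- (r * (Im (cnj (\<theta> k j) * lam x k))\<^sup>2))"
    have C: "0 < C" "C \<le> 1" using r by (auto simp: C_def)
    define g where "g t = exp (- (r * t\<^sup>2))" for t
    have lam_y: "lam (x(j := y)) k = lam x k + \<theta> k j * of_real ((y - x j) * q)" for y
      unfolding lam_upd[OF j] by (simp add: q_def)
    have unit1: "cnj (\<theta> k j) * \<theta> k j = 1"
      using unit[OF k j] complex_norm_square[of "\<theta> k j"] by (simp add: mult.commute)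
    have a_y: "a (x(j := y)) = c + y * q" for y
      unfolding a_def lam_y distrib_left mult.assoc[symmetric] unit1
      by (simp add: c_def a_def algebra_simps)
    have e_y: "e (x(j := y)) = C * g (c + y * q)" for y
      unfolding e_def lam_y cmod_add_unit_square[OF unit[OF k j]] C_def g_def c_def a_def
      by (simp add: algebra_simps flip: exp_add)
    define F where "F y = q * C * ((c + y * q) * g (c + y * q))" for y
    define F' where "F' y = q * C * ((1 - 2 * r * (c + y * q)\<^sup>2) * g (c + y * q) * q)" for y
    define F'' where "F'' y = q * C * ((4 * r\<^sup>2 * (c + y * q) ^ 3 - 6 * r * (c + y * q)) * g (c + y * q) * q * q)" for y
    have inner: "((\<lambda>t. c + t * q) has_real_derivative q) (at t)" for t
      by (auto intro!: derivative_eq_intros)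
    have dF: "(F has_real_derivative F' y) (at y)" for y
      unfolding F_def F'_def g_def
      by (intro DERIV_cmult DERIV_chain2[OF gauss_derivs(2) inner])
    have dF': "(F' has_real_derivative F'' y) (at y)" for y
      unfolding F'_def F''_def g_def
      by (intro DERIV_cmult DERIV_cmult_right DERIV_chain2[OF gauss_derivs(3) inner])
    \<comment> \<open>One factor \<open>q\<close> is the prefactor of \<open>F\<close>, the other
      two come from differentiating twice.\<close>
    have bF: "\<bar>F'' y\<bar> \<le> K * q ^ 3" for y
    proof -
      have "\<bar>F'' y\<bar> = q ^ 3 * (C * \<bar>(4 * r\<^sup>2 * (c + y * q) ^ 3 - 6 * r * (c + y * q)) * g (c + y * q)\<bar>)"
        using C q(1) by (simp add: F''_def abs_mult power3_eq_cube)
      also have "\<dots> \<le> q ^ 3 * (1 * K)"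
        using C q(1) unfolding g_def K_def
        by (intro mult_left_mono mult_mono gauss_deriv_bounds(2) r) auto
      finally show ?thesis by (simp add: mult.commute)
    qed
    have "f (x(j := y)) = y * F y - F' y" for y
      unfolding f_alt a_y e_y F_def F'_def by (simp add: power2_eq_square)
    then show "\<bar>\<integral>y. f (x(j := y)) \<partial>M j\<bar> \<le> K * q ^ 3 * (B ^ 3 + B)"
      using M.stein_approx[of "\<lambda>y. y" j B F F' F'', OF id_measurable _ mean var dF dF' bF]
      by (simp add: space_M abs_le_iff)
  qed
  also have "K * q ^ 3 = K / (real n * sqrt (real n))"
    using n_pos by (simp add: q_def power3_eq_cube)
  finally show "\<bar>\<integral>x. x j * (a x / sqrt (real n) * e x) - (1 - 2 * r * (a x)\<^sup>2) / real n * e x \<partial>N\<bar>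
      \<le> (4 * (r\<^sup>2 + 2) + 6 * (r + 1)) / (real n * sqrt (real n)) * (B ^ 3 + B)"
    by (simp add: f_def K_def)
qed

text \<open>Summed over \<open>j\<close>, Euler's identity produces |lambda_k|^2, and
  \<open>sum_Re_square\<close> collapses the second terms to 1 - r |lambda_k|^2; together they form
  the defect in \<open>laplace_limit_bound\<close>. The \<open>n\<close> errors of order n^(-3/2)
  add up to n^(-1/2).\<close>

lemma laplace_lam:
  assumes s: "s \<ge> 0" and k: "k < n" "(\<Sum>j<n. (\<theta> k j)\<^sup>2) = 0"
  shows "\<bar>(\<integral>x. exp (- (s * (cmod (lam x k))\<^sup>2)) \<partial>N) - 1 / (1 + s)\<bar>
    \<le> (4 * (s\<^sup>2 + 2) + 6 * (s + 1)) * (B ^ 3 + B) / sqrt (real n) * s"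
proof (rule N.laplace_limit_bound[where Q = "(real n * B)\<^sup>2"])
  show "(\<lambda>x. (cmod (lam x k))\<^sup>2) \<in> borel_measurable N" by measurable
  show "0 \<le> (cmod (lam x k))\<^sup>2" for x by simp
  show "(cmod (lam x k))\<^sup>2 \<le> (real n * B)\<^sup>2" if "x \<in> space N" for x
    using lam_norm_bound[of x B k] space_N[OF that] k(1) by (intro power_mono) auto
  show "s \<ge> 0" by (rule s)
  fix r assume r: "0 \<le> r" "r \<le> s"
  define e where "e x = exp (- (r * (cmod (lam x k))\<^sup>2))" for x
  define a where "a x j = Re (cnj (\<theta> k j) * lam x k)" for x j
  define f where "f j x = x j * (a x j / sqrt (real n) * e x) - (1 - 2 * r * (a x j)\<^sup>2) / real n * e x" for j x
  have "(\<Sum>j<n. f j x) = ((1 + r) * (cmod (lam x k))\<^sup>2 - 1) * e x" for x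
  proof -
    have "(\<Sum>j<n. f j x) = (\<Sum>j<n. x j * (a x j / sqrt (real n))) * e x
        - (\<Sum>j<n. 1 - 2 * r * (a x j)\<^sup>2) / real n * e x"
      unfolding f_def sum_subtractf[of "\<lambda>j. x j * (a x j / sqrt (real n) * e x)"]
        sum_distrib_right sum_divide_distrib by (simp only: mult.assoc)
    also have "(\<Sum>j<n. 1 - 2 * r * (a x j)\<^sup>2) = real n - 2 * r * (\<Sum>j<n. (a x j)\<^sup>2)"
      by (simp add: sum_subtractf sum_distrib_left)
    also have "\<dots> = real n * (1 - r * (cmod (lam x k))\<^sup>2)"
      unfolding a_def sum_Re_square[OF k] by (simp add: algebra_simps)
    also have "(\<Sum>j<n. x j * (a x j / sqrt (real n))) = (cmod (lam x k))\<^sup>2"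
      unfolding a_def by (rule sum_mult_Re_lam)
    finally have "(\<Sum>j<n. f j x) = (cmod (lam x k))\<^sup>2 * e x - (1 - r * (cmod (lam x k))\<^sup>2) * e x"
      using n_pos by simp
    then show ?thesis by (simp add: algebra_simps)
  qed
  then have "(\<integral>x. ((1 + r) * (cmod (lam x k))\<^sup>2 - 1) * exp (- (r * (cmod (lam x k))\<^sup>2)) \<partial>N) = (\<integral>x. (\<Sum>j<n. f j x) \<partial>N)"
    by (simp add: e_def)
  also have "\<dots> = (\<Sum>j<n. \<integral>x. f j x \<partial>N)"
    unfolding f_def a_def e_def
    by (intro Bochner_Integration.integral_sum stein_coordinate(1) r k(1)) simp
  also have "\<bar>\<dots>\<bar> \<le> (\<Sum>j<n. (4 * (r\<^sup>2 + 2) + 6 * (r + 1)) / (real n * sqrt (real n)) * (B ^ 3 + B))"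
    unfolding f_def a_def e_def
    by (intro order_trans[OF sum_abs] sum_mono stein_coordinate(2) r k(1)) simp
  also have "\<dots> = (4 * (r\<^sup>2 + 2) + 6 * (r + 1)) * (B ^ 3 + B) / sqrt (real n)"
    using n_pos by simp
  also have "\<dots> \<le> (4 * (s\<^sup>2 + 2) + 6 * (s + 1)) * (B ^ 3 + B) / sqrt (real n)"
    using r B_nonneg by (intro divide_right_mono mult_right_mono add_mono mult_left_mono power_mono) auto
  finally show "\<bar>\<integral>x. ((1 + r) * (cmod (lam x k))\<^sup>2 - 1) * exp (- (r * (cmod (lam x k))\<^sup>2)) \<partial>N\<bar>
      \<le> (4 * (s\<^sup>2 + 2) + 6 * (s + 1)) * (B ^ 3 + B) / sqrt (real n)" .
qed

text \<open>Frequencies with a nonzero sum of squares have no rate, but each deviates by at most 1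
  and there are at most two, whence \<open>2 / n\<close>.\<close>

lemma G_expectation:
  assumes s: "s \<ge> 0"
  shows "\<bar>(\<integral>x. G s x \<partial>N) - 1 / (1 + s)\<bar>
    \<le> (4 * (s\<^sup>2 + 2) + 6 * (s + 1)) * (B ^ 3 + B) / sqrt (real n) * s + 2 / real n"
proof -
  define c where "c = (4 * (s\<^sup>2 + 2) + 6 * (s + 1)) * (B ^ 3 + B) / sqrt (real n) * s"
  have c: "c \<ge> 0" using s B_nonneg by (simp add: c_def)
  define S where "S = {k. k < n \<and> (\<Sum>j<n. (\<theta> k j)\<^sup>2) \<noteq> 0}"
  define u where "u k = (\<integral>x. exp (- (s * (cmod (lam x k))\<^sup>2)) \<partial>N)" for k
  have int: "integrable N (\<lambda>x. exp (- (s * (cmod (lam x k))\<^sup>2)))" for k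
    by (rule N.integrable_real_bounded[of _ 1]) (use s in auto)
  have u01: "0 \<le> u k" "u k \<le> 1" for k
    unfolding u_def using s by (auto intro!: integral_nonneg_AE N.integral_le_bound)
  have s01: "0 \<le> 1 / (1 + s)" "1 / (1 + s) \<le> 1" using s by auto
  have uk: "\<bar>u k - 1 / (1 + s)\<bar> \<le> c + (if k \<in> S then 1 else 0)" if "k < n" for k
  proof (cases "k \<in> S")
    case True
    have "\<bar>u k - 1 / (1 + s)\<bar> \<le> 1" using u01[of k] s01 unfolding abs_le_iff by linarith
    then show ?thesis using True c by simp
  next
    case False
    then show ?thesis
      using laplace_lam[OF s that] that by (simp add: S_def u_def c_def)
  qed
  have "(\<integral>x. G s x \<partial>N) - 1 / (1 + s) = (\<Sum>k<n. u k - 1 / (1 + s)) / real n"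
    using n_pos int by (simp add: G_def u_def sum_subtractf diff_divide_distrib)
  also have "\<bar>\<dots>\<bar> \<le> (\<Sum>k<n. c + (if k \<in> S then 1 else 0)) / real n"
    unfolding abs_divide using uk by (auto intro!: divide_right_mono order_trans[OF sum_abs] sum_mono)
  also have "\<dots> = c + real (card S) / real n"
  proof -
    have "{..<n} \<inter> S = S" by (auto simp: S_def)
    then show ?thesis using n_pos by (simp add: sum.distrib sum.If_cases add_divide_distrib)
  qed
  also have "\<dots> \<le> c + 2 / real n"
    using few_self by (intro add_left_mono divide_right_mono) (auto simp: S_def)
  finally show ?thesis by (simp add: c_def)
qed

end

text \<open>For each \<open>n\<close>, independence identifies the law of the first \<open>n\<close>
  inputs with a finite product, where the moment bounds hold; the resulting fourth moments are
  summable on the original space.\<close>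

lemma (in prob_space) bounded_G_tendsto:
  fixes X :: "nat \<Rightarrow> 'a \<Rightarrow> real"
  assumes fs: "\<And>n. n > 0 \<Longrightarrow> fourier_system n (\<theta> n)"
    and indep: "indep_vars (\<lambda>_. borel) X UNIV"
    and b: "\<And>i \<omega>. \<bar>X i \<omega>\<bar> \<le> B"
    and mean: "\<And>i. (\<integral>\<omega>. X i \<omega> \<partial>M) = 0" and var: "\<And>i. (\<integral>\<omega>. (X i \<omega>)\<^sup>2 \<partial>M) = 1"
    and s: "s \<ge> 1"
  shows "AE \<omega> in M. (\<lambda>n. fourier_system.G n (\<theta> n) s (\<lambda>j. X j \<omega>)) \<longlonglongrightarrow> 1 / (1 + s)"
proof -
  define R where "R = restrict_space (borel :: real measure) {- B..B}"
  define m where "m = (\<lambda>j. distr M R (X j))"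
  have Xm[measurable]: "X j \<in> borel_measurable M" for j
    using indep by (simp add: indep_vars_def)
  have XR: "X j \<in> measurable M R" for j
    unfolding R_def using b[of j] by (intro measurable_restrict_space2 Xm) (auto simp: abs_le_iff minus_le_iff)
  have idR: "(\<lambda>y. y) \<in> borel_measurable R"
    unfolding R_def by (rule measurable_restrict_space1) simp
  have id2R: "(\<lambda>y. y\<^sup>2) \<in> borel_measurable R"
    using idR by measurable
  have B0: "B \<ge> 0" using b[of 0 undefined] by linarith
  have indepR: "indep_vars (\<lambda>_. R) X UNIV"
  proof -
    \<comment> \<open>Clipping fixes all values of the inputs, so composing with it moves
      independence from the real line to the interval.\<close>
    have clip: "(\<lambda>y. max (- B) (min B y)) \<in> measurable borel R"
      unfolding R_def using B0 by (intro measurable_restrict_space2) auto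
    have "max (- B) (min B (X i \<omega>)) = X i \<omega>" for i \<omega>
      using b[of i \<omega>] by (simp add: abs_le_iff min_def max_def)
    then show ?thesis using indep_vars_compose2[OF indep clip] by simp
  qed
  define N where "N n = PiM {..<n} m" for n
  have bs: "bounded_system n (\<theta> n) m B" if "n > 0" for n
  proof -
    show ?thesis
    proof (intro bounded_system.intro prob_family.intro bounded_system_axioms.intro)
      show "fourier_system n (\<theta> n)" by (rule fs[OF that])
      show "prob_space (m i)" for i unfolding m_def by (rule prob_space_distr[OF XR])
      show "sets (m j) = sets (restrict_space borel {- B..B})" for j by (simp add: m_def R_def)
      show "(\<integral>y. y \<partial>m j) = 0" for j
        using integral_distr[OF XR idR] by (simp add: m_def mean)
      show "(\<integral>y. y\<^sup>2 \<partial>m j) = 1" for j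
        using integral_distr[OF XR id2R] by (simp add: m_def var)
    qed
  qed
  define g where "g n \<omega> = fourier_system.G n (\<theta> n) s (\<lambda>j. X j \<omega>)" for n \<omega>
  define c where "c n = (\<integral>x. fourier_system.G n (\<theta> n) s x \<partial>N n)" for n
  define C where "C = 32 * B\<^sup>2 * s\<^sup>2 + 1152 * s\<^sup>2 * B ^ 4"
  have gm: "g n \<in> borel_measurable M" if "n > 0" for n
  proof -
    interpret fourier_system n "\<theta> n" by (rule fs[OF that])
    show ?thesis unfolding g_def G_def lam_def by measurable
  qed
  have g01: "0 \<le> g n \<omega>" "g n \<omega> \<le> 1" if "n > 0" for n \<omega>
  proof -
    interpret fourier_system n "\<theta> n" by (rule fs[OF that])
    show "0 \<le> g n \<omega>" "g n \<omega> \<le> 1" unfolding g_def using G_bounds s by auto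
  qed
  have fourth: "(\<integral>\<omega>. (g n \<omega> - c n) ^ 4 \<partial>M) \<le> 11 * (C / real n)\<^sup>2" if n: "n > 0" for n
  proof -
    interpret bounded_system n "\<theta> n" m B by (rule bs[OF n])
    define T where "T = (\<lambda>\<omega>. \<lambda>i\<in>{..<n}. X i \<omega>)"
    have Tm: "T \<in> measurable M (PiM {..<n} (\<lambda>_. R))"
      unfolding T_def by (intro measurable_restrict XR)
    have "indep_vars (\<lambda>_. R) X {..<n}" by (rule indep_vars_subset[OF indepR]) simp
    then have NT: "N n = distr M (PiM {..<n} (\<lambda>_. R)) T"
      using indep_vars_iff_distr_eq_PiM'[of "{..<n}" X "\<lambda>_. R"] n XR
      by (simp add: N_def m_def T_def lessThan_empty_iff)
    have sets_N: "sets (N n) = sets (PiM {..<n} (\<lambda>_. R))" unfolding NT by simp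
    have GT: "G s (T \<omega>) = g n \<omega>" for \<omega>
      by (simp add: G_def lam_def T_def g_def)
    have meas: "(\<lambda>x. (G s x - c n) ^ 4) \<in> borel_measurable (PiM {..<n} (\<lambda>_. R))"
    proof -
      have "G s \<in> borel_measurable (PiM {..<n} (\<lambda>_. R))"
        using G_measurable[of s] measurable_cong_sets[OF sets_N refl, of borel]
        unfolding N_def by blast
      then show ?thesis by measurable
    qed
    have "(\<integral>\<omega>. (g n \<omega> - c n) ^ 4 \<partial>M) = (\<integral>x. (G s x - c n) ^ 4 \<partial>N n)"
      unfolding NT by (subst integral_distr[OF Tm meas]) (simp add: GT)
    also have "\<dots> \<le> 11 * (C / real n)\<^sup>2"
      unfolding N_def c_def C_def by (rule G_fourth_moment[OF s])
    finally show ?thesis .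
  qed
  have c_lim: "c \<longlonglongrightarrow> 1 / (1 + s)"
  proof -
    define A where "A = (4 * (s\<^sup>2 + 2) + 6 * (s + 1)) * (B ^ 3 + B)"
    have "(\<lambda>n. A / sqrt (real n) * s + 2 / real n) \<longlonglongrightarrow> 0 * s + 0"
      by (intro tendsto_add tendsto_mult tendsto_const lim_const_over_n
          real_tendsto_divide_at_top[OF tendsto_const] filterlim_compose[OF sqrt_at_top filterlim_real_sequentially])
    then have lim0: "(\<lambda>n. A / sqrt (real n) * s + 2 / real n) \<longlonglongrightarrow> 0" by simp
    have "\<forall>\<^sub>F n in sequentially. norm (c n - 1 / (1 + s)) \<le> A / sqrt (real n) * s + 2 / real n"
      using eventually_gt_at_top[of 0]
    proof eventually_elim
      case (elim n)
      interpret bounded_system n "\<theta> n" m B by (rule bs[OF elim])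
      show ?case using G_expectation[of s] s by (simp add: c_def N_def A_def)
    qed
    then show ?thesis by (rule LIM_zero_cancel[OF Lim_null_comparison[OF _ lim0]])
  qed
  \<comment> \<open>Set to 0 at \<open>n = 0\<close>, where no Fourier system exists.\<close>
  define f where "f n \<omega> = (if n = 0 then 0 else (g n \<omega> - c n) ^ 4)" for n \<omega>
  have fm: "f n \<in> borel_measurable M" for n
    unfolding f_def using gm[of n] by (cases "n = 0") auto
  have c01: "0 \<le> c n" "c n \<le> 1" if "n > 0" for n
  proof -
    interpret bounded_system n "\<theta> n" m B by (rule bs[OF that])
    show "0 \<le> c n" "c n \<le> 1"
      unfolding c_def N_def using G_bounds s by (auto intro!: integral_nonneg_AE N.integral_le_bound)
  qed
  have fb: "\<bar>f n \<omega>\<bar> \<le> 1" for n \<omega>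
  proof (cases "n = 0")
    case False
    then have "\<bar>g n \<omega> - c n\<bar> \<le> 1" using g01[of n \<omega>] c01[of n] by (simp add: abs_le_iff)
    then have "\<bar>g n \<omega> - c n\<bar> ^ 4 \<le> 1" by (intro power_le_one) auto
    then show ?thesis by (simp add: f_def power_abs)
  qed (simp add: f_def)
  have "AE \<omega> in M. (\<lambda>n. f n \<omega>) \<longlonglongrightarrow> 0"
  proof (rule AE_tendsto_0_of_summable_integral[OF fm])
    show "0 \<le> f n \<omega>" for n \<omega> by (simp add: f_def)
    show "integrable M (f n)" for n by (rule integrable_real_bounded[OF fm fb])
    have bd: "(\<integral>\<omega>. f n \<omega> \<partial>M) \<le> 11 * C\<^sup>2 * inverse (real n ^ 2)" for n
      using fourth[of n] by (cases "n = 0") (auto simp: f_def power_mult_distrib power_inverse divide_inverse)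
    show "summable (\<lambda>n. \<integral>\<omega>. f n \<omega> \<partial>M)"
    proof (rule summable_comparison_test')
      show "summable (\<lambda>n. 11 * C\<^sup>2 * inverse (real n ^ 2))"
        by (intro summable_mult inverse_power_summable) simp
      show "norm (\<integral>\<omega>. f n \<omega> \<partial>M) \<le> 11 * C\<^sup>2 * inverse (real n ^ 2)" for n
        using bd[of n] by (simp add: f_def)
    qed
  qed
  then show ?thesis
  proof (rule AE_mp, intro AE_I2 impI)
    fix \<omega> assume lim: "(\<lambda>n. f n \<omega>) \<longlonglongrightarrow> 0"
    have "\<forall>\<^sub>F n in sequentially. f n \<omega> = (g n \<omega> - c n) ^ 4"
      using eventually_gt_at_top[of 0] by eventually_elim (simp add: f_def)
    with lim have "(\<lambda>n. (g n \<omega> - c n) ^ 4) \<longlonglongrightarrow> 0" by (simp cong: filterlim_cong)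
    then have "(\<lambda>n. g n \<omega> - c n) \<longlonglongrightarrow> 0" by simp
    from tendsto_add[OF this c_lim] show "(\<lambda>n. fourier_system.G n (\<theta> n) s (\<lambda>j. X j \<omega>)) \<longlonglongrightarrow> 1 / (1 + s)"
      by (simp add: g_def)
  qed
qed

section \<open>A one-sided strong law of large numbers\<close>

lemma (in prob_space) variance_sum_indep_le:
  fixes W :: "nat \<Rightarrow> 'a \<Rightarrow> real"
  assumes indep: "indep_vars (\<lambda>_. borel) W UNIV"
    and b: "\<And>i \<omega>. \<bar>W i \<omega>\<bar> \<le> c i"
  shows "(\<integral>\<omega>. ((\<Sum>i<n. W i \<omega>) - (\<Sum>i<n. \<integral>\<omega>. W i \<omega> \<partial>M))\<^sup>2 \<partial>M) \<le> (\<Sum>i<n. \<integral>\<omega>. (W i \<omega>)\<^sup>2 \<partial>M)"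
proof -
  define m where "m i = (\<integral>\<omega>. W i \<omega> \<partial>M)" for i
  define Z where "Z i \<omega> = W i \<omega> - m i" for i \<omega>
  have Wm[measurable]: "W i \<in> borel_measurable M" for i
    using indep by (simp add: indep_vars_def)
  have iW: "integrable M (W i)" for i by (rule integrable_real_bounded[OF Wm b])
  have iW2: "integrable M (\<lambda>\<omega>. (W i \<omega>)\<^sup>2)" for i
    by (rule integrable_real_bounded[OF _ abs_square_le[OF b]]) auto
  have Zm[measurable]: "Z i \<in> borel_measurable M" for i unfolding Z_def by measurable
  have Zb: "\<bar>Z i \<omega>\<bar> \<le> c i + \<bar>m i\<bar>" for i \<omega>
    unfolding Z_def using b[of i \<omega>] by linarith
  have iZ: "integrable M (Z i)" for i by (rule integrable_real_bounded[OF Zm Zb])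
  have EZ: "(\<integral>\<omega>. Z i \<omega> \<partial>M) = 0" for i
    unfolding Z_def using iW[of i] by (simp add: m_def prob_space)
  have iZZ: "integrable M (\<lambda>\<omega>. Z i \<omega> * Z j \<omega>)" for i j
    by (rule integrable_real_bounded[of _ "(c i + \<bar>m i\<bar>) * (c j + \<bar>m j\<bar>)"])
      (auto simp: abs_mult intro!: mult_mono Zb order_trans[OF abs_ge_zero Zb])
  have indepZ: "indep_vars (\<lambda>_. borel) Z UNIV"
    unfolding Z_def by (rule indep_vars_compose2[OF indep, of "\<lambda>i y. y - m i"]) simp
  have EZZ: "(\<integral>\<omega>. Z i \<omega> * Z j \<omega> \<partial>M) = (if i = j then (\<integral>\<omega>. (Z i \<omega>)\<^sup>2 \<partial>M) else 0)" for i j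
  proof (cases "i = j")
    case False
    have "(\<integral>\<omega>. (\<Prod>k\<in>{i, j}. Z k \<omega>) \<partial>M) = (\<Prod>k\<in>{i, j}. \<integral>\<omega>. Z k \<omega> \<partial>M)"
      by (rule indep_vars_lebesgue_integral) (auto intro: indep_vars_subset[OF indepZ] iZ)
    then show ?thesis using False by (simp add: EZ)
  qed (simp add: power2_eq_square)
  have EZ2: "(\<integral>\<omega>. (Z i \<omega>)\<^sup>2 \<partial>M) \<le> (\<integral>\<omega>. (W i \<omega>)\<^sup>2 \<partial>M)" for i
    using variance_eq[OF iW iW2, of i] by (simp add: Z_def m_def)
  have "(\<integral>\<omega>. ((\<Sum>i<n. W i \<omega>) - (\<Sum>i<n. \<integral>\<omega>. W i \<omega> \<partial>M))\<^sup>2 \<partial>M) = (\<integral>\<omega>. (\<Sum>i<n. \<Sum>j<n. Z i \<omega> * Z j \<omega>) \<partial>M)"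
    by (simp add: Z_def m_def power2_eq_square sum_subtractf[symmetric] sum_product)
  also have "\<dots> = (\<Sum>i<n. \<Sum>j<n. \<integral>\<omega>. Z i \<omega> * Z j \<omega> \<partial>M)"
    using iZZ by (simp add: Bochner_Integration.integral_sum)
  also have "\<dots> = (\<Sum>i<n. \<integral>\<omega>. (Z i \<omega>)\<^sup>2 \<partial>M)"
    by (simp add: EZZ)
  also have "\<dots> \<le> (\<Sum>i<n. \<integral>\<omega>. (W i \<omega>)\<^sup>2 \<partial>M)" by (intro sum_mono EZ2)
  finally show ?thesis .
qed

text \<open>A dyadic average is a quarter of the preceding one plus at most the new block of the
  convergent series. The extra \<open>T p / 3\<close> in the induction pays in advance for the
  geometric tail 1/4 + 1/16 + ... = 1/3.\<close>

lemma summable_dyadic_averages: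
  fixes a :: "nat \<Rightarrow> real"
  assumes nonneg: "\<And>i. 0 \<le> a i" and sm: "summable (\<lambda>i. a i / (real i + 1)\<^sup>2)"
  shows "summable (\<lambda>p. (\<Sum>i<2 ^ p. a i) / 4 ^ p)"
proof -
  define b where "b i = a i / (real i + 1)\<^sup>2" for i
  define T where "T p = (\<Sum>i<2 ^ p. a i) / 4 ^ p" for p :: nat
  have b0: "0 \<le> b i" for i using nonneg by (simp add: b_def)
  have step: "T (Suc p) \<le> T p / 4 + (\<Sum>i=2 ^ p..<2 ^ Suc p. b i)" for p
  proof -
    have "(\<Sum>i<2 ^ Suc p. a i) = (\<Sum>i<2 ^ p. a i) + (\<Sum>i=2 ^ p..<2 ^ Suc p. a i)"
      by (simp add: lessThan_atLeast0 sum.atLeastLessThan_concat)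
    moreover have "(\<Sum>i=2 ^ p..<2 ^ Suc p. a i) / 4 ^ Suc p \<le> (\<Sum>i=2 ^ p..<2 ^ Suc p. b i)"
      unfolding sum_divide_distrib
    proof (rule sum_mono)
      fix i :: nat assume i: "i \<in> {2 ^ p..<2 ^ Suc p}"
      then have "real (i + 1) \<le> real (2 ^ Suc p)" by (intro of_nat_mono) auto
      then have "(real i + 1)\<^sup>2 \<le> (2 ^ Suc p)\<^sup>2" by (intro power_mono) auto
      also have "\<dots> = (4 :: real) ^ Suc p" by (simp add: power2_eq_square flip: power_mult_distrib)
      finally show "a i / 4 ^ Suc p \<le> b i"
        unfolding b_def by (intro divide_left_mono nonneg) (auto intro!: mult_pos_pos)
    qed
    ultimately show ?thesis by (simp add: T_def add_divide_distrib)
  qed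
  have "(\<Sum>q<Suc p. T q) + T p / 3 \<le> 4 / 3 * (\<Sum>i<2 ^ p. b i)" for p
  proof (induction p)
    case 0
    then show ?case by (simp add: T_def b_def)
  next
    case (Suc p)
    have "(\<Sum>i<2 ^ Suc p. b i) = (\<Sum>i<2 ^ p. b i) + (\<Sum>i=2 ^ p..<2 ^ Suc p. b i)"
      by (simp add: lessThan_atLeast0 sum.atLeastLessThan_concat)
    then show ?case using Suc step[of p] by simp
  qed
  moreover have "0 \<le> T p" for p using nonneg by (simp add: T_def sum_nonneg)
  moreover have "(\<Sum>i<n. b i) \<le> suminf b" for n
    by (rule sum_le_suminf) (use sm b0 in \<open>auto simp: b_def\<close>)
  ultimately have "(\<Sum>q<p. T q) \<le> 4 / 3 * suminf b" for p
  proof -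
    have "(\<Sum>q<p. T q) \<le> (\<Sum>q<Suc p. T q) + T p / 3"
      using \<open>\<And>p. 0 \<le> T p\<close>[of p] by simp
    also have "\<dots> \<le> 4 / 3 * (\<Sum>i<2 ^ p. b i)" by fact
    also have "\<dots> \<le> 4 / 3 * suminf b"
      using \<open>\<And>n. (\<Sum>i<n. b i) \<le> suminf b\<close>[of "2 ^ p"] by simp
    finally show ?thesis .
  qed
  then show ?thesis
    using summableI_nonneg_bounded[of T, OF \<open>\<And>p. 0 \<le> T p\<close>] unfolding T_def by blast
qed

text \<open>Second moments control the sums along powers of 2; between these, sums of nonnegative
  terms are monotone, which costs the factor 2 before \<open>\<mu>\<close>. This is acceptable
  because \<open>\<mu>\<close> will be small, and it avoids any maximal inequality.\<close>

lemma (in prob_space) slln_upper_bound: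
  fixes W :: "nat \<Rightarrow> 'a \<Rightarrow> real"
  assumes indep: "indep_vars (\<lambda>_. borel) W UNIV"
    and nonneg: "\<And>i \<omega>. 0 \<le> W i \<omega>" and int: "\<And>i. integrable M (W i)"
    and mean: "\<And>i. (\<integral>\<omega>. W i \<omega> \<partial>M) \<le> \<mu>"
    and tail: "summable (\<lambda>i. \<integral>\<omega>. (of_bool (real i + 1 < W i \<omega>) :: real) \<partial>M)"
    and var: "summable (\<lambda>i. (\<integral>\<omega>. (W i \<omega> * of_bool (W i \<omega> \<le> real i + 1))\<^sup>2 \<partial>M) / (real i + 1)\<^sup>2)"
    and \<eta>: "\<eta> > 0"
  shows "AE \<omega> in M. \<forall>\<^sub>F n in sequentially. (\<Sum>i<n. W i \<omega>) / real n \<le> 2 * \<mu> + \<eta>"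
proof -
  have Wm[measurable]: "W i \<in> borel_measurable M" for i
    using indep by (simp add: indep_vars_def)
  \<comment> \<open>The truncation level grows with the index: by \<open>tail\<close> and
    Borel--Cantelli almost surely only finitely many terms change, while \<open>var\<close> keeps
    the second moments in check.\<close>
  define W' where "W' i \<omega> = W i \<omega> * of_bool (W i \<omega> \<le> real i + 1)" for i \<omega>
  have W'0: "0 \<le> W' i \<omega>" for i \<omega> using nonneg by (simp add: W'_def)
  have W'b: "\<bar>W' i \<omega>\<bar> \<le> real i + 1" for i \<omega> using nonneg[of i \<omega>] by (simp add: W'_def of_bool_def)
  have W'm[measurable]: "W' i \<in> borel_measurable M" for i unfolding W'_def by measurable
  have indep': "indep_vars (\<lambda>_. borel) W' UNIV"
    unfolding W'_def
    by (rule indep_vars_compose2[OF indep, of "\<lambda>i y. y * of_bool (y \<le> real i + 1)"]) measurable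
  have EW': "(\<integral>\<omega>. W' i \<omega> \<partial>M) \<le> \<mu>" for i
  proof -
    have "(\<integral>\<omega>. W' i \<omega> \<partial>M) \<le> (\<integral>\<omega>. W i \<omega> \<partial>M)"
      by (rule integral_mono[OF integrable_real_bounded[OF W'm W'b] int])
        (use nonneg in \<open>simp add: W'_def of_bool_def\<close>)
    with mean[of i] show ?thesis by simp
  qed
  have AE1: "AE \<omega> in M. \<forall>\<^sub>F i in sequentially. \<omega> \<in> space M - {\<omega> \<in> space M. real i + 1 < W i \<omega>}"
  proof (rule borel_cantelli_AE1)
    have "measure M {\<omega> \<in> space M. real i + 1 < W i \<omega>} = (\<integral>\<omega>. (of_bool (real i + 1 < W i \<omega>) :: real) \<partial>M)" for i
    proof -
      have "(\<integral>\<omega>. (of_bool (real i + 1 < W i \<omega>) :: real) \<partial>M) = (\<integral>\<omega>. indicator {\<omega> \<in> space M. real i + 1 < W i \<omega>} \<omega> \<partial>M)"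
        by (rule Bochner_Integration.integral_cong) (auto simp: indicator_def)
      also have "\<dots> = measure M {\<omega> \<in> space M. real i + 1 < W i \<omega>}" by (simp add: Int_absorb1 subset_eq)
      finally show ?thesis by simp
    qed
    then show "summable (\<lambda>i. measure M {\<omega> \<in> space M. real i + 1 < W i \<omega>})" using tail by simp
  qed (auto simp: emeasure_eq_measure)
  define D where "D p \<omega> = ((\<Sum>i<2 ^ p. W' i \<omega>) - (\<Sum>i<2 ^ p. \<integral>\<omega>. W' i \<omega> \<partial>M)) / 2 ^ p" for p \<omega>
  have Dm: "(\<lambda>\<omega>. (D p \<omega>)\<^sup>2) \<in> borel_measurable M" for p unfolding D_def by measurable
  have D_int: "integrable M (\<lambda>\<omega>. (D p \<omega>)\<^sup>2)" for p
  proof (rule integrable_real_bounded[OF Dm abs_square_le])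
    fix \<omega>
    have "\<bar>\<Sum>i<2 ^ p. W' i \<omega>\<bar> \<le> (\<Sum>i<2 ^ p. real i + 1)"
      by (rule order_trans[OF sum_abs]) (intro sum_mono W'b)
    then show "\<bar>D p \<omega>\<bar> \<le> ((\<Sum>i<2 ^ p. real i + 1) + \<bar>\<Sum>i<2 ^ p. \<integral>\<omega>. W' i \<omega> \<partial>M\<bar>) / 2 ^ p"
      unfolding D_def abs_divide by (intro frac_le order_trans[OF abs_triangle_ineq4]) auto
  qed
  have AE2: "AE \<omega> in M. (\<lambda>p. (D p \<omega>)\<^sup>2) \<longlonglongrightarrow> 0"
  proof (rule AE_tendsto_0_of_summable_integral[OF Dm _ D_int])
    have "(\<integral>\<omega>. (D p \<omega>)\<^sup>2 \<partial>M) \<le> (\<Sum>i<2 ^ p. \<integral>\<omega>. (W' i \<omega>)\<^sup>2 \<partial>M) / 4 ^ p" for p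
    proof -
      have "((2 :: real) ^ p)\<^sup>2 = 4 ^ p"
        by (simp add: power2_eq_square flip: power_mult_distrib)
      then have "(\<integral>\<omega>. (D p \<omega>)\<^sup>2 \<partial>M)
        = (\<integral>\<omega>. ((\<Sum>i<2 ^ p. W' i \<omega>) - (\<Sum>i<2 ^ p. \<integral>\<omega>. W' i \<omega> \<partial>M))\<^sup>2 \<partial>M) / 4 ^ p"
        by (simp add: D_def power_divide)
      also have "\<dots> \<le> (\<Sum>i<2 ^ p. \<integral>\<omega>. (W' i \<omega>)\<^sup>2 \<partial>M) / 4 ^ p"
        by (intro divide_right_mono variance_sum_indep_le[OF indep' W'b]) simp
      finally show ?thesis .
    qed
    then have "norm (\<integral>\<omega>. (D p \<omega>)\<^sup>2 \<partial>M) \<le> (\<Sum>i<2 ^ p. \<integral>\<omega>. (W' i \<omega>)\<^sup>2 \<partial>M) / 4 ^ p" for p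
      by simp
    moreover have "summable (\<lambda>p. (\<Sum>i<2 ^ p. \<integral>\<omega>. (W' i \<omega>)\<^sup>2 \<partial>M) / 4 ^ p)"
      by (rule summable_dyadic_averages) (use var in \<open>simp_all add: W'_def\<close>)
    ultimately show "summable (\<lambda>p. \<integral>\<omega>. (D p \<omega>)\<^sup>2 \<partial>M)"
      by (rule summable_comparison_test'[rotated])
  qed auto
  show ?thesis
    using AE1 AE2
  proof (rule AE_mp[OF AE_conjI], intro AE_I2 impI)
    fix \<omega>
    assume *: "(\<forall>\<^sub>F i in sequentially. \<omega> \<in> space M - {\<omega> \<in> space M. real i + 1 < W i \<omega>}) \<and>
      (\<lambda>p. (D p \<omega>)\<^sup>2) \<longlonglongrightarrow> 0"
    then obtain n0 where n0: "\<And>i. i \<ge> n0 \<Longrightarrow> W i \<omega> \<le> real i + 1"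
      unfolding eventually_sequentially by (auto simp: not_less)
    have "(\<lambda>p. D p \<omega>) \<longlonglongrightarrow> 0" using * by simp
    then have "\<forall>\<^sub>F p in sequentially. D p \<omega> < \<eta> / 4"
      by (rule order_tendstoD(2)) (use \<eta> in simp)
    then obtain p0 where p0: "\<And>p. p \<ge> p0 \<Longrightarrow> D p \<omega> < \<eta> / 4"
      unfolding eventually_sequentially by blast
    \<comment> \<open>The finitely many early terms, which truncation may have altered; divided by
      \<open>n\<close> they vanish.\<close>
    define c where "c = (\<Sum>i<n0. W i \<omega>)"
    have c0: "c \<ge> 0" by (simp add: c_def sum_nonneg nonneg)
    have W_le: "(\<Sum>i<n. W i \<omega>) \<le> c + (\<Sum>i<n. W' i \<omega>)" for n
    proof -
      have "(\<Sum>i<n. W i \<omega>) \<le> (\<Sum>i<n. (if i < n0 then W i \<omega> else 0) + W' i \<omega>)"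
        using n0 nonneg W'0 by (intro sum_mono) (auto simp: W'_def not_less)
      also have "(\<Sum>i<n. if i < n0 then W i \<omega> else 0) = (\<Sum>i\<in>{..<n} \<inter> {..<n0}. W i \<omega>)"
        by (simp add: sum.If_cases lessThan_def)
      then have "(\<Sum>i<n. (if i < n0 then W i \<omega> else 0) + W' i \<omega>)
          \<le> c + (\<Sum>i<n. W' i \<omega>)"
        unfolding sum.distrib c_def by (simp add: sum_mono2 nonneg)
      finally show ?thesis .
    qed
    have main: "(\<Sum>i<n. W' i \<omega>) / real n \<le> 2 * \<mu> + \<eta> / 2" if n: "n \<ge> 2 ^ p0" for n
    proof -
      have n1: "n \<ge> 1" using n by (metis order_trans one_le_numeral one_le_power)
      obtain p where p: "2 ^ p \<le> n" "n < 2 ^ (p + 1)" using ex_power_ivl1[of 2 n] n1 by auto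
      have "(2 :: nat) ^ p0 < 2 ^ (p + 1)" using n p by linarith
      then have pp: "p + 1 \<ge> p0" using power_less_imp_less_exp[of "2 :: nat" p0 "p + 1"] by simp
      have "(\<Sum>i<n. W' i \<omega>) \<le> (\<Sum>i<2 ^ (p + 1). W' i \<omega>)"
        using p W'0 by (intro sum_mono2) auto
      also have "\<dots> = 2 ^ (p + 1) * D (p + 1) \<omega> + (\<Sum>i<2 ^ (p + 1). \<integral>\<omega>. W' i \<omega> \<partial>M)"
        by (simp add: D_def)
      also have "\<dots> \<le> 2 ^ (p + 1) * (\<eta> / 4) + (\<Sum>i<(2::nat) ^ (p + 1). \<mu>)"
        by (intro add_mono mult_left_mono sum_mono EW' less_imp_le[OF p0[OF pp]]) auto
      also have "\<dots> = 2 ^ p * (2 * \<mu> + \<eta> / 2)" by (simp add: algebra_simps)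
      also have "\<dots> \<le> real n * (2 * \<mu> + \<eta> / 2)"
      proof (rule mult_right_mono)
        have "real (2 ^ p) \<le> real n" using p(1) by (rule of_nat_mono)
        then show "2 ^ p \<le> real n" by simp
        have "0 \<le> (\<integral>\<omega>. W 0 \<omega> \<partial>M)" using nonneg by simp
        then show "0 \<le> 2 * \<mu> + \<eta> / 2" using mean[of 0] \<eta> by linarith
      qed
      finally show ?thesis using n1 by (simp add: divide_le_eq mult.commute)
    qed
    have "(\<lambda>n. c / real n) \<longlonglongrightarrow> 0" by (rule lim_const_over_n)
    then have "\<forall>\<^sub>F n in sequentially. c / real n < \<eta> / 2"
      by (rule order_tendstoD(2)) (use \<eta> in simp)
    then show "\<forall>\<^sub>F n in sequentially. (\<Sum>i<n. W i \<omega>) / real n \<le> 2 * \<mu> + \<eta>"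
      using eventually_ge_at_top[of "2 ^ p0"]
    proof eventually_elim
      case (elim n)
      have "(\<Sum>i<n. W i \<omega>) / real n \<le> c / real n + (\<Sum>i<n. W' i \<omega>) / real n"
        using divide_right_mono[OF W_le[of n], of "real n"] by (simp add: add_divide_distrib)
      then show ?case using main[OF elim(2)] elim(1) by linarith
    qed
  qed
qed

section \<open>Truncation of the inputs\<close>

text \<open>Intended for \<open>m\<close> and \<open>v\<close> the mean and the variance of the
  truncated variable: integration by parts needs mean 0 and variance 1 exactly, which truncation
  destroys.\<close>

definition centered_trunc :: "real \<Rightarrow> real \<Rightarrow> real \<Rightarrow> real \<Rightarrow> real" where
  "centered_trunc K m v t = (t * of_bool (\<bar>t\<bar> \<le> K) - m) / sqrt v"

lemma centered_trunc_measurable [measurable]: "centered_trunc K m v \<in> borel_measurable borel"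
  unfolding centered_trunc_def by measurable

text \<open>Since \<open>v = 1 - E w^2 - m^2 \<ge> 1 / 2\<close>, rescaling at most doubles the
  bound \<open>2 * K\<close>. The distance follows from E (x - y)^2 = 2 - 2 E x y, where E x y = E
  z^2 / sqrt v is at least E z^2 \<ge> 1 - \<open>\<tau>\<close>.\<close>

lemma (in prob_space) centered_trunc_props:
  fixes x :: "'a \<Rightarrow> real"
  assumes xm[measurable]: "x \<in> borel_measurable M"
    and int: "integrable M x" "integrable M (\<lambda>\<omega>. (x \<omega>)\<^sup>2)"
    and mean: "(\<integral>\<omega>. x \<omega> \<partial>M) = 0" and var: "(\<integral>\<omega>. (x \<omega>)\<^sup>2 \<partial>M) = 1"
    and K: "K > 0" and \<tau>: "\<tau> \<le> 1 / 4"
    and tail: "(\<integral>\<omega>. (x \<omega>)\<^sup>2 * of_bool (K < \<bar>x \<omega>\<bar>) \<partial>M) \<le> \<tau>"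
  defines "z \<equiv> \<lambda>\<omega>. x \<omega> * of_bool (\<bar>x \<omega>\<bar> \<le> K)"
  defines "m \<equiv> (\<integral>\<omega>. z \<omega> \<partial>M)"
  defines "v \<equiv> (\<integral>\<omega>. (z \<omega>)\<^sup>2 \<partial>M) - m\<^sup>2"
  defines "y \<equiv> \<lambda>\<omega>. centered_trunc K m v (x \<omega>)"
  shows "\<And>t. \<bar>centered_trunc K m v t\<bar> \<le> 4 * K"
    and "(\<integral>\<omega>. y \<omega> \<partial>M) = 0" and "(\<integral>\<omega>. (y \<omega>)\<^sup>2 \<partial>M) = 1"
    and "integrable M (\<lambda>\<omega>. (x \<omega> - y \<omega>)\<^sup>2)"
    and "(\<integral>\<omega>. (x \<omega> - y \<omega>)\<^sup>2 \<partial>M) \<le> 2 * \<tau>"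
proof -
  define w where "w \<omega> = x \<omega> * of_bool (K < \<bar>x \<omega>\<bar>)" for \<omega>
  have zm[measurable]: "z \<in> borel_measurable M" unfolding z_def by measurable
  have zb: "\<bar>z \<omega>\<bar> \<le> K" for \<omega> using K by (simp add: z_def of_bool_def)
  have iz: "integrable M z" by (rule integrable_real_bounded[OF zm zb])
  have iz2: "integrable M (\<lambda>\<omega>. (z \<omega>)\<^sup>2)"
    by (rule integrable_real_bounded[OF _ abs_square_le[OF zb]]) auto
  have xzw: "x \<omega> = z \<omega> + w \<omega>" "(x \<omega>)\<^sup>2 = (z \<omega>)\<^sup>2 + (w \<omega>)\<^sup>2" "x \<omega> * z \<omega> = (z \<omega>)\<^sup>2" for \<omega>
    by (auto simp: z_def w_def of_bool_def power2_eq_square)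
  have iw: "integrable M w"
  proof -
    have "w = (\<lambda>\<omega>. x \<omega> - z \<omega>)" using xzw(1) by auto
    then show ?thesis using int(1) iz by simp
  qed
  have iw2: "integrable M (\<lambda>\<omega>. (w \<omega>)\<^sup>2)"
  proof -
    have "(\<lambda>\<omega>. (w \<omega>)\<^sup>2) = (\<lambda>\<omega>. (x \<omega>)\<^sup>2 - (z \<omega>)\<^sup>2)" using xzw(2) by auto
    then show ?thesis using int(2) iz2 by simp
  qed
  have w2: "(\<integral>\<omega>. (w \<omega>)\<^sup>2 \<partial>M) \<le> \<tau>"
  proof -
    have "(w \<omega>)\<^sup>2 = (x \<omega>)\<^sup>2 * of_bool (K < \<bar>x \<omega>\<bar>)" for \<omega>
      by (simp add: w_def power_mult_distrib of_bool_def)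
    then show ?thesis using tail by simp
  qed
  have Ez2: "(\<integral>\<omega>. (z \<omega>)\<^sup>2 \<partial>M) = 1 - (\<integral>\<omega>. (w \<omega>)\<^sup>2 \<partial>M)"
    using var iz2 iw2 by (simp add: xzw(2))
  \<comment> \<open>\<open>x\<close> is centred, so the mean of the kept part is that of the
    discarded part with opposite sign, and Jensen bounds its square.\<close>
  have "m = - (\<integral>\<omega>. w \<omega> \<partial>M)"
    using mean iz iw by (simp add: xzw(1) m_def)
  then have "m\<^sup>2 \<le> (\<integral>\<omega>. (w \<omega>)\<^sup>2 \<partial>M)"
    using square_integral_le[OF iw iw2] by simp
  then have m2: "m\<^sup>2 \<le> \<tau>" using w2 by simp
  have v_ge: "v \<ge> 1 / 2" unfolding v_def using Ez2 w2 m2 \<tau> by linarith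
  have w0: "0 \<le> (\<integral>\<omega>. (w \<omega>)\<^sup>2 \<partial>M)" by simp
  have v_le: "v \<le> 1" using Ez2 w0 zero_le_power2[of m] unfolding v_def by linarith
  have sv1: "1 / 2 \<le> sqrt v"
    by (rule real_le_rsqrt) (use v_ge in \<open>simp add: power2_eq_square\<close>)
  have sv: "sqrt v \<le> 1" "(sqrt v)\<^sup>2 = v" "sqrt v > 0"
    using v_ge v_le by auto
  have mb: "\<bar>m\<bar> \<le> K" unfolding m_def by (rule abs_integral_le_bound[OF zb])
  show "\<bar>centered_trunc K m v t\<bar> \<le> 4 * K" for t
  proof -
    have "\<bar>t * of_bool (\<bar>t\<bar> \<le> K)\<bar> \<le> K" using K by (simp add: of_bool_def)
    then have "\<bar>t * of_bool (\<bar>t\<bar> \<le> K) - m\<bar> \<le> 2 * K" using mb by linarith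
    moreover have "4 * K * (1 / 2) \<le> 4 * K * sqrt v" using sv1 K by (intro mult_left_mono) auto
    ultimately have "\<bar>t * of_bool (\<bar>t\<bar> \<le> K) - m\<bar> \<le> 4 * K * sqrt v" by linarith
    then show ?thesis using sv by (simp add: centered_trunc_def abs_divide divide_le_eq)
  qed
  have y_eq: "y \<omega> = (z \<omega> - m) / sqrt v" for \<omega> by (simp add: y_def centered_trunc_def z_def)
  show "(\<integral>\<omega>. y \<omega> \<partial>M) = 0" unfolding y_eq using iz by (simp add: m_def prob_space)
  have Ey2: "(\<integral>\<omega>. (y \<omega>)\<^sup>2 \<partial>M) = 1"
  proof -
    have "(\<integral>\<omega>. (y \<omega>)\<^sup>2 \<partial>M) = (\<integral>\<omega>. (z \<omega> - m)\<^sup>2 \<partial>M) / v"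
      unfolding y_eq power_divide sv(2) by simp
    also have "(\<integral>\<omega>. (z \<omega> - m)\<^sup>2 \<partial>M) = v"
      unfolding v_def m_def by (rule variance_eq[OF iz iz2])
    finally show ?thesis using v_ge by simp
  qed
  then show "(\<integral>\<omega>. (y \<omega>)\<^sup>2 \<partial>M) = 1" .
  \<comment> \<open>A non-integrable function would have integral 0, not 1.\<close>
  have iy2: "integrable M (\<lambda>\<omega>. (y \<omega>)\<^sup>2)"
    using Ey2 not_integrable_integral_eq by force
  have xy: "x \<omega> * y \<omega> = ((z \<omega>)\<^sup>2 - m * x \<omega>) / sqrt v" for \<omega>
    unfolding y_eq xzw(3)[symmetric] by (simp add: algebra_simps)
  have ixy: "integrable M (\<lambda>\<omega>. x \<omega> * y \<omega>)" unfolding xy using iz2 int(1) by simp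
  have Exy: "(\<integral>\<omega>. x \<omega> * y \<omega> \<partial>M) = (\<integral>\<omega>. (z \<omega>)\<^sup>2 \<partial>M) / sqrt v"
    unfolding xy using iz2 int(1) mean by simp
  have sq: "(x \<omega> - y \<omega>)\<^sup>2 = (x \<omega>)\<^sup>2 + (y \<omega>)\<^sup>2 - 2 * (x \<omega> * y \<omega>)" for \<omega>
    by (simp add: power2_diff)
  show "integrable M (\<lambda>\<omega>. (x \<omega> - y \<omega>)\<^sup>2)" unfolding sq using int(2) iy2 ixy by simp
  have "(\<integral>\<omega>. (x \<omega> - y \<omega>)\<^sup>2 \<partial>M) = 2 - 2 * ((\<integral>\<omega>. (z \<omega>)\<^sup>2 \<partial>M) / sqrt v)"
    unfolding sq using int(2) iy2 ixy by (simp add: var Ey2 Exy)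
  moreover have "(\<integral>\<omega>. (z \<omega>)\<^sup>2 \<partial>M) \<le> (\<integral>\<omega>. (z \<omega>)\<^sup>2 \<partial>M) / sqrt v"
    using sv by (simp add: le_divide_eq mult_left_le)
  ultimately show "(\<integral>\<omega>. (x \<omega> - y \<omega>)\<^sup>2 \<partial>M) \<le> 2 * \<tau>" using Ez2 w2 by linarith
qed

text \<open>Both series are dominated by C/(i + 1)^2, the first one through Chebyshev's inequality.
  In the application \<open>W\<close> is itself a square, so that fourth moments of the inputs
  enter.\<close>

lemma summable_tail_of_second_moment:
  fixes W :: "nat \<Rightarrow> 'a \<Rightarrow> real"
  assumes "prob_space M" and Wm: "\<And>i. W i \<in> borel_measurable M"
    and nonneg: "\<And>i \<omega>. 0 \<le> W i \<omega>"
    and int: "\<And>i. integrable M (\<lambda>\<omega>. (W i \<omega>)\<^sup>2)" and C: "\<And>i. (\<integral>\<omega>. (W i \<omega>)\<^sup>2 \<partial>M) \<le> C"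
  shows "summable (\<lambda>i. \<integral>\<omega>. (of_bool (real i + 1 < W i \<omega>) :: real) \<partial>M)"
    and "summable (\<lambda>i. (\<integral>\<omega>. (W i \<omega> * of_bool (W i \<omega> \<le> real i + 1))\<^sup>2 \<partial>M) / (real i + 1)\<^sup>2)"
proof -
  interpret prob_space M by fact
  note Wm[measurable]
  have "summable (\<lambda>i. inverse (real (Suc i) ^ 2))"
    by (subst summable_Suc_iff) (simp add: inverse_power_summable)
  then have sm: "summable (\<lambda>i. C / (real i + 1)\<^sup>2)"
    using summable_mult[of _ C] by (simp add: divide_inverse add.commute)
  have b1: "(\<integral>\<omega>. (of_bool (real i + 1 < W i \<omega>) :: real) \<partial>M) \<le> C / (real i + 1)\<^sup>2" for i
  proof -
    have "(\<integral>\<omega>. (of_bool (real i + 1 < W i \<omega>) :: real) \<partial>M) \<le> (\<integral>\<omega>. (W i \<omega>)\<^sup>2 / (real i + 1)\<^sup>2 \<partial>M)"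
    proof (rule integral_mono)
      show "integrable M (\<lambda>\<omega>. of_bool (real i + 1 < W i \<omega>) :: real)"
        by (rule integrable_real_bounded[of _ 1]) auto
      show "integrable M (\<lambda>\<omega>. (W i \<omega>)\<^sup>2 / (real i + 1)\<^sup>2)" using int by simp
      show "(of_bool (real i + 1 < W i \<omega>) :: real) \<le> (W i \<omega>)\<^sup>2 / (real i + 1)\<^sup>2" for \<omega>
        by (auto simp: of_bool_def le_divide_eq power_mono)
    qed
    also have "\<dots> \<le> C / (real i + 1)\<^sup>2" using C[of i] by (simp add: divide_right_mono)
    finally show ?thesis .
  qed
  show "summable (\<lambda>i. \<integral>\<omega>. (of_bool (real i + 1 < W i \<omega>) :: real) \<partial>M)"
    by (rule summable_comparison_test'[OF sm, of 0]) (use b1 in simp)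
  have b2: "(\<integral>\<omega>. (W i \<omega> * of_bool (W i \<omega> \<le> real i + 1))\<^sup>2 \<partial>M) \<le> C" for i
  proof -
    have "(\<integral>\<omega>. (W i \<omega> * of_bool (W i \<omega> \<le> real i + 1))\<^sup>2 \<partial>M) \<le> (\<integral>\<omega>. (W i \<omega>)\<^sup>2 \<partial>M)"
    proof (rule integral_mono)
      show "integrable M (\<lambda>\<omega>. (W i \<omega> * of_bool (W i \<omega> \<le> real i + 1))\<^sup>2)"
        by (rule integrable_real_bounded[of _ "(real i + 1)\<^sup>2"])
          (use nonneg in \<open>auto simp: of_bool_def power_mono\<close>)
    qed (use int in \<open>auto simp: of_bool_def\<close>)
    with C[of i] show ?thesis by simp
  qed
  show "summable (\<lambda>i. (\<integral>\<omega>. (W i \<omega> * of_bool (W i \<omega> \<le> real i + 1))\<^sup>2 \<partial>M) / (real i + 1)\<^sup>2)"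
    by (rule summable_comparison_test'[OF sm, of 0]) (use b2 in \<open>simp add: divide_right_mono\<close>)
qed

text \<open>The pointwise form of the bound of the sum of tail probabilities by the mean. The
  induction needs the stronger bound \<open>min n w\<close>.\<close>

lemma sum_tail_indicator_le:
  fixes w :: real
  assumes "w \<ge> 0"
  shows "(\<Sum>i<n. of_bool (real i + 1 < w)) \<le> w"
proof -
  have "(\<Sum>i<n. of_bool (real i + 1 < w) :: real) \<le> min (real n) w"
  proof (induction n)
    case (Suc n)
    then show ?case by (cases "real n + 1 < w") simp_all
  qed (use assms in simp)
  then show ?thesis by simp
qed

text \<open>A discrete form of w^2 times the integral of 1/t^2 beyond w. The induction carries the
  telescoping value 2/w - 2/(n + 1), where 1/N^2 \<le> 2/N - 2/(N + 1) holds because N \<ge>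
  1.\<close>

lemma sum_truncated_squares_le:
  fixes w :: real
  assumes "w \<ge> 0"
  shows "(\<Sum>i<n. (w * of_bool (w \<le> real i + 1))\<^sup>2 / (real i + 1)\<^sup>2) \<le> 2 * w"
proof (cases "w = 0")
  case False
  then have w: "w > 0" using assms by simp
  have "(\<Sum>i<n. of_bool (w \<le> real i + 1) / (real i + 1)\<^sup>2)
      \<le> (if w \<le> real n then 2 / w - 2 / (real n + 1) else 0)"
  proof (induction n)
    case (Suc n)
    define N where "N = real n + 1"
    have N: "N \<ge> 1" by (simp add: N_def)
    have key: "1 / N\<^sup>2 \<le> 2 / N - 2 / (N + 1)"
    proof -
      have "2 / N - 2 / (N + 1) = 2 / (N * (N + 1))" using N by (simp add: field_simps)
      moreover have "N * (N + 1) \<le> 2 * N\<^sup>2" using N by (simp add: power2_eq_square algebra_simps)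
      then have "2 / (2 * N\<^sup>2) \<le> 2 / (N * (N + 1))"
        using N by (intro divide_left_mono mult_pos_pos) auto
      ultimately show ?thesis by simp
    qed
    consider "w \<le> real n" | "real n < w" "w \<le> N" | "N < w" by linarith
    then show ?case
    proof cases
      case 1
      then show ?thesis using Suc key by (simp add: N_def add.commute)
    next
      case 2
      have "2 / N \<le> 2 / w" using 2(2) w by (intro divide_left_mono) (auto simp: N_def)
      then show ?thesis using Suc key 2 by (simp add: N_def add.commute)
    next
      case 3
      then show ?thesis using Suc by (simp add: N_def)
    qed
  qed (use w in simp)
  also have "\<dots> \<le> 2 / w" using w by simp
  finally have "w\<^sup>2 * (\<Sum>i<n. of_bool (w \<le> real i + 1) / (real i + 1)\<^sup>2) \<le> w\<^sup>2 * (2 / w)"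
    by (rule mult_left_mono) simp
  also have "w\<^sup>2 * (2 / w) = 2 * w" using w by (simp add: power2_eq_square)
  also have "w\<^sup>2 * (\<Sum>i<n. of_bool (w \<le> real i + 1) / (real i + 1)\<^sup>2)
      = (\<Sum>i<n. (w * of_bool (w \<le> real i + 1))\<^sup>2 / (real i + 1)\<^sup>2)"
    unfolding sum_distrib_left by (intro sum.cong refl) (simp add: of_bool_def power_mult_distrib)
  finally show ?thesis .
qed simp

text \<open>With identical laws every term can be written in \<open>W 0\<close>; exchanging sum and
  expectation then bounds both series by multiples of the mean, so that first moments of
  \<open>W\<close> suffice.\<close>

lemma summable_tail_of_identical:
  fixes W :: "nat \<Rightarrow> 'a \<Rightarrow> real"
  assumes "prob_space M" and Wm: "\<And>i. W i \<in> borel_measurable M"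
    and nonneg: "\<And>i \<omega>. 0 \<le> W i \<omega>" and int: "integrable M (W 0)"
    and same: "\<And>i (f :: real \<Rightarrow> real). f \<in> borel_measurable borel \<Longrightarrow>
      (\<integral>\<omega>. f (W i \<omega>) \<partial>M) = (\<integral>\<omega>. f (W 0 \<omega>) \<partial>M)"
  shows "summable (\<lambda>i. \<integral>\<omega>. (of_bool (real i + 1 < W i \<omega>) :: real) \<partial>M)"
    and "summable (\<lambda>i. (\<integral>\<omega>. (W i \<omega> * of_bool (W i \<omega> \<le> real i + 1))\<^sup>2 \<partial>M) / (real i + 1)\<^sup>2)"
proof -
  interpret prob_space M by fact
  note Wm[measurable]
  have E1: "(\<integral>\<omega>. (of_bool (real i + 1 < W i \<omega>) :: real) \<partial>M) = (\<integral>\<omega>. of_bool (real i + 1 < W 0 \<omega>) \<partial>M)" for i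
    by (rule same[of "\<lambda>y. of_bool (real i + 1 < y)"]) measurable
  have i1: "integrable M (\<lambda>\<omega>. of_bool (real i + 1 < W 0 \<omega>) :: real)" for i
    by (rule integrable_real_bounded[of _ 1]) auto
  show "summable (\<lambda>i. \<integral>\<omega>. (of_bool (real i + 1 < W i \<omega>) :: real) \<partial>M)"
  proof (rule summableI_nonneg_bounded)
    fix n
    have "(\<Sum>i<n. \<integral>\<omega>. (of_bool (real i + 1 < W i \<omega>) :: real) \<partial>M)
        = (\<integral>\<omega>. (\<Sum>i<n. of_bool (real i + 1 < W 0 \<omega>)) \<partial>M)"
      unfolding E1 by (rule Bochner_Integration.integral_sum[symmetric]) (rule i1)
    also have "\<dots> \<le> (\<integral>\<omega>. W 0 \<omega> \<partial>M)"
      by (intro integral_mono Bochner_Integration.integrable_sum i1 int sum_tail_indicator_le nonneg)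
    finally show "(\<Sum>i<n. \<integral>\<omega>. (of_bool (real i + 1 < W i \<omega>) :: real) \<partial>M) \<le> (\<integral>\<omega>. W 0 \<omega> \<partial>M)" .
  qed simp
  have E2: "(\<integral>\<omega>. (W i \<omega> * of_bool (W i \<omega> \<le> real i + 1))\<^sup>2 \<partial>M) / (real i + 1)\<^sup>2
      = (\<integral>\<omega>. (W 0 \<omega> * of_bool (W 0 \<omega> \<le> real i + 1))\<^sup>2 / (real i + 1)\<^sup>2 \<partial>M)" for i
    using same[of "\<lambda>y. (y * of_bool (y \<le> real i + 1))\<^sup>2" i] by simp
  have i2: "integrable M (\<lambda>\<omega>. (W 0 \<omega> * of_bool (W 0 \<omega> \<le> real i + 1))\<^sup>2 / (real i + 1)\<^sup>2)" for i
    by (intro integrable_divide integrable_real_bounded[of _ "(real i + 1)\<^sup>2"])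
      (use nonneg in \<open>auto simp: of_bool_def power_mono\<close>)
  show "summable (\<lambda>i. (\<integral>\<omega>. (W i \<omega> * of_bool (W i \<omega> \<le> real i + 1))\<^sup>2 \<partial>M) / (real i + 1)\<^sup>2)"
  proof (rule summableI_nonneg_bounded)
    fix n
    have "(\<Sum>i<n. (\<integral>\<omega>. (W i \<omega> * of_bool (W i \<omega> \<le> real i + 1))\<^sup>2 \<partial>M) / (real i + 1)\<^sup>2)
        = (\<integral>\<omega>. (\<Sum>i<n. (W 0 \<omega> * of_bool (W 0 \<omega> \<le> real i + 1))\<^sup>2 / (real i + 1)\<^sup>2) \<partial>M)"
      unfolding E2 by (rule Bochner_Integration.integral_sum[symmetric]) (rule i2)
    also have "\<dots> \<le> (\<integral>\<omega>. 2 * W 0 \<omega> \<partial>M)"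
      by (intro integral_mono Bochner_Integration.integrable_sum i2 integrable_mult_right int
          sum_truncated_squares_le nonneg)
    finally show "(\<Sum>i<n. (\<integral>\<omega>. (W i \<omega> * of_bool (W i \<omega> \<le> real i + 1))\<^sup>2 \<partial>M) / (real i + 1)\<^sup>2)
      \<le> (\<integral>\<omega>. 2 * W 0 \<omega> \<partial>M)" .
  qed simp
qed

section \<open>The three input assumptions and the reduction to bounded inputs\<close>

lemma std_inputD:
  assumes "std_input P x"
  shows "prob_space P" "prob_space.indep_vars P (\<lambda>_. borel) x UNIV"
    "x i \<in> borel_measurable P" "integrable P (x i)" "integrable P (\<lambda>\<omega>. (x i \<omega>)\<^sup>2)"
    "(\<integral>\<omega>. x i \<omega> \<partial>P) = 0" "(\<integral>\<omega>. (x i \<omega>)\<^sup>2 \<partial>P) = 1"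
proof -
  interpret prob_space P using assms by (simp add: std_input_def)
  show "prob_space P" by (rule prob_space_axioms)
  show ind: "indep_vars (\<lambda>_. borel) x UNIV" using assms by (simp add: std_input_def)
  then show "x i \<in> borel_measurable P" by (simp add: indep_vars_def)
  show "integrable P (x i)" "integrable P (\<lambda>\<omega>. (x i \<omega>)\<^sup>2)" and m: "(\<integral>\<omega>. x i \<omega> \<partial>P) = 0"
    using assms by (simp_all add: std_input_def)
  have "variance (x i) = 1" using assms unfolding std_input_def by blast
  then show "(\<integral>\<omega>. (x i \<omega>)\<^sup>2 \<partial>P) = 1" by (simp add: m)
qed

lemma input_A1_imp_A3:
  assumes "input_A1 P x"
  shows "input_A3 P x"
proof -
  have std: "std_input P x" using assms by (simp add: input_A1_def)
  interpret prob_space P by (rule std_inputD(1)[OF std])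
  note [measurable] = std_inputD(3)[OF std]
  obtain B where B: "\<And>i. AE \<omega> in P. \<bar>x i \<omega>\<bar> \<le> B"
    using assms by (auto simp: input_A1_def)
  have "integrable P (\<lambda>\<omega>. \<bar>x i \<omega>\<bar> ^ k) \<and> (\<integral>\<omega>. \<bar>x i \<omega>\<bar> ^ k \<partial>P) \<le> B ^ k" for i k
  proof -
    have ae: "AE \<omega> in P. \<bar>x i \<omega>\<bar> ^ k \<le> B ^ k"
      using B[of i] by eventually_elim (auto intro: power_mono)
    have i: "integrable P (\<lambda>\<omega>. \<bar>x i \<omega>\<bar> ^ k)"
      by (rule integrable_const_bound[of _ "B ^ k"]) (use ae in auto)
    have "(\<integral>\<omega>. \<bar>x i \<omega>\<bar> ^ k \<partial>P) \<le> (\<integral>\<omega>. B ^ k \<partial>P)"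
      by (rule integral_mono_AE[OF i _ ae]) simp
    with i show ?thesis by (simp add: prob_space)
  qed
  with std show ?thesis unfolding input_A3_def by blast
qed

lemma (in prob_space) expectation_of_same_distr:
  fixes f :: "real \<Rightarrow> real"
  assumes "distr M borel X = distr M borel Y" "X \<in> borel_measurable M" "Y \<in> borel_measurable M"
    and f: "f \<in> borel_measurable borel"
  shows "(\<integral>\<omega>. f (X \<omega>) \<partial>M) = (\<integral>\<omega>. f (Y \<omega>) \<partial>M)"
  using integral_distr[OF assms(2) f] integral_distr[OF assms(3) f] assms(1) by simp

text \<open>Uniform integrability of the squares: dominated convergence for one variable in the
  identically distributed case, a Chebyshev argument with fourth moments otherwise.\<close>

lemma input_square_tail:
  assumes inp: "input_A2 P x \<or> input_A3 P x" and \<epsilon>: "\<epsilon> > 0"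
  obtains K where "K > 0"
    "\<And>i. (\<integral>\<omega>. (x i \<omega>)\<^sup>2 * of_bool (K < \<bar>x i \<omega>\<bar>) \<partial>P) \<le> \<epsilon>"
proof -
  have std: "std_input P x" using inp by (auto simp: input_A2_def input_A3_def)
  interpret prob_space P by (rule std_inputD(1)[OF std])
  note xm[measurable] = std_inputD(3)[OF std]
  note int2 = std_inputD(5)[OF std]
  show ?thesis
    using inp
  proof
    assume A2: "input_A2 P x"
    have lim: "(\<lambda>K. \<integral>\<omega>. (x 0 \<omega>)\<^sup>2 * of_bool (real K < \<bar>x 0 \<omega>\<bar>) \<partial>P) \<longlonglongrightarrow> (\<integral>\<omega>. 0 \<partial>P)"
    proof (rule integral_dominated_convergence[where w = "\<lambda>\<omega>. (x 0 \<omega>)\<^sup>2"])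
      show "AE \<omega> in P. (\<lambda>K. (x 0 \<omega>)\<^sup>2 * of_bool (real K < \<bar>x 0 \<omega>\<bar>)) \<longlonglongrightarrow> 0"
      proof (intro AE_I2 tendsto_eventually)
        fix \<omega>
        have "\<forall>\<^sub>F K in sequentially. \<bar>x 0 \<omega>\<bar> \<le> real K"
          by (rule filterlim_real_sequentially[THEN filterlim_at_top[THEN iffD1], rule_format])
        then show "\<forall>\<^sub>F K in sequentially. (x 0 \<omega>)\<^sup>2 * of_bool (real K < \<bar>x 0 \<omega>\<bar>) = 0"
          by eventually_elim simp
      qed
      show "AE \<omega> in P. norm ((x 0 \<omega>)\<^sup>2 * of_bool (real K < \<bar>x 0 \<omega>\<bar>)) \<le> (x 0 \<omega>)\<^sup>2" for K
        by (simp add: of_bool_def)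
    qed (use int2 in \<open>simp_all, measurable\<close>)
    have "\<forall>\<^sub>F K in sequentially. (\<integral>\<omega>. (x 0 \<omega>)\<^sup>2 * of_bool (real K < \<bar>x 0 \<omega>\<bar>) \<partial>P) < \<epsilon>"
      by (rule order_tendstoD(2)[OF lim]) (use \<epsilon> in simp)
    then have "\<forall>\<^sub>F K in sequentially. (\<integral>\<omega>. (x 0 \<omega>)\<^sup>2 * of_bool (real K < \<bar>x 0 \<omega>\<bar>) \<partial>P) < \<epsilon> \<and> K > 0"
      using eventually_gt_at_top[of 0] by (rule eventually_conj)
    then obtain K :: nat where K: "(\<integral>\<omega>. (x 0 \<omega>)\<^sup>2 * of_bool (real K < \<bar>x 0 \<omega>\<bar>) \<partial>P) < \<epsilon>" "K > 0"
      using eventually_happens'[OF sequentially_bot] by blast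
    have "(\<integral>\<omega>. (x i \<omega>)\<^sup>2 * of_bool (real K < \<bar>x i \<omega>\<bar>) \<partial>P) \<le> \<epsilon>" for i
    proof -
      have d: "distr P borel (x i) = distr P borel (x 0)" using A2 by (simp add: input_A2_def)
      have "(\<integral>\<omega>. (x i \<omega>)\<^sup>2 * of_bool (real K < \<bar>x i \<omega>\<bar>) \<partial>P)
          = (\<integral>\<omega>. (x 0 \<omega>)\<^sup>2 * of_bool (real K < \<bar>x 0 \<omega>\<bar>) \<partial>P)"
        by (rule expectation_of_same_distr[OF d xm xm, of "\<lambda>y. y\<^sup>2 * of_bool (real K < \<bar>y\<bar>)"]) measurable
      with K(1) show ?thesis by simp
    qed
    with K(2) show ?thesis by (intro that[of "real K"]) auto
  next
    assume A3: "input_A3 P x"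
    then obtain C where C: "\<And>i. integrable P (\<lambda>\<omega>. \<bar>x i \<omega>\<bar> ^ 4)" "\<And>i. (\<integral>\<omega>. \<bar>x i \<omega>\<bar> ^ 4 \<partial>P) \<le> C"
      unfolding input_A3_def by blast
    have "0 \<le> (\<integral>\<omega>. \<bar>x 0 \<omega>\<bar> ^ 4 \<partial>P)" by simp
    then have C0: "C \<ge> 0" using C(2)[of 0] by linarith
    \<comment> \<open>The summand 1 keeps \<open>K\<close> positive even if
      \<open>C = 0\<close>.\<close>
    define K where "K = sqrt (C / \<epsilon> + 1)"
    have K: "K > 0" "K\<^sup>2 = C / \<epsilon> + 1" using C0 \<epsilon> by (auto simp: K_def add_nonneg_pos)
    have "(\<integral>\<omega>. (x i \<omega>)\<^sup>2 * of_bool (K < \<bar>x i \<omega>\<bar>) \<partial>P) \<le> \<epsilon>" for i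
    proof -
      have "(\<integral>\<omega>. (x i \<omega>)\<^sup>2 * of_bool (K < \<bar>x i \<omega>\<bar>) \<partial>P) \<le> (\<integral>\<omega>. \<bar>x i \<omega>\<bar> ^ 4 / K\<^sup>2 \<partial>P)"
      proof (rule integral_mono)
        show "integrable P (\<lambda>\<omega>. (x i \<omega>)\<^sup>2 * of_bool (K < \<bar>x i \<omega>\<bar>))"
          by (rule Bochner_Integration.integrable_bound[OF int2[of i]]) (auto simp: of_bool_def)
        show "integrable P (\<lambda>\<omega>. \<bar>x i \<omega>\<bar> ^ 4 / K\<^sup>2)" using C(1)[of i] by simp
        fix \<omega>
        show "(x i \<omega>)\<^sup>2 * of_bool (K < \<bar>x i \<omega>\<bar>) \<le> \<bar>x i \<omega>\<bar> ^ 4 / K\<^sup>2"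
        proof (cases "K < \<bar>x i \<omega>\<bar>")
          case True
          then have "K\<^sup>2 \<le> \<bar>x i \<omega>\<bar>\<^sup>2" using K by (intro power_mono) auto
          then have "(x i \<omega>)\<^sup>2 * K\<^sup>2 \<le> (x i \<omega>)\<^sup>2 * (x i \<omega>)\<^sup>2" by (intro mult_left_mono) auto
          also have "\<dots> = \<bar>x i \<omega>\<bar> ^ 4" by (simp flip: power_add)
          moreover have "K\<^sup>2 > 0" using K(1) by simp
          ultimately show ?thesis using True by (simp add: pos_le_divide_eq del: power_abs zero_less_power2)
        qed simp
      qed
      also have "\<dots> \<le> C / K\<^sup>2" using C(2)[of i] by (simp add: divide_right_mono)
      also have "\<dots> \<le> \<epsilon>"
      proof -
        have "C \<le> \<epsilon> * K\<^sup>2" unfolding K(2) using \<epsilon> by (simp add: distrib_left)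
        moreover have "K\<^sup>2 > 0" using K(1) by simp
        ultimately show ?thesis by (simp add: pos_divide_le_eq del: zero_less_power2)
      qed
      finally show ?thesis .
    qed
    with K(1) show ?thesis by (rule that)
  qed
qed

text \<open>The squared truncation errors are independent with small means, so the one-sided law of
  large numbers makes their averages small almost surely. The functions \<open>g i\<close> may
  depend on \<open>i\<close>, as the laws do under (A3).\<close>

lemma input_truncation:
  assumes inp: "input_A2 P x \<or> input_A3 P x" and \<epsilon>: "0 < \<epsilon>" "\<epsilon> \<le> 1"
  obtains B g where "\<And>i. g i \<in> borel_measurable borel" "\<And>i t. \<bar>g i t\<bar> \<le> B"
    "\<And>i. (\<integral>\<omega>. g i (x i \<omega>) \<partial>P) = 0" "\<And>i. (\<integral>\<omega>. (g i (x i \<omega>))\<^sup>2 \<partial>P) = 1"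
    "AE \<omega> in P. \<forall>\<^sub>F n in sequentially. (\<Sum>i<n. (x i \<omega> - g i (x i \<omega>))\<^sup>2) / real n \<le> \<epsilon>"
proof -
  have std: "std_input P x" using inp by (auto simp: input_A2_def input_A3_def)
  interpret prob_space P by (rule std_inputD(1)[OF std])
  note xm[measurable] = std_inputD(3)[OF std]
  \<comment> \<open>Means are at most \<open>2 * \<tau>\<close> and the law of large numbers doubles
    them: \<open>4 * \<tau> = \<epsilon> / 2\<close> leaves \<open>\<epsilon> / 2\<close> for its
    slack.\<close>
  define \<tau> where "\<tau> = \<epsilon> / 8"
  have \<tau>: "0 < \<tau>" "\<tau> \<le> 1 / 4" using \<epsilon> by (auto simp: \<tau>_def)
  obtain K where K: "K > 0" "\<And>i. (\<integral>\<omega>. (x i \<omega>)\<^sup>2 * of_bool (K < \<bar>x i \<omega>\<bar>) \<partial>P) \<le> \<tau>"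
    using input_square_tail[OF inp \<tau>(1)] by blast
  define m where "m i = (\<integral>\<omega>. x i \<omega> * of_bool (\<bar>x i \<omega>\<bar> \<le> K) \<partial>P)" for i
  define v where "v i = (\<integral>\<omega>. (x i \<omega> * of_bool (\<bar>x i \<omega>\<bar> \<le> K))\<^sup>2 \<partial>P) - (m i)\<^sup>2" for i
  define g where "g i = centered_trunc K (m i) (v i)" for i
  note props = centered_trunc_props[OF xm std_inputD(4,5,6,7)[OF std] K(1) \<tau>(2) K(2), folded m_def, folded v_def, folded g_def]
  have gm[measurable]: "g i \<in> borel_measurable borel" for i unfolding g_def by measurable
  define W where "W i \<omega> = (x i \<omega> - g i (x i \<omega>))\<^sup>2" for i \<omega>
  have Wm: "W i \<in> borel_measurable P" for i unfolding W_def by measurable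
  have W0: "0 \<le> W i \<omega>" for i \<omega> by (simp add: W_def)
  have Wi: "integrable P (W i)" for i unfolding W_def by (rule props(4))
  have indepW: "indep_vars (\<lambda>_. borel) W UNIV"
    unfolding W_def
    by (rule indep_vars_compose2[OF std_inputD(2)[OF std], of "\<lambda>i t. (t - g i t)\<^sup>2"]) measurable
  have EW: "(\<integral>\<omega>. W i \<omega> \<partial>P) \<le> 2 * \<tau>" for i unfolding W_def by (rule props(5))
  have tails: "summable (\<lambda>i. \<integral>\<omega>. (of_bool (real i + 1 < W i \<omega>) :: real) \<partial>P) \<and>
    summable (\<lambda>i. (\<integral>\<omega>. (W i \<omega> * of_bool (W i \<omega> \<le> real i + 1))\<^sup>2 \<partial>P) / (real i + 1)\<^sup>2)"
    using inp
  proof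
    assume A2: "input_A2 P x"
    have d: "distr P borel (x i) = distr P borel (x 0)" for i
      using A2 by (simp add: input_A2_def)
    have mi: "m i = m 0" for i
      unfolding m_def
      by (rule expectation_of_same_distr[OF d xm xm, of "\<lambda>y. y * of_bool (\<bar>y\<bar> \<le> K)"]) measurable
    have vi: "v i = v 0" for i
      unfolding v_def mi[of i]
      by (rule arg_cong2[where f = minus,
            OF expectation_of_same_distr[OF d xm xm, of "\<lambda>y. (y * of_bool (\<bar>y\<bar> \<le> K))\<^sup>2"] refl]) measurable
    \<comment> \<open>A common truncation function is what makes the errors \<open>W i\<close>
      identically distributed.\<close>
    have gi: "g i = g 0" for i by (simp add: g_def mi[of i] vi[of i])
    have same: "(\<integral>\<omega>. f (W i \<omega>) \<partial>P) = (\<integral>\<omega>. f (W 0 \<omega>) \<partial>P)"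
      if [measurable]: "f \<in> borel_measurable borel" for i and f :: "real \<Rightarrow> real"
      unfolding W_def gi[of i]
      by (rule expectation_of_same_distr[OF d xm xm, of "\<lambda>t. f ((t - g 0 t)\<^sup>2)"]) measurable
    show ?thesis
      using summable_tail_of_identical[of P W, OF prob_space_axioms Wm W0 Wi same] by blast
  next
    assume A3: "input_A3 P x"
    then obtain C where C: "\<And>i. integrable P (\<lambda>\<omega>. \<bar>x i \<omega>\<bar> ^ 4)" "\<And>i. (\<integral>\<omega>. \<bar>x i \<omega>\<bar> ^ 4 \<partial>P) \<le> C"
      unfolding input_A3_def by blast
    define b where "b = 8 * (4 * K) ^ 4"
    have W2: "(W i \<omega>)\<^sup>2 \<le> 8 * \<bar>x i \<omega>\<bar> ^ 4 + b" for i \<omega>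
    proof -
      define u t where "u = x i \<omega>" and "t = g i (x i \<omega>)"
      have sq2: "(p - q)\<^sup>2 \<le> 2 * p\<^sup>2 + 2 * q\<^sup>2" "(p + q)\<^sup>2 \<le> 2 * p\<^sup>2 + 2 * q\<^sup>2" for p q :: real
        using zero_le_power2[of "p + q"] zero_le_power2[of "p - q"] by (simp_all add: power2_sum power2_diff)
      have "((u - t)\<^sup>2)\<^sup>2 \<le> (2 * u\<^sup>2 + 2 * t\<^sup>2)\<^sup>2" by (intro power_mono sq2) simp
      also have "\<dots> \<le> 2 * (2 * u\<^sup>2)\<^sup>2 + 2 * (2 * t\<^sup>2)\<^sup>2" by (rule sq2)
      also have "\<dots> = 8 * \<bar>u\<bar> ^ 4 + 8 * \<bar>t\<bar> ^ 4" by (simp add: power_mult_distrib flip: power_mult)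
      also have "\<bar>t\<bar> ^ 4 \<le> (4 * K) ^ 4" unfolding t_def by (intro power_mono props(1)) simp
      finally show ?thesis by (simp add: W_def u_def t_def b_def)
    qed
    have ib: "integrable P (\<lambda>\<omega>. 8 * \<bar>x i \<omega>\<bar> ^ 4 + b)" for i using C(1)[of i] by simp
    have iW2: "integrable P (\<lambda>\<omega>. (W i \<omega>)\<^sup>2)" for i
    proof (rule Bochner_Integration.integrable_bound[OF ib])
      show "(\<lambda>\<omega>. (W i \<omega>)\<^sup>2) \<in> borel_measurable P" using Wm[of i] by measurable
      show "AE \<omega> in P. norm ((W i \<omega>)\<^sup>2) \<le> norm (8 * \<bar>x i \<omega>\<bar> ^ 4 + b)"
      proof (rule AE_I2)
        fix \<omega>
        have "0 \<le> 8 * \<bar>x i \<omega>\<bar> ^ 4 + b" by (simp add: b_def)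
        then show "norm ((W i \<omega>)\<^sup>2) \<le> norm (8 * \<bar>x i \<omega>\<bar> ^ 4 + b)"
          using W2[of i \<omega>] by simp
      qed
    qed
    have EW2: "(\<integral>\<omega>. (W i \<omega>)\<^sup>2 \<partial>P) \<le> 8 * C + b" for i
    proof -
      have "(\<integral>\<omega>. (W i \<omega>)\<^sup>2 \<partial>P) \<le> (\<integral>\<omega>. 8 * \<bar>x i \<omega>\<bar> ^ 4 + b \<partial>P)"
        by (intro integral_mono iW2 ib W2)
      also have "\<dots> \<le> 8 * C + b" using C(1)[of i] C(2)[of i] by (simp add: prob_space)
      finally show ?thesis .
    qed
    show ?thesis
      using summable_tail_of_second_moment[of P W, OF prob_space_axioms Wm W0 iW2 EW2] by blast
  qed
  have "AE \<omega> in P. \<forall>\<^sub>F n in sequentially. (\<Sum>i<n. W i \<omega>) / real n \<le> 2 * (2 * \<tau>) + \<epsilon> / 2"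
    using tails \<epsilon> by (intro slln_upper_bound[OF indepW W0 Wi EW]) auto
  then have "AE \<omega> in P. \<forall>\<^sub>F n in sequentially. (\<Sum>i<n. (x i \<omega> - g i (x i \<omega>))\<^sup>2) / real n \<le> \<epsilon>"
    by (simp add: W_def \<tau>_def)
  then show ?thesis
    using that[of g "4 * K"] gm props(1,2,3) by blast
qed

text \<open>At truncation level 1/(M + 1) the Lipschitz bound costs
  \<open>2 * s * sqrt \<epsilon>\<close> and the convergence for bounded inputs another
  \<open>s * sqrt \<epsilon>\<close>. Countably many levels leave a single null set.\<close>

theorem G_tendsto:
  assumes inp: "input_A1 P x \<or> input_A2 P x \<or> input_A3 P x"
    and fs: "\<And>n. n > 0 \<Longrightarrow> fourier_system n (\<theta> n)"
    and s: "s \<ge> 1"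
  shows "AE \<omega> in P. (\<lambda>n. fourier_system.G n (\<theta> n) s (\<lambda>j. x j \<omega>)) \<longlonglongrightarrow> 1 / (1 + s)"
proof -
  have inp': "input_A2 P x \<or> input_A3 P x" using inp input_A1_imp_A3 by blast
  then have std: "std_input P x" by (auto simp: input_A2_def input_A3_def)
  interpret prob_space P by (rule std_inputD(1)[OF std])
  define g where "g n z = fourier_system.G n (\<theta> n) s z" for n z
  have approx: "AE \<omega> in P. \<forall>\<^sub>F n in sequentially. \<bar>g n (\<lambda>j. x j \<omega>) - 1 / (1 + s)\<bar> \<le> 3 * s / sqrt (real (Suc M))" for M
  proof -
    define \<epsilon> where "\<epsilon> = 1 / real (Suc M)"
    have \<epsilon>: "0 < \<epsilon>" "\<epsilon> \<le> 1" by (auto simp: \<epsilon>_def)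
    obtain B h where hm: "\<And>i. h i \<in> borel_measurable borel" and hb: "\<And>i t. \<bar>h i t\<bar> \<le> B"
      and h0: "\<And>i. (\<integral>\<omega>. h i (x i \<omega>) \<partial>P) = 0" and h1: "\<And>i. (\<integral>\<omega>. (h i (x i \<omega>))\<^sup>2 \<partial>P) = 1"
      and hW: "AE \<omega> in P. \<forall>\<^sub>F n in sequentially. (\<Sum>i<n. (x i \<omega> - h i (x i \<omega>))\<^sup>2) / real n \<le> \<epsilon>"
      by (rule input_truncation[OF inp' \<epsilon>]) (rule that)
    have "indep_vars (\<lambda>_. borel) (\<lambda>i \<omega>. h i (x i \<omega>)) UNIV"
      by (rule indep_vars_compose2[OF std_inputD(2)[OF std] hm])
    then have "AE \<omega> in P. (\<lambda>n. g n (\<lambda>j. h j (x j \<omega>))) \<longlonglongrightarrow> 1 / (1 + s)"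
      unfolding g_def by (intro bounded_G_tendsto[OF fs _ hb h0 h1 s])
    then show ?thesis
      using hW
    proof eventually_elim
      case (elim \<omega>)
      have pos: "s * sqrt \<epsilon> > 0" using s \<epsilon> by simp
      from elim(1) have "\<forall>\<^sub>F n in sequentially. \<bar>g n (\<lambda>j. h j (x j \<omega>)) - 1 / (1 + s)\<bar> < s * sqrt \<epsilon>"
        using pos unfolding tendsto_iff dist_real_def by blast
      then show ?case
        using elim(2) eventually_gt_at_top[of 0]
      proof eventually_elim
        case (elim n)
        interpret fourier_system n "\<theta> n" by (rule fs[OF elim(3)])
        have "\<bar>g n (\<lambda>j. x j \<omega>) - g n (\<lambda>j. h j (x j \<omega>))\<bar>
            \<le> 2 * s * sqrt ((\<Sum>i<n. (x i \<omega> - h i (x i \<omega>))\<^sup>2) / real n)"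
          unfolding g_def by (rule G_lipschitz[OF s])
        also have "\<dots> \<le> 2 * s * sqrt \<epsilon>"
          using elim(2) s by (intro mult_left_mono real_sqrt_le_mono) auto
        finally have "\<bar>g n (\<lambda>j. x j \<omega>) - 1 / (1 + s)\<bar> \<le> 3 * (s * sqrt \<epsilon>)"
          using elim(1) by linarith
        then show ?case by (simp add: \<epsilon>_def real_sqrt_divide)
      qed
    qed
  qed
  have "AE \<omega> in P. \<forall>M. \<forall>\<^sub>F n in sequentially. \<bar>g n (\<lambda>j. x j \<omega>) - 1 / (1 + s)\<bar> \<le> 3 * s / sqrt (real (Suc M))"
    unfolding AE_all_countable using approx by blast
  then show ?thesis
  proof eventually_elim
    case (elim \<omega>)
    have lim0: "(\<lambda>M. 3 * s / sqrt (real (Suc M))) \<longlonglongrightarrow> 0"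
      by (rule LIMSEQ_Suc, rule real_tendsto_divide_at_top[OF tendsto_const])
        (rule filterlim_compose[OF sqrt_at_top filterlim_real_sequentially])
    show ?case
      unfolding g_def[symmetric] tendsto_iff dist_real_def
    proof (intro allI impI)
      fix r :: real assume "r > 0"
      then have "\<forall>\<^sub>F M in sequentially. 3 * s / sqrt (real (Suc M)) < r"
        by (rule order_tendstoD(2)[OF lim0])
      then obtain M where M: "3 * s / sqrt (real (Suc M)) < r"
        using eventually_happens'[OF sequentially_bot] by blast
      from elim[rule_format, of M] show "\<forall>\<^sub>F n in sequentially. \<bar>g n (\<lambda>j. x j \<omega>) - 1 / (1 + s)\<bar> < r"
        by eventually_elim (use M in linarith)
    qed
  qed
qed

section \<open>The limiting spectral distribution\<close>

text \<open>The input \<open>x 0\<close> sits at position \<open>n\<close>, where the Fourier vector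
  equals \<open>(- 1) ^ e\<close>; in the skew case this is not its value at position 0.\<close>

definition shifted_fourier :: "nat \<Rightarrow> nat \<Rightarrow> nat \<Rightarrow> nat \<Rightarrow> complex" where
  "shifted_fourier e n k j = fourier n e k (if j = 0 then n else j)"

lemma sum_rotate:
  fixes g :: "nat \<Rightarrow> 'a :: comm_monoid_add"
  assumes "n > 0"
  shows "(\<Sum>j<n. g (if j = 0 then n else j)) = (\<Sum>l=1..n. g l)"
  by (rule sum.reindex_bij_witness[where i = "\<lambda>l. if l = n then 0 else l" and j = "\<lambda>j. if j = 0 then n else j"])
    (use assms in auto)

lemma fourier_system_shifted:
  assumes n: "n > 0" and e: "e \<le> 1"
  shows "fourier_system n (shifted_fourier e n)"
proof
  show "n > 0" by (rule n)
  show "cmod (shifted_fourier e n k j) = 1" for k j by (simp add: shifted_fourier_def)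
  show "(\<Sum>j<n. shifted_fourier e n k j * cnj (shifted_fourier e n k' j)) = (if k = k' then of_nat n else 0)"
    if "k < n" "k' < n" for k k'
    unfolding shifted_fourier_def
    using sum_rotate[OF n, of "\<lambda>l. fourier n e k l * cnj (fourier n e k' l)"] sum_fourier_cnj[OF that, of e]
    by simp
  show "card {k. k < n \<and> (\<Sum>j<n. (shifted_fourier e n k j)\<^sup>2) \<noteq> 0} \<le> 2"
  proof -
    have "(\<Sum>j<n. (shifted_fourier e n k j)\<^sup>2) = (if k = conj_index n e k then of_nat n else 0)" if "k < n" for k
      unfolding shifted_fourier_def power2_eq_square
      using sum_rotate[OF n, of "\<lambda>l. fourier n e k l * fourier n e k l"] sum_fourier_mult[OF e that that]
      by simp
    then have "{k. k < n \<and> (\<Sum>j<n. (shifted_fourier e n k j)\<^sup>2) \<noteq> 0} = {k. k < n \<and> conj_index n e k = k}"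
      using n by (auto split: if_splits)
    then show ?thesis using card_conj_index_fixed[OF e] by simp
  qed
  show "(\<Sum>k<n. shifted_fourier e n k j * cnj (shifted_fourier e n k j')) = (if j = j' then of_nat n else 0)"
    if "j < n" "j' < n" for j j'
  proof -
    define l l' where "l = (if j = 0 then n else j)" and "l' = (if j' = 0 then n else j')"
    have l: "1 \<le> l" "l \<le> n" "1 \<le> l'" "l' \<le> n" "l = l' \<longleftrightarrow> j = j'"
      using that by (auto simp: l_def l'_def)
    \<comment> \<open>Both positions lie in \<open>1..n\<close>, so \<open>n\<close> divides
      \<open>m\<close> only if \<open>m = 0\<close>. The half-integer shift of the frequencies is a
      phase independent of \<open>k\<close> and leaves the sum.\<close>
    define m where "m = int l - int l'"
    define h where "h k = cis (2 * pi * of_int m * real k / real n)" for k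
    have "shifted_fourier e n k j * cnj (shifted_fourier e n k j') = cis (pi * real e * of_int m / real n) * h k" for k
      unfolding shifted_fourier_def l_def[symmetric] l'_def[symmetric] fourier_def h_def cis_cnj cis_mult
      by (rule arg_cong[where f = cis]) (use n in \<open>simp add: m_def field_simps\<close>)
    then have "(\<Sum>k<n. shifted_fourier e n k j * cnj (shifted_fourier e n k j'))
        = cis (pi * real e * of_int m / real n) * (\<Sum>k<n. h k)"
      by (simp add: sum_distrib_left)
    also have "(\<Sum>k<n. h k) = (\<Sum>k=1..n. h k)"
    proof -
      have "h n = h 0" using cis_multiple_2pi[of "of_int m"] n by (simp add: h_def mult.assoc)
      then have "h (if k = 0 then n else k) = h k" for k by simp
      then show ?thesis using sum_rotate[OF n, of h] by simp
    qed
    also have "\<dots> = (if int n dvd m then of_nat n else 0)"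
      unfolding h_def by (rule sum_cis_multiples[OF n])
    also have "int n dvd m \<longleftrightarrow> m = 0"
    proof
      assume "int n dvd m"
      then show "m = 0" using dvd_imp_le_int[of m "int n"] l by (cases "m = 0") (auto simp: m_def)
    qed simp
    also have "m = 0 \<longleftrightarrow> j = j'" using l by (simp add: m_def)
    finally show ?thesis using l(5) by (cases "j = j'") (simp_all add: m_def)
  qed
qed

lemma G_shifted_fourier:
  assumes n: "n > 0" and e: "e \<le> 1" and y: "\<And>l. 1 \<le> l \<Longrightarrow> l \<le> n \<Longrightarrow> y l = x (l mod n)"
  shows "fourier_system.G n (shifted_fourier e n) s x
    = (\<Sum>k<n. exp (- (s * ((cmod (dft n e y k))\<^sup>2 / real n)))) / real n"
proof -
  interpret fourier_system n "shifted_fourier e n" by (rule fourier_system_shifted[OF n e])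
  have "dft n e y k = (\<Sum>j<n. shifted_fourier e n k j * of_real (x j))" for k
  proof -
    have "dft n e y k = (\<Sum>j<n. of_real (y (if j = 0 then n else j)) * fourier n e k (if j = 0 then n else j))"
      unfolding dft_def by (rule sum_rotate[OF n, symmetric])
    also have "\<dots> = (\<Sum>j<n. shifted_fourier e n k j * of_real (x j))"
      using n by (intro sum.cong refl) (auto simp: y shifted_fourier_def)
    finally show ?thesis .
  qed
  then have "(cmod (lam x k))\<^sup>2 = (cmod (dft n e y k))\<^sup>2 / real n" for k
    by (simp add: lam_def norm_divide power_divide)
  then show ?thesis by (simp add: G_def)
qed

section \<open>The limit law and its uniqueness\<close>

lemma distribution_function_rayleigh: "distribution_function rayleigh_sym_cdf"
  unfolding distribution_function_def
proof (intro conjI allI)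
  show "mono rayleigh_sym_cdf"
  proof (rule monoI)
    fix t u :: real assume tu: "t \<le> u"
    have half: "exp (- a\<^sup>2) / 2 \<le> 1 / 2" for a :: real by simp
    consider "u < 0" | "t < 0" "0 \<le> u" | "0 \<le> t" using tu by linarith
    then show "rayleigh_sym_cdf t \<le> rayleigh_sym_cdf u"
    proof cases
      case 1
      then have "u\<^sup>2 \<le> t\<^sup>2" using tu by (simp add: abs_le_square_iff[symmetric])
      then show ?thesis using 1 tu by (simp add: rayleigh_sym_cdf_def)
    next
      case 2
      have "exp (- t\<^sup>2) / 2 \<le> 1 - exp (- u\<^sup>2) / 2" using half[of t] half[of u] by linarith
      with 2 show ?thesis by (simp add: rayleigh_sym_cdf_def)
    next
      case 3
      then have "t\<^sup>2 \<le> u\<^sup>2" using tu by (simp add: abs_le_square_iff[symmetric])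
      then show ?thesis using 3 tu by (simp add: rayleigh_sym_cdf_def)
    qed
  qed
  show "continuous (at_right t) rayleigh_sym_cdf" for t
  proof (cases "t < 0")
    case True
    have "\<forall>\<^sub>F u in at_right t. rayleigh_sym_cdf u = exp (- u\<^sup>2) / 2"
      unfolding eventually_at_right_field using True by (intro exI[of _ 0]) (auto simp: rayleigh_sym_cdf_def)
    moreover have "((\<lambda>u. exp (- u\<^sup>2) / 2) \<longlongrightarrow> exp (- t\<^sup>2) / 2) (at_right t)"
      by (intro tendsto_intros) auto
    ultimately have "(rayleigh_sym_cdf \<longlongrightarrow> exp (- t\<^sup>2) / 2) (at_right t)"
      by (subst tendsto_cong)
    then show ?thesis
      unfolding continuous_within using True by (simp add: rayleigh_sym_cdf_def[of t])
  next
    case False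
    have "\<forall>\<^sub>F u in at_right t. rayleigh_sym_cdf u = 1 - exp (- u\<^sup>2) / 2"
      unfolding eventually_at_right_field using False by (intro exI[of _ "t + 1"]) (auto simp: rayleigh_sym_cdf_def)
    moreover have "((\<lambda>u. 1 - exp (- u\<^sup>2) / 2) \<longlongrightarrow> 1 - exp (- t\<^sup>2) / 2) (at_right t)"
      by (intro tendsto_intros) auto
    ultimately have "(rayleigh_sym_cdf \<longlongrightarrow> 1 - exp (- t\<^sup>2) / 2) (at_right t)"
      by (subst tendsto_cong)
    then show ?thesis
      unfolding continuous_within using False by (simp add: rayleigh_sym_cdf_def[of t])
  qed
  have "\<forall>\<^sub>F t in at_bot. rayleigh_sym_cdf t = exp (- t\<^sup>2) / 2"
    using eventually_gt_at_bot[of 0] by eventually_elim (simp add: rayleigh_sym_cdf_def)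
  moreover have "((\<lambda>t :: real. exp (- t\<^sup>2) / 2) \<longlongrightarrow> 0) at_bot" by real_asymp
  ultimately show "(rayleigh_sym_cdf \<longlongrightarrow> 0) at_bot" by (subst tendsto_cong)
  have "\<forall>\<^sub>F t in at_top. rayleigh_sym_cdf t = 1 - exp (- t\<^sup>2) / 2"
    using eventually_ge_at_top[of 0] by eventually_elim (simp add: rayleigh_sym_cdf_def)
  moreover have "((\<lambda>t :: real. 1 - exp (- t\<^sup>2) / 2) \<longlongrightarrow> 1) at_top" by real_asymp
  ultimately show "(rayleigh_sym_cdf \<longlongrightarrow> 1) at_top" by (subst tendsto_cong)
qed

text \<open>By right continuity a difference at \<open>t\<close> persists on an interval to the
  right, where \<open>F\<close> would have to be discontinuous throughout; a monotone function has
  only countably many discontinuities.\<close>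

lemma distribution_function_eqI:
  assumes F: "distribution_function F" and F': "distribution_function F'"
    and eq: "\<And>t. isCont F t \<Longrightarrow> F t = F' t"
  shows "F = F'"
proof (rule ext, rule ccontr)
  fix t assume ne: "F t \<noteq> F' t"
  have "(F \<longlongrightarrow> F t) (at_right t)" "(F' \<longlongrightarrow> F' t) (at_right t)"
    using F F' by (auto simp: distribution_function_def continuous_within)
  then have "((\<lambda>u. F u - F' u) \<longlongrightarrow> F t - F' t) (at_right t)" by (rule tendsto_diff)
  then have "\<forall>\<^sub>F u in at_right t. F u - F' u \<noteq> 0"
    by (rule tendsto_imp_eventually_ne) (use ne in simp)
  then obtain b where b: "b > t" "\<And>u. t < u \<Longrightarrow> u < b \<Longrightarrow> F u \<noteq> F' u"
    unfolding eventually_at_right_field by auto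
  have "{t<..<b} \<subseteq> {u. \<not> isCont F u}"
  proof
    fix u assume "u \<in> {t<..<b}"
    then show "u \<in> {u. \<not> isCont F u}" using b(2)[of u] eq[of u] by auto
  qed
  moreover have "countable {u. \<not> isCont F u}"
    using F by (intro mono_ctble_discont) (simp add: distribution_function_def)
  ultimately have "countable {t<..<b}" by (rule countable_subset)
  then show False using b(1) uncountable_open_interval[of t b] by simp
qed

lemma is_LSD_rayleighI:
  assumes "AE \<omega> in P. \<forall>t. (\<lambda>n. esd (A n \<omega>) t) \<longlonglongrightarrow> rayleigh_sym_cdf t"
  shows "is_LSD P A rayleigh_sym_cdf"
  unfolding is_LSD_def weak_conv_def
  using distribution_function_rayleigh assms by auto

text \<open>Overwriting the single input \<open>x\<^sub>1\<close> accounts for the zero antidiagonal of the sign matrix: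
  it moves \<open>G\<close> by \<open>O(n\<^sup>-\<^sup>1\<^sup>/\<^sup>2)\<close> only.\<close>

lemma esd_hankel_tendsto_of_input:
  fixes P :: "'a measure" and y :: "nat \<Rightarrow> 'a \<Rightarrow> nat \<Rightarrow> real"
  assumes inp: "input_A1 P x \<or> input_A2 P x \<or> input_A3 P x" and e: "e \<le> 1"
    and A: "\<And>n \<omega>. A n \<omega> \<in> carrier_mat n n"
    and A_eq: "\<And>n \<omega> i j. i < n \<Longrightarrow> j < n \<Longrightarrow> A n \<omega> $$ (i, j) = 1 / sqrt (real n) * y n \<omega> (i + j + 2)"
    and period: "\<And>n \<omega> l. 1 \<le> l \<Longrightarrow> l \<le> n \<Longrightarrow> y n \<omega> (l + n) = (- 1) ^ e * y n \<omega> l"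
    and y: "\<And>n \<omega> l. n > 1 \<Longrightarrow> 1 \<le> l \<Longrightarrow> l \<le> n \<Longrightarrow> y n \<omega> l = ((\<lambda>j. x j \<omega>)(1 := c \<omega>)) (l mod n)"
  shows "AE \<omega> in P. \<forall>t. (\<lambda>n. esd (A n \<omega>) t) \<longlonglongrightarrow> rayleigh_sym_cdf t"
proof -
  define g where "g n s z = fourier_system.G n (shifted_fourier e n) s z" for n s z
  have "AE \<omega> in P. (\<lambda>n. g n (real (Suc s)) (\<lambda>j. x j \<omega>)) \<longlonglongrightarrow> 1 / (1 + real (Suc s))" for s
    unfolding g_def by (rule G_tendsto[OF inp]) (auto intro: fourier_system_shifted e)
  then have "AE \<omega> in P. \<forall>s. (\<lambda>n. g n (real (Suc s)) (\<lambda>j. x j \<omega>)) \<longlonglongrightarrow> 1 / (1 + real (Suc s))"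
    unfolding AE_all_countable by blast
  then show ?thesis
  proof (eventually_elim, intro allI)
    fix \<omega> t
    assume lim: "\<forall>s. (\<lambda>n. g n (real (Suc s)) (\<lambda>j. x j \<omega>)) \<longlonglongrightarrow> 1 / (1 + real (Suc s))"
    define x' where "x' = (\<lambda>j. x j \<omega>)(1 := c \<omega>)"
    show "(\<lambda>n. esd (A n \<omega>) t) \<longlonglongrightarrow> rayleigh_sym_cdf t"
    proof (rule esd_hankel_tendsto[OF e, of "\<lambda>n. y n \<omega>", OF period A A_eq])
      fix s :: nat assume s1: "s \<ge> 1"
      then obtain s' where s': "s = Suc s'" by (cases s) auto
      have diff: "(\<lambda>n. g n (real s) x' - g n (real s) (\<lambda>j. x j \<omega>)) \<longlonglongrightarrow> 0"
      proof (rule Lim_null_comparison)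
        have "(\<lambda>n. sqrt ((c \<omega> - x 1 \<omega>)\<^sup>2 / real n)) \<longlonglongrightarrow> sqrt 0"
          by (intro tendsto_real_sqrt lim_const_over_n)
        then show "(\<lambda>n. 2 * real s * sqrt ((c \<omega> - x 1 \<omega>)\<^sup>2 / real n)) \<longlonglongrightarrow> 0"
          by (auto intro!: tendsto_mult_right_zero)
        show "\<forall>\<^sub>F n in sequentially. norm (g n (real s) x' - g n (real s) (\<lambda>j. x j \<omega>))
            \<le> 2 * real s * sqrt ((c \<omega> - x 1 \<omega>)\<^sup>2 / real n)"
          using eventually_gt_at_top[of 1]
        proof eventually_elim
          case (elim n)
          interpret fourier_system n "shifted_fourier e n"
            using elim e by (intro fourier_system_shifted) auto
          have "\<bar>g n (real s) x' - g n (real s) (\<lambda>j. x j \<omega>)\<bar>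
              \<le> 2 * real s * sqrt ((\<Sum>j<n. (x' j - x j \<omega>)\<^sup>2) / real n)"
            unfolding g_def by (rule G_lipschitz) (use s1 in simp)
          also have "(\<Sum>j<n. (x' j - x j \<omega>)\<^sup>2) = (\<Sum>j<n. if j = 1 then (c \<omega> - x 1 \<omega>)\<^sup>2 else 0)"
            by (intro sum.cong refl) (auto simp: x'_def)
          also have "\<dots> = (c \<omega> - x 1 \<omega>)\<^sup>2" using elim by simp
          finally show ?case by simp
        qed
      qed
      have "(\<lambda>n. g n (real s) (\<lambda>j. x j \<omega>)) \<longlonglongrightarrow> 1 / (1 + real s)"
        unfolding s' by (rule lim[rule_format])
      from tendsto_add[OF diff this] have lim': "(\<lambda>n. g n (real s) x') \<longlonglongrightarrow> 1 / (1 + real s)" by simp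
      have "\<forall>\<^sub>F n in sequentially. g n (real s) x'
          = (\<Sum>k<n. exp (- (real s * ((cmod (dft n e (y n \<omega>) k))\<^sup>2 / real n)))) / real n"
        using eventually_gt_at_top[of 1]
        by eventually_elim (unfold g_def, rule G_shifted_fourier, use e in \<open>auto simp: y x'_def\<close>)
      then show "(\<lambda>n. (\<Sum>k<n. exp (- (real s * ((cmod (dft n e (y n \<omega>) k))\<^sup>2 / real n)))) / real n)
          \<longlonglongrightarrow> 1 / (1 + real s)"
        by (rule Lim_transform_eventually[OF lim'])
    qed
  qed
qed

text \<open>The plain case: \<open>c = x 1\<close> overwrites the input by itself.\<close>

lemma esd_scaled_RC_tendsto:
  assumes "input_A1 P x \<or> input_A2 P x \<or> input_A3 P x"
  shows "AE \<omega> in P. \<forall>t. (\<lambda>n. esd (scaled_RC x n \<omega>) t) \<longlonglongrightarrow> rayleigh_sym_cdf t"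
  by (rule esd_hankel_tendsto_of_input[OF assms, where e = 0 and c = "x 1" and y = "\<lambda>n \<omega> l. x (l mod n) \<omega>"])
    (auto simp: scaled_RC_def RC_def)

lemma esd_scaled_RC_hat_tendsto:
  assumes "input_A1 P x \<or> input_A2 P x \<or> input_A3 P x"
  shows "AE \<omega> in P. \<forall>t. (\<lambda>n. esd (scaled_RC_hat x n \<omega>) t) \<longlonglongrightarrow> rayleigh_sym_cdf t"
proof (rule esd_hankel_tendsto_of_input[OF assms])
  \<comment> \<open>The antidiagonal has index sum \<open>n + 1\<close>, which reads the input
    \<open>x 1\<close> once \<open>n > 1\<close>; hence the zero there. The zero at 1 is forced by
    the sign rule, and no matrix entry has index sum 1.\<close>
  define y where "y n \<omega> l = (if l = 1 \<or> l = n + 1 then 0 else if l \<le> n then x (l mod n) \<omega> else - x (l mod n) \<omega>)"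
    for n l \<omega>
  show "scaled_RC_hat x n \<omega> \<in> carrier_mat n n" for n \<omega>
    by (simp add: scaled_RC_hat_def RC_hat_def schur_hadamard_def sign_mat_def)
  show "scaled_RC_hat x n \<omega> $$ (i, j) = 1 / sqrt (real n) * y n \<omega> (i + j + 2)" if "i < n" "j < n" for n \<omega> i j
    using that by (auto simp: scaled_RC_hat_def RC_hat_def schur_hadamard_def sign_mat_def RC_def y_def)
  show "y n \<omega> (l + n) = (- 1) ^ 1 * y n \<omega> l" if "1 \<le> l" "l \<le> n" for n \<omega> l
    using that by (auto simp: y_def)
  show "y n \<omega> l = ((\<lambda>j. x j \<omega>)(1 := 0)) (l mod n)" if "n > 1" "1 \<le> l" "l \<le> n" for n \<omega> l
    using that by (cases "l = n") (auto simp: y_def)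
qed simp

text \<open>Without an input sequence on the type \<open>nat \<Rightarrow> real\<close> the description in \<open>L_RC\<close> would not
  determine a unique function.\<close>

lemma ex_input_A1: "\<exists>(P :: (nat \<Rightarrow> real) measure) x. input_A1 P x"
proof -
  \<comment> \<open>Fair signs: bounded, centred and of variance 1.\<close>
  define p where "p = pmf_of_set {- 1, 1 :: real}"
  define M where "M = distr (measure_pmf p) borel (\<lambda>y. y)"
  define P where "P = PiM (UNIV :: nat set) (\<lambda>_. M)"
  define x where "x i \<omega> = \<omega> i" for i :: nat and \<omega> :: "nat \<Rightarrow> real"
  have prob_M: "prob_space M" unfolding M_def by (rule measure_pmf.prob_space_distr) simp
  interpret PP: product_prob_space "\<lambda>_ :: nat. M" UNIV
    using prob_M by (intro product_prob_spaceI)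
  have sets_M: "sets M = sets borel" by (simp add: M_def)
  interpret P: prob_space P unfolding P_def by (rule PP.prob_space_axioms)
  have xM: "x i \<in> measurable P M" for i
    unfolding x_def P_def by (rule measurable_component_singleton) simp
  have xm[measurable]: "x i \<in> borel_measurable P" for i
    using xM[of i] measurable_cong_sets[OF refl sets_M] by blast
  have dist_x: "distr P borel (x i) = M" for i
  proof -
    have "distr P borel (x i) = distr P M (x i)" by (rule distr_cong) (simp_all add: sets_M)
    also have "\<dots> = M" unfolding P_def x_def by (rule PP.PiM_component) simp
    finally show ?thesis .
  qed
  have E: "(\<integral>\<omega>. f (x i \<omega>) \<partial>P) = (f (- 1) + f 1) / 2" if [measurable]: "f \<in> borel_measurable borel"
    for f :: "real \<Rightarrow> real" and i
  proof -
    have "(\<integral>\<omega>. f (x i \<omega>) \<partial>P) = (\<integral>y. f y \<partial>M)"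
      using integral_distr[OF xm that, of i] by (simp add: dist_x)
    also have "\<dots> = (\<integral>y. f y \<partial>measure_pmf p)"
      unfolding M_def by (rule integral_distr) auto
    also have "\<dots> = (f (- 1) + f 1) / 2"
      unfolding p_def by (subst integral_pmf_of_set) auto
    finally show ?thesis .
  qed
  have bnd: "AE \<omega> in P. \<bar>x i \<omega>\<bar> \<le> 1" for i
  proof -
    have "AE y in M. \<bar>y\<bar> \<le> 1"
      unfolding M_def by (subst AE_distr_iff) (auto simp: p_def AE_measure_pmf_iff)
    then have "AE y in distr P borel (x i). \<bar>y\<bar> \<le> 1" unfolding dist_x .
    then show ?thesis by (subst (asm) AE_distr_iff) auto
  qed
  have int: "integrable P (x i)" "integrable P (\<lambda>\<omega>. (x i \<omega>)\<^sup>2)" for i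
  proof -
    show "integrable P (x i)" by (rule P.integrable_const_bound[of _ 1]) (use bnd in auto)
    have "AE \<omega> in P. (x i \<omega>)\<^sup>2 \<le> 1"
      using bnd[of i] by eventually_elim (simp add: abs_square_le_1)
    then show "integrable P (\<lambda>\<omega>. (x i \<omega>)\<^sup>2)" by (intro P.integrable_const_bound[of _ 1]) auto
  qed
  have indep: "P.indep_vars (\<lambda>_. borel) x UNIV"
  proof (subst P.indep_vars_iff_distr_eq_PiM)
    have sP: "sets P = sets (PiM UNIV (\<lambda>_ :: nat. borel :: real measure))"
      unfolding P_def by (intro sets_PiM_cong refl) (rule sets_M)
    have "distr P (PiM UNIV (\<lambda>_. borel)) (\<lambda>\<omega>. \<lambda>i\<in>UNIV. x i \<omega>) = distr P P (\<lambda>\<omega>. \<omega>)"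
      by (rule distr_cong) (simp_all add: sP x_def restrict_def)
    also have "\<dots> = P" by (rule distr_id)
    finally show "distr P (PiM UNIV (\<lambda>_. borel)) (\<lambda>\<omega>. \<lambda>i\<in>UNIV. x i \<omega>) = PiM UNIV (\<lambda>i. distr P borel (x i))"
      unfolding dist_x by (simp only: P_def)
  qed auto
  have "std_input P x"
    unfolding std_input_def using P.prob_space_axioms indep int E[of "\<lambda>y. y"] E[of "\<lambda>y. y\<^sup>2"] by simp
  then show ?thesis using bnd unfolding input_A1_def by blast
qed

text \<open>Uniqueness needs a single admissible input and a single outcome at which both limits
  hold. The explicit formula then carries the limit from the sequence space to inputs on an
  arbitrary probability space.\<close>

lemma L_RC_eq: "L_RC = rayleigh_sym_cdf"
  unfolding L_RC_def
proof (rule the_equality)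
  show "\<forall>(P :: (nat \<Rightarrow> real) measure) x. input_A1 P x \<or> input_A2 P x \<or> input_A3 P x \<longrightarrow>
      is_LSD P (scaled_RC x) rayleigh_sym_cdf"
    using is_LSD_rayleighI[OF esd_scaled_RC_tendsto] by blast
  fix F
  assume F: "\<forall>(P :: (nat \<Rightarrow> real) measure) x. input_A1 P x \<or> input_A2 P x \<or> input_A3 P x \<longrightarrow>
      is_LSD P (scaled_RC x) F"
  obtain P :: "(nat \<Rightarrow> real) measure" and x where A1: "input_A1 P x" using ex_input_A1 by blast
  interpret prob_space P using A1 by (simp add: input_A1_def std_input_def)
  have LF: "is_LSD P (scaled_RC x) F" using F A1 by blast
  have esd_lim: "AE \<omega> in P. \<forall>t. (\<lambda>n. esd (scaled_RC x n \<omega>) t) \<longlonglongrightarrow> rayleigh_sym_cdf t"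
    using A1 by (intro esd_scaled_RC_tendsto) blast
  have "AE \<omega> in P. weak_conv (\<lambda>n. esd (scaled_RC x n \<omega>)) F \<and>
      (\<forall>t. (\<lambda>n. esd (scaled_RC x n \<omega>) t) \<longlonglongrightarrow> rayleigh_sym_cdf t)"
    using LF esd_lim by (simp add: is_LSD_def)
  then have "\<exists>\<omega>. weak_conv (\<lambda>n. esd (scaled_RC x n \<omega>)) F \<and>
      (\<forall>t. (\<lambda>n. esd (scaled_RC x n \<omega>) t) \<longlonglongrightarrow> rayleigh_sym_cdf t)"
    using eventually_happens'[OF ae_filter_bot] by blast
  then obtain \<omega> where w: "weak_conv (\<lambda>n. esd (scaled_RC x n \<omega>)) F"
      "\<And>t. (\<lambda>n. esd (scaled_RC x n \<omega>) t) \<longlonglongrightarrow> rayleigh_sym_cdf t" by blast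
  show "F = rayleigh_sym_cdf"
  proof (rule distribution_function_eqI)
    show "distribution_function F" using LF by (simp add: is_LSD_def)
    show "distribution_function rayleigh_sym_cdf" by (rule distribution_function_rayleigh)
    fix t assume "isCont F t"
    then have "(\<lambda>n. esd (scaled_RC x n \<omega>) t) \<longlonglongrightarrow> F t"
      using w(1) by (simp add: weak_conv_def)
    moreover have "(\<lambda>n. esd (scaled_RC x n \<omega>) t) \<longlonglongrightarrow> rayleigh_sym_cdf t"
      by (rule w(2))
    ultimately show "F t = rayleigh_sym_cdf t" by (rule LIMSEQ_unique)
  qed
qed

theorem theorem5p1:
  fixes P :: "'a measure" and x :: "nat \<Rightarrow> 'a \<Rightarrow> real"
  assumes "input_A1 P x \<or> input_A2 P x \<or> input_A3 P x"
  shows "is_LSD P (scaled_RC x) L_RC \<and> is_LSD P (scaled_RC_hat x) L_RC"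
  unfolding L_RC_eq
  by (intro conjI is_LSD_rayleighI esd_scaled_RC_tendsto esd_scaled_RC_hat_tendsto assms)

end
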